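(* Let $d\ge1$ and let $X_1,X_2,\dots$ be i.i.d. random vectors in $\mathbb{R}^d$ with density $f\in\mathcal{P}_{C,4}$ for some $C<\infty$. Suppose the kernel $K:\mathbb{R}^d\to\mathbb{R}$ has the form $K(t)=\Phi(\|t\|^2)$ for some real function $\Phi$ with uniformly bounded second order derivative and with support contained in $[0,T]$, $T<\infty$, and that $K$ is non-negative and integrates to $1$. Let $c>0$, let $p:\mathbb{R}\to\mathbb{R}$ be a nondecreasing clipping function, that is, $p(s)\ge1$ for all $s$ and $p(s)=s$ for all $s\ge t_0$ for some $1\le t_0<\infty$, with five bounded and uniformly continuous derivatives, and set $\alpha(s)=c\,p^{1/2}(s/c^2)$. Let $$\bar f(t;h_{2,n})=\frac{1}{nh_{2,n}^d}\sum_{i=1}^{n}\alpha^d(f(X_i))K\bigl(h_{2,n}^{-1}\alpha(f(X_i))(t-X_i)\bigr),$$ where $h_{2,n}>0$, $h_{2,n}\to0$ and $nh_{2,n}^d\to\infty$. Let $\mu_0=\int_{\mathbb{R}^d}K^2(u)\,du$. (i) For all $t\in\mathbb{R}^d$, as $n\to\infty$, $$\sqrt{nh_{2,n}^d}\,[\bar f(t;h_{2,n})-\mathbb{E}\bar f(t;h_{2,n})]\xrightarrow{D}N\bigl(0,\alpha^d(f(t))f(t)\mu_0\bigr).$$ (ii) If moreover $h_{2,n}=c_2n^{-1/(8+d)}$ for some constant $c_2>0$, then for every $r>0$ and every $t\in\mathcal{D}_r$, as $n\to\infty$, $$\sqrt{nh_{2,n}^d}\,[\bar f(t;h_{2,n})-f(t)]\xrightarrow{D}N\left(c_2^{(d+8)/2}\sum_{|v|=4}\frac{\tau_vD_v(1/f)(t)}{v!},\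 \alpha^d(f(t))f(t)\mu_0\right).$$
   Context: $\mathcal{P}_{C,k}$ is the set of probability densities on $\mathbb{R}^d$ which, together with all their partial derivatives of order $k$ or lower, are bounded by $C<\infty$ and are uniformly continuous. $\mathcal{D}_r=\{t\in\mathbb{R}^d: f(t)>r>t_0c^2,\ \|t\|<1/r\}$ (empty unless $r>t_0c^2$). $\alpha^d(s)$ means $(\alpha(s))^d$. For a multi-index $v=(v_1,\dots,v_d)\in(\mathbb{N}\cup\{0\})^d$: $|v|=\sum_iv_i$, $v!=v_1!\cdots v_d!$, $u^v=u_1^{v_1}\cdots u_d^{v_d}$, $D_v$ is the partial derivative of order $v_i$ in the $i$-th coordinate for each $i$, and $\tau_v=\int_{\mathbb{R}^d}u^vK(u)\,du$. $\Phi$ is regarded as a function on $[0,\infty)$. $\xrightarrow{D}$ denotes convergence in distribution; $N(0,0)$ is the point mass at $0$. *)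

theory Defs
  imports "HOL-Probability.Probability"
begin

definition partial_deriv :: "'n \<Rightarrow> (real^'n::finite \<Rightarrow> real) \<Rightarrow> real^'n \<Rightarrow> real" where
  "partial_deriv i g x = deriv (\<lambda>s. g (x + s *\<^sub>R axis i 1)) 0"

definition partially_differentiable_at :: "'n \<Rightarrow> (real^'n::finite \<Rightarrow> real) \<Rightarrow> real^'n \<Rightarrow> bool" where
  "partially_differentiable_at i g x \<longleftrightarrow> (\<lambda>s. g (x + s *\<^sub>R axis i 1)) differentiable (at 0)"

text \<open>The partial derivatives of order \<open>m\<close> are the functions \<open>iter_partial is g\<close>
  with \<open>length is = m\<close>.\<close>

definition iter_partial :: "'n list \<Rightarrow> (real^'n::finite \<Rightarrow> real) \<Rightarrow> real^'n \<Rightarrow> real" where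
  "iter_partial is g = foldr partial_deriv is g"

text \<open>The index type carries no order, so some order of differentiation is fixed by choice; it is
  irrelevant wherever the partial derivatives of order \<open>|v|\<close> or lower are continuous.\<close>

definition multi_deriv :: "('n \<Rightarrow> nat) \<Rightarrow> (real^'n::finite \<Rightarrow> real) \<Rightarrow> real^'n \<Rightarrow> real" where
  "multi_deriv v g = iter_partial (SOME is. \<forall>i. count_list is i = v i) g"

definition mi_abs :: "('n::finite \<Rightarrow> nat) \<Rightarrow> nat" where
  "mi_abs v = (\<Sum>i\<in>UNIV. v i)"

definition mi_fact :: "('n::finite \<Rightarrow> nat) \<Rightarrow> real" where
  "mi_fact v = (\<Prod>i\<in>UNIV. fact (v i))"

definition mi_power :: "real^'n::finite \<Rightarrow> ('n \<Rightarrow> nat) \<Rightarrow> real" where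
  "mi_power u v = (\<Prod>i\<in>UNIV. (u $ i) ^ v i)"

definition kernel_moment :: "(real^'n::finite \<Rightarrow> real) \<Rightarrow> ('n \<Rightarrow> nat) \<Rightarrow> real" where
  "kernel_moment K v = (LINT u|lborel. mi_power u v * K u)"

definition density_class :: "real \<Rightarrow> nat \<Rightarrow> (real^'n::finite \<Rightarrow> real) set" where
  "density_class C k = {f.
     (\<forall>x. 0 \<le> f x) \<and> has_bochner_integral lborel f 1 \<and>
     (\<forall>is i x. length is < k \<longrightarrow> partially_differentiable_at i (iter_partial is f) x) \<and>
     (\<forall>is. length is \<le> k \<longrightarrow>
        (\<forall>x. \<bar>iter_partial is f x\<bar> \<le> C) \<and> uniformly_continuous_on UNIV (iter_partial is f))}"

text \<open>\<open>\<Phi>\<close> is a function on \<open>[0,\<infinity>)\<close>: derivatives at \<open>0\<close> are one-sided and values at negative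
  arguments are irrelevant.\<close>

definition kernel_profile :: "(real \<Rightarrow> real) \<Rightarrow> real \<Rightarrow> bool" where
  "kernel_profile \<Phi> T \<longleftrightarrow>
     (\<exists>\<Phi>1 \<Phi>2 B. \<forall>s\<ge>0.
        (\<Phi> has_real_derivative \<Phi>1 s) (at s within {0..}) \<and>
        (\<Phi>1 has_real_derivative \<Phi>2 s) (at s within {0..}) \<and>
        \<bar>\<Phi>2 s\<bar> \<le> B) \<and>
     closure {s\<in>{0..}. \<Phi> s \<noteq> 0} \<subseteq> {0..T}"

text \<open>The five derivatives are those of orders \<open>1\<close> to \<open>5\<close>; \<open>p\<close> itself is unbounded.\<close>

definition clipping_function :: "(real \<Rightarrow> real) \<Rightarrow> real \<Rightarrow> bool" where
  "clipping_function p t0 \<longleftrightarrow>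
     1 \<le> t0 \<and> mono p \<and> (\<forall>s. 1 \<le> p s) \<and> (\<forall>s\<ge>t0. p s = s) \<and>
     (\<forall>j<5. \<forall>s. ((deriv ^^ j) p) differentiable (at s)) \<and>
     (\<forall>j\<in>{1..5}. bounded (range ((deriv ^^ j) p)) \<and> uniformly_continuous_on UNIV ((deriv ^^ j) p))"

definition bandwidth_factor :: "real \<Rightarrow> (real \<Rightarrow> real) \<Rightarrow> real \<Rightarrow> real" where
  "bandwidth_factor c p s = c * sqrt (p (s / c\<^sup>2))"

text \<open>The sample is indexed from \<open>0\<close>: \<open>x i\<close> stands for \<open>X\<^sub>i\<^sub>+\<^sub>1\<close>.\<close>

definition ideal_estimator ::
  "(real \<Rightarrow> real) \<Rightarrow> (real^'n::finite \<Rightarrow> real) \<Rightarrow> (real^'n \<Rightarrow> real) \<Rightarrow> nat \<Rightarrow> real \<Rightarrow> (nat \<Rightarrow> real^'n) \<Rightarrow> real^'n \<Rightarrow> real"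
  where
  "ideal_estimator \<alpha> f K n h x t =
     1 / (real n * h ^ CARD('n)) *
     (\<Sum>i<n. \<alpha> (f (x i)) ^ CARD('n) * K ((inverse h * \<alpha> (f (x i))) *\<^sub>R (t - x i)))"

definition good_region :: "(real^'n::finite \<Rightarrow> real) \<Rightarrow> real \<Rightarrow> real \<Rightarrow> real \<Rightarrow> (real^'n) set" where
  "good_region f t0 c r = {t. f t > r \<and> r > t0 * c\<^sup>2 \<and> norm t < 1 / r}"

text \<open>\<open>v\<close> is the variance, whereas \<open>normal_density\<close> takes the standard deviation (and must not be
  used with standard deviation \<open>0\<close>).\<close>

definition normal_law :: "real \<Rightarrow> real \<Rightarrow> real measure" where
  "normal_law m v =
     (if v = 0 then return borel m else density lborel (\<lambda>x. ennreal (normal_density m (sqrt v) x)))"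

definition converges_in_distribution ::
  "'w measure \<Rightarrow> (nat \<Rightarrow> 'w \<Rightarrow> real) \<Rightarrow> real measure \<Rightarrow> bool" where
  "converges_in_distribution M Z N \<longleftrightarrow> weak_conv_m (\<lambda>n. distr M borel (Z n)) N"

end

theory Submission
  imports Defs "HOL-Combinatorics.Multiset_Permutations"
begin

text \<open>The fluctuations of the estimator form a triangular array with bounded independent rows, so that (i) is a
  Lindeberg-type limit theorem proved through characteristic functions; (ii) adds the deterministic
  shift \<open>\<surd>(n h\<^sup>d) (E fbar - f t)\<close>.

  For the bias put \<open>g = 1 / f\<close>. Near \<open>t\<close> one has \<open>\<alpha> \<circ> f = \<surd>f\<close>, and
  \<open>E fbar = \<integral> f(t + h u)\<^bsup>d/2 + 1\<^esup> \<Phi>(f(t + h u) |u|\<^sup>2) du\<close>. Since \<open>\<Phi>\<close> is Lipschitz, \<open>f\<close> may be replaced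
  by \<open>1 / \<rho>\<^sup>2\<close>, where \<open>\<rho>\<close> is a polynomial in \<open>h\<close> and \<open>\<rho>\<^sup>2\<close> has the Taylor polynomial of \<open>g(t + h u)\<close>,
  at the cost \<open>o(h\<^sup>4)\<close>. The radial substitution \<open>v = u / \<rho>\<close> then removes \<open>h\<close> from the argument of
  \<open>\<Phi>\<close>, which has too few derivatives for a direct expansion, and turns the integral into \<open>\<integral> K(v) (f t - c\<^sub>1(v) h + c\<^sub>3(v) h\<^sup>3 + c\<^sub>4(v) h\<^sup>4) dv\<close>, where \<open>c\<^sub>1\<close> and \<open>c\<^sub>3\<close> are odd and
  \<open>c\<^sub>4\<close> is the Taylor form of order 4 of \<open>g\<close>.\<close>

text \<open>Origin of the odd coefficients and of the form of order 4: the coefficient of h^i in rho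
  is homogeneous of degree i in u, so on a ray rho is a function of one variable x, proportional to
  h |u|, and the radial substitution reads y = x / rho(x), with dy/dx = (rho - x rho') / rho^2.
  After it, the power rho^(-(d+2)) leaves the weight 1 / (rho (rho - x rho')), which has to be
  expanded in y. By Lagrange inversion its coefficient of y^n is the coefficient of x^n in
  rho^(n-2). For n = 2 that power is the constant 1, so the usual bias of second order vanishes; for
  n = 4 it is rho^2, so derivatives of 1 / f appear and not those of f. The code verifies this
  inversion by an identity with an explicit remainder divisible by h^5, which keeps every error
  uniform over bounded u. The substitution itself is carried out ray by ray in one variable.\<close>

section \<open>Partial derivatives and Taylor expansion\<close>

text \<open>Continuity is demanded at every level because partial differentiability alone does not
  give it. The recursion passes to the partial derivatives of \<open>g\<close>, so closure under
  products and reciprocals goes by induction on the order.\<close>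

primrec C_partial :: "nat \<Rightarrow> (real^'n::finite) set \<Rightarrow> (real^'n \<Rightarrow> real) \<Rightarrow> bool" where
  "C_partial 0 S g \<longleftrightarrow> continuous_on S g"
| "C_partial (Suc k) S g \<longleftrightarrow> continuous_on S g \<and>
     (\<forall>i. (\<forall>x\<in>S. partially_differentiable_at i g x) \<and> C_partial k S (partial_deriv i g))"

lemma partial_deriv_DERIV:
  assumes "partially_differentiable_at i g (x + a *\<^sub>R axis i 1)"
  shows "((\<lambda>s. g (x + s *\<^sub>R axis i 1)) has_real_derivative partial_deriv i g (x + a *\<^sub>R axis i 1)) (at a)"
proof -
  have "((\<lambda>s. g ((x + a *\<^sub>R axis i 1) + s *\<^sub>R axis i 1)) has_real_derivative partial_deriv i g (x + a *\<^sub>R axis i 1)) (at 0)"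
    using assms unfolding partially_differentiable_at_def partial_deriv_def
    by (simp add: DERIV_deriv_iff_real_differentiable)
  then show ?thesis
    using DERIV_shift[of "\<lambda>s. g (x + s *\<^sub>R axis i 1)" _ 0 a] by (simp add: algebra_simps)
qed

lemma partial_deriv_DERIV0:
  "partially_differentiable_at i g x \<Longrightarrow> ((\<lambda>s. g (x + s *\<^sub>R axis i 1)) has_real_derivative partial_deriv i g x) (at 0)"
  using partial_deriv_DERIV[of i g x 0] by simp

lemma partial_derivI:
  assumes "((\<lambda>s. g (x + s *\<^sub>R axis i 1)) has_real_derivative D) (at 0)"
  shows "partially_differentiable_at i g x" "partial_deriv i g x = D"
  using assms by (auto simp: partially_differentiable_at_def partial_deriv_def real_differentiable_def DERIV_imp_deriv)

lemma partial_deriv_cong: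
  assumes "open S" "x \<in> S" "\<And>y. y \<in> S \<Longrightarrow> g y = g' y"
  shows "partial_deriv i g x = partial_deriv i g' x"
    and "partially_differentiable_at i g x \<longleftrightarrow> partially_differentiable_at i g' x"
proof -
  have "((\<lambda>s. x + s *\<^sub>R axis i 1) \<longlongrightarrow> x + 0 *\<^sub>R axis i 1) (nhds 0)"
    by (intro tendsto_intros filterlim_ident)
  then have "\<forall>\<^sub>F s in nhds 0. x + s *\<^sub>R axis i 1 \<in> S"
    using topological_tendstoD[OF _ assms(1)] assms(2) by fastforce
  then have ev: "\<forall>\<^sub>F s in nhds 0. g (x + s *\<^sub>R axis i 1) = g' (x + s *\<^sub>R axis i 1)"
    by eventually_elim (rule assms(3))
  show "partial_deriv i g x = partial_deriv i g' x"
    unfolding partial_deriv_def by (rule deriv_cong_ev[OF ev refl])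
  show "partially_differentiable_at i g x \<longleftrightarrow> partially_differentiable_at i g' x"
    unfolding partially_differentiable_at_def real_differentiable_def
    by (intro ex_cong1 DERIV_cong_ev refl ev)
qed

lemma C_partial_cong:
  assumes "open S" "\<And>x. x \<in> S \<Longrightarrow> g x = g' x"
  shows "C_partial k S g \<longleftrightarrow> C_partial k S g'"
  using assms(2)
proof (induction k arbitrary: g g')
  case 0
  then show ?case by (simp cong: continuous_on_cong)
next
  case (Suc k)
  have "C_partial k S (partial_deriv i g) \<longleftrightarrow> C_partial k S (partial_deriv i g')" for i
    by (rule Suc.IH) (rule partial_deriv_cong[OF assms(1) _ Suc.prems])
  moreover have "(\<forall>x\<in>S. partially_differentiable_at i g x) \<longleftrightarrow> (\<forall>x\<in>S. partially_differentiable_at i g' x)" for i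
    by (intro ball_cong refl partial_deriv_cong(2)[OF assms(1) _ Suc.prems])
  ultimately show ?case using Suc.prems by (simp cong: continuous_on_cong)
qed

text \<open>Lets the closure proofs name a formula \<open>D i\<close> for the derivative, which has
  to agree with \<open>partial_deriv i g\<close> only on \<open>S\<close>.\<close>

lemma C_partial_SucI:
  assumes "open S" "continuous_on S g"
    and "\<And>i x. x \<in> S \<Longrightarrow> ((\<lambda>s. g (x + s *\<^sub>R axis i 1)) has_real_derivative D i x) (at 0)"
    and "\<And>i. C_partial k S (D i)"
  shows "C_partial (Suc k) S g"
proof -
  have "C_partial k S (partial_deriv i g) \<longleftrightarrow> C_partial k S (D i)" for i
    by (rule C_partial_cong[OF assms(1)]) (rule partial_derivI[OF assms(3)])
  then show ?thesis using assms partial_derivI(1)[OF assms(3)] by auto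
qed

lemma C_partial_continuous: "C_partial k S g \<Longrightarrow> continuous_on S g"
  by (cases k) auto

lemma C_partial_Suc_imp: "C_partial (Suc k) S g \<Longrightarrow> C_partial k S g"
proof (induction k arbitrary: g)
  case 0
  then show ?case by simp
next
  case (Suc k)
  have "C_partial (Suc k) S (partial_deriv i g)" for i
    using Suc.prems unfolding C_partial.simps(2)[of "Suc k"] by blast
  then have "C_partial k S (partial_deriv i g)" for i
    by (rule Suc.IH)
  then show ?case using Suc.prems by simp
qed

lemma C_partial_mono: "C_partial k S g \<Longrightarrow> j \<le> k \<Longrightarrow> C_partial j S g"
  by (induction k) (auto simp: le_Suc_eq intro: C_partial_Suc_imp simp del: C_partial.simps)

lemma C_partial_subset: "C_partial k S g \<Longrightarrow> S' \<subseteq> S \<Longrightarrow> C_partial k S' g"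
  by (induction k arbitrary: g) (auto intro: continuous_on_subset)

lemma C_partial_const: "C_partial k S (\<lambda>_. c)"
proof (induction k arbitrary: c)
  case (Suc k)
  have "partial_deriv i (\<lambda>_. c) = (\<lambda>_. 0)" for i :: 'a
    by (simp add: partial_deriv_def fun_eq_iff)
  then show ?case using Suc by (simp add: partially_differentiable_at_def)
qed simp

lemma C_partial_add:
  assumes "open S"
  shows "C_partial k S g \<Longrightarrow> C_partial k S g' \<Longrightarrow> C_partial k S (\<lambda>x. g x + g' x)"
proof (induction k arbitrary: g g')
  case (Suc k)
  show ?case
  proof (rule C_partial_SucI[OF assms])
    show "((\<lambda>s. g (x + s *\<^sub>R axis i 1) + g' (x + s *\<^sub>R axis i 1)) has_real_derivative partial_deriv i g x + partial_deriv i g' x) (at 0)"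
      if "x \<in> S" for x i
      using Suc.prems that by (intro DERIV_add partial_deriv_DERIV0) auto
  qed (use Suc in \<open>auto intro: continuous_on_add\<close>)
qed (auto intro: continuous_on_add)

lemma C_partial_mult:
  assumes "open S"
  shows "C_partial k S g \<Longrightarrow> C_partial k S g' \<Longrightarrow> C_partial k S (\<lambda>x. g x * g' x)"
proof (induction k arbitrary: g g')
  case (Suc k)
  show ?case
  proof (rule C_partial_SucI[OF assms])
    show "((\<lambda>s. g (x + s *\<^sub>R axis i 1) * g' (x + s *\<^sub>R axis i 1)) has_real_derivative partial_deriv i g x * g' x + partial_deriv i g' x * g x) (at 0)"
      if "x \<in> S" for x i
    proof -
      have "partially_differentiable_at i g x" "partially_differentiable_at i g' x"
        using Suc.prems that by auto
      from DERIV_mult[OF this[THEN partial_deriv_DERIV0]] show ?thesis by simp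
    qed
    show "C_partial k S (\<lambda>x. partial_deriv i g x * g' x + partial_deriv i g' x * g x)" for i
      using Suc.prems Suc.prems[THEN C_partial_Suc_imp] by (intro C_partial_add[OF assms] Suc.IH) auto
  qed (use Suc.prems in \<open>auto intro: continuous_on_mult\<close>)
qed (auto intro: continuous_on_mult)

lemma C_partial_inverse:
  assumes "open S" "\<And>x. x \<in> S \<Longrightarrow> g x \<noteq> 0"
  shows "C_partial k S g \<Longrightarrow> C_partial k S (\<lambda>x. 1 / g x)"
proof (induction k)
  case (Suc k)
  show ?case
  proof (rule C_partial_SucI[OF assms(1)])
    \<comment> \<open>The derivative is written as a product containing \<open>1 / g\<close> twice,
      so that the induction hypothesis and closure under products apply.\<close>
    show "((\<lambda>s. 1 / g (x + s *\<^sub>R axis i 1)) has_real_derivative (- 1) * (partial_deriv i g x * ((1 / g x) * (1 / g x)))) (at 0)"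
      if "x \<in> S" for x i
      using Suc.prems that assms(2)[OF that] partial_deriv_DERIV0[of i g x]
      by (auto intro!: derivative_eq_intros simp: power2_eq_square)
    have "C_partial k S (\<lambda>x. 1 / g x)"
      by (rule Suc.IH[OF C_partial_Suc_imp[OF Suc.prems]])
    then show "C_partial k S (\<lambda>x. (- 1) * (partial_deriv i g x * ((1 / g x) * (1 / g x))))" for i
      using Suc.prems by (intro C_partial_mult[OF assms(1)] C_partial_const) auto
  qed (use Suc.prems assms(2) in \<open>auto intro!: continuous_on_divide\<close>)
qed (use assms(2) in \<open>auto intro!: continuous_on_divide\<close>)

lemma iter_partial_simps [simp]:
  "iter_partial [] g = g" "iter_partial (i # is) g = partial_deriv i (iter_partial is g)"
  by (simp_all add: iter_partial_def)

lemma C_partial_iter_partial: "C_partial (length is + m) S g \<Longrightarrow> C_partial m S (iter_partial is g)"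
proof (induction "is" arbitrary: m)
  case (Cons i "is")
  then have "C_partial (Suc m) S (iter_partial is g)" by (simp del: C_partial.simps)
  then show ?case by simp
qed simp

lemma density_class_C_partial:
  assumes "f \<in> density_class C k"
  shows "C_partial k UNIV f"
proof -
  \<comment> \<open>Induction on the number \<open>j\<close> of derivatives still available, with
    the list of those already taken kept general.\<close>
  have "length is + j \<le> k \<Longrightarrow> C_partial j UNIV (iter_partial is f)" for "is" j
  proof (induction j arbitrary: "is")
    case 0
    then show ?case using assms by (auto simp: density_class_def intro: uniformly_continuous_imp_continuous)
  next
    case (Suc j)
    have "C_partial j UNIV (partial_deriv i (iter_partial is f))" for i
      using Suc.IH[of "i # is"] Suc.prems by simp
    then show ?case
      using Suc.prems assms by (auto simp: density_class_def intro: uniformly_continuous_imp_continuous)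
  qed
  from this[of "[]" k] show ?thesis by simp
qed

section \<open>Total differentiability and symmetry of mixed derivatives\<close>

lemma partial_mvt:
  assumes "\<And>a. \<bar>a\<bar> \<le> \<bar>s\<bar> \<Longrightarrow> partially_differentiable_at i g (x + a *\<^sub>R axis i 1)"
  shows "\<exists>\<theta>. \<bar>\<theta>\<bar> \<le> \<bar>s\<bar> \<and> g (x + s *\<^sub>R axis i 1) - g x = s * partial_deriv i g (x + \<theta> *\<^sub>R axis i 1)"
proof -
  let ?G = "\<lambda>a. g (x + a *\<^sub>R axis i 1)"
  have D: "(?G has_real_derivative partial_deriv i g (x + a *\<^sub>R axis i 1)) (at a)" if "\<bar>a\<bar> \<le> \<bar>s\<bar>" for a
    by (rule partial_deriv_DERIV[OF assms[OF that]])
  consider "s = 0" | "0 < s" | "s < 0" by linarith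
  then show ?thesis
  proof cases
    case 2
    obtain z where "0 < z" "z < s" "?G s - ?G 0 = (s - 0) * partial_deriv i g (x + z *\<^sub>R axis i 1)"
      using MVT2[OF 2, of ?G "\<lambda>a. partial_deriv i g (x + a *\<^sub>R axis i 1)"] D by auto
    then show ?thesis by (intro exI[of _ z]) auto
  next
    case 3
    obtain z where "s < z" "z < 0" "?G 0 - ?G s = (0 - s) * partial_deriv i g (x + z *\<^sub>R axis i 1)"
      using MVT2[OF 3, of ?G "\<lambda>a. partial_deriv i g (x + a *\<^sub>R axis i 1)"] D by auto
    then show ?thesis by (intro exI[of _ z]) auto
  qed (intro exI[of _ 0], simp)
qed

text \<open>The increment is split into moves along one coordinate axis at a time. The mean value
  theorem treats each move, and continuity of the partial derivatives at \<open>x\<close> bounds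
  each error by \<open>e / n * norm v\<close>, where \<open>n\<close> is the dimension.\<close>

lemma C_partial_has_derivative:
  fixes g :: "real^'n::finite \<Rightarrow> real"
  assumes "C_partial (Suc k) S g" "open S" "x \<in> S"
  shows "(g has_derivative (\<lambda>v. \<Sum>i\<in>UNIV. v $ i * partial_deriv i g x)) (at x)"
  unfolding has_derivative_at_alt
proof (intro conjI allI impI)
  show "bounded_linear (\<lambda>v. \<Sum>i\<in>UNIV. v $ i * partial_deriv i g x)"
    by (intro bounded_linear_sum bounded_linear_mult_left bounded_linear_vec_nth
        bounded_linear_compose[OF bounded_linear_mult_left])
  fix e :: real assume e: "0 < e"
  define n where "n = real CARD('n)"
  have n: "0 < n" by (simp add: n_def)
  have cont: "continuous_on S (partial_deriv i g)" for i
    using assms(1) by (auto intro: C_partial_continuous)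
  have "\<forall>\<^sub>F y in nhds x. \<bar>partial_deriv i g y - partial_deriv i g x\<bar> < e / n" for i
  proof -
    have "(partial_deriv i g \<longlongrightarrow> partial_deriv i g x) (nhds x)"
      using cont[of i] assms(2,3) by (simp add: continuous_on_eq_continuous_at isCont_def tendsto_at_iff_tendsto_nhds)
    from tendstoD[OF this, of "e / n"] show ?thesis
      using e n by (simp add: dist_real_def)
  qed
  then have "\<forall>\<^sub>F y in nhds x. \<forall>i\<in>UNIV. \<bar>partial_deriv i g y - partial_deriv i g x\<bar> < e / n"
    by (intro eventually_ball_finite) auto
  moreover have "\<forall>\<^sub>F y in nhds x. y \<in> S"
    using assms(2,3) by (rule eventually_nhds_in_open)
  ultimately have "\<forall>\<^sub>F y in nhds x. (\<forall>i. \<bar>partial_deriv i g y - partial_deriv i g x\<bar> < e / n) \<and> y \<in> S"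
    by eventually_elim auto
  then obtain d where d: "0 < d" "\<And>y i. dist y x < d \<Longrightarrow> \<bar>partial_deriv i g y - partial_deriv i g x\<bar> < e / n"
    "\<And>y. dist y x < d \<Longrightarrow> y \<in> S"
    unfolding eventually_nhds_metric by auto
  have main: "\<bar>g (x + v) - g x - (\<Sum>i\<in>UNIV. v $ i * partial_deriv i g x)\<bar> \<le> e * norm v" if v: "norm v < d" for v
  proof -
    \<comment> \<open>\<open>w A\<close> keeps the coordinates of \<open>v\<close> in
      \<open>A\<close>; enlarging \<open>A\<close> by one index moves along one axis, and every
      point visited stays within distance \<open>norm v\<close> of \<open>x\<close>.\<close>
    define w where "w A = (\<chi> i. if i \<in> A then v $ i else 0)" for A
    have "\<bar>g (x + w A) - g x - (\<Sum>i\<in>A. v $ i * partial_deriv i g x)\<bar> \<le> real (card A) * (e / n * norm v)" if "finite A" for A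
      using that
    proof (induction A)
      case empty
      have "w {} = 0" by (simp add: w_def vec_eq_iff)
      then show ?case by simp
    next
      case (insert i A)
      have wi: "w (insert i A) = w A + v $ i *\<^sub>R axis i 1"
        using insert by (auto simp: w_def vec_eq_iff axis_def)
      have near: "dist (x + w A + a *\<^sub>R axis i 1) x < d" if "\<bar>a\<bar> \<le> \<bar>v $ i\<bar>" for a
      proof -
        have "norm (w A + a *\<^sub>R axis i 1) \<le> norm v"
          by (rule norm_le_componentwise_cart) (use that insert in \<open>auto simp: w_def axis_def\<close>)
        then show ?thesis using v by (simp add: dist_norm add.assoc)
      qed
      have "partially_differentiable_at i g (x + w A + a *\<^sub>R axis i 1)" if "\<bar>a\<bar> \<le> \<bar>v $ i\<bar>" for a
        using d(3)[OF near[OF that]] assms(1) by auto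
      from partial_mvt[OF this] obtain \<theta> where \<theta>: "\<bar>\<theta>\<bar> \<le> \<bar>v $ i\<bar>"
        "g (x + w A + v $ i *\<^sub>R axis i 1) - g (x + w A) = v $ i * partial_deriv i g (x + w A + \<theta> *\<^sub>R axis i 1)"
        by blast
      have "\<bar>g (x + w (insert i A)) - g (x + w A) - v $ i * partial_deriv i g x\<bar>
          = \<bar>v $ i\<bar> * \<bar>partial_deriv i g (x + w A + \<theta> *\<^sub>R axis i 1) - partial_deriv i g x\<bar>"
        using \<theta>(2) by (simp add: wi add.assoc abs_mult[symmetric] algebra_simps)
      also have "\<dots> \<le> norm v * (e / n)"
        using d(2)[OF near[OF \<theta>(1)], of i] component_le_norm_cart[of v i] by (intro mult_mono) auto
      finally have step: "\<bar>g (x + w (insert i A)) - g (x + w A) - v $ i * partial_deriv i g x\<bar> \<le> e / n * norm v"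
        by (simp add: mult.commute)
      have "real (card (insert i A)) * (e / n * norm v) = real (card A) * (e / n * norm v) + e / n * norm v"
        using insert by (simp add: algebra_simps add_divide_distrib)
      moreover have "(\<Sum>i\<in>insert i A. v $ i * partial_deriv i g x) = v $ i * partial_deriv i g x + (\<Sum>i\<in>A. v $ i * partial_deriv i g x)"
        using insert by simp
      ultimately show ?case using insert.IH step by linarith
    qed
    from this[of UNIV] have "\<bar>g (x + w UNIV) - g x - (\<Sum>i\<in>UNIV. v $ i * partial_deriv i g x)\<bar> \<le> n * (e / n * norm v)"
      by (simp add: n_def)
    moreover have "w UNIV = v" by (simp add: w_def vec_eq_iff)
    ultimately show ?thesis using n by simp
  qed
  show "\<exists>d>0. \<forall>y. norm (y - x) < d \<longrightarrow>
      norm (g y - g x - (\<Sum>i\<in>UNIV. (y - x) $ i * partial_deriv i g x)) \<le> e * norm (y - x)"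
    using d(1) main[of "y - x" for y] by (intro exI[of _ d]) auto
qed

text \<open>Mean value theorem in direction \<open>i\<close> for the increment of \<open>g\<close>
  in direction \<open>j\<close>, then in direction \<open>j\<close>. The second difference is
  symmetric in \<open>i\<close> and \<open>j\<close> while the derivative obtained is not; this
  asymmetry is what \<open>partial_deriv_commute\<close> exploits.\<close>

lemma second_difference_mvt:
  fixes g :: "real^'n::finite \<Rightarrow> real"
  assumes C: "C_partial 2 S g" and s: "0 < s" and ball: "cball x (2 * s) \<subseteq> S"
  shows "\<exists>y\<in>cball x (2 * s). g (x + s *\<^sub>R axis i 1 + s *\<^sub>R axis j 1) - g (x + s *\<^sub>R axis i 1) - g (x + s *\<^sub>R axis j 1) + g x
           = s\<^sup>2 * partial_deriv j (partial_deriv i g) y"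
proof -
  have near: "x + a *\<^sub>R axis i 1 + b *\<^sub>R axis j 1 \<in> cball x (2 * s)" if "\<bar>a\<bar> \<le> s" "\<bar>b\<bar> \<le> s" for a b
  proof -
    have "norm (a *\<^sub>R axis i 1 + b *\<^sub>R axis j (1::real)) \<le> \<bar>a\<bar> + \<bar>b\<bar>"
      by (rule norm_triangle_le) simp
    moreover have "dist x (x + a *\<^sub>R axis i 1 + b *\<^sub>R axis j 1) = norm (a *\<^sub>R axis i 1 + b *\<^sub>R axis j (1::real))"
      by (subst dist_commute) (simp add: dist_norm add.assoc)
    ultimately show ?thesis using that by simp
  qed
  have pd: "partially_differentiable_at i g y" "partially_differentiable_at j (partial_deriv i g) y"
    if "y \<in> cball x (2 * s)" for y
    using C ball that by (auto simp: numeral_2_eq_2)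
  define G where "G y = g (y + s *\<^sub>R axis j 1) - g y" for y
  have G: "((\<lambda>b. G (x + b *\<^sub>R axis i 1)) has_real_derivative
      partial_deriv i g (x + a *\<^sub>R axis i 1 + s *\<^sub>R axis j 1) - partial_deriv i g (x + a *\<^sub>R axis i 1)) (at a)"
    if "\<bar>a\<bar> \<le> s" for a
  proof -
    have "partially_differentiable_at i g (x + s *\<^sub>R axis j 1 + a *\<^sub>R axis i 1)"
      using near[of a s] that s pd by (simp add: algebra_simps)
    from partial_deriv_DERIV[OF this]
    have 1: "((\<lambda>b. g (x + b *\<^sub>R axis i 1 + s *\<^sub>R axis j 1)) has_real_derivative
        partial_deriv i g (x + a *\<^sub>R axis i 1 + s *\<^sub>R axis j 1)) (at a)"
      by (simp add: algebra_simps)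
    have "partially_differentiable_at i g (x + a *\<^sub>R axis i 1)"
      using near[of a 0] that s pd by simp
    from DERIV_diff[OF 1 partial_deriv_DERIV[OF this]] show ?thesis by (simp add: G_def)
  qed
  have "\<exists>a>0. a < s \<and> G (x + s *\<^sub>R axis i 1) - G (x + 0 *\<^sub>R axis i 1) = (s - 0) *
      (partial_deriv i g (x + a *\<^sub>R axis i 1 + s *\<^sub>R axis j 1) - partial_deriv i g (x + a *\<^sub>R axis i 1))"
    by (rule MVT2[OF s]) (rule G, simp)
  then obtain a where a: "0 < a" "a < s" "G (x + s *\<^sub>R axis i 1) - G x = s *
      (partial_deriv i g (x + a *\<^sub>R axis i 1 + s *\<^sub>R axis j 1) - partial_deriv i g (x + a *\<^sub>R axis i 1))"
    by auto
  have "partially_differentiable_at j (partial_deriv i g) (x + a *\<^sub>R axis i 1 + b *\<^sub>R axis j 1)" if "\<bar>b\<bar> \<le> \<bar>s\<bar>" for b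
    using near[of a b] a that s pd by simp
  from partial_mvt[OF this] obtain b where b: "\<bar>b\<bar> \<le> \<bar>s\<bar>"
    "partial_deriv i g (x + a *\<^sub>R axis i 1 + s *\<^sub>R axis j 1) - partial_deriv i g (x + a *\<^sub>R axis i 1)
      = s * partial_deriv j (partial_deriv i g) (x + a *\<^sub>R axis i 1 + b *\<^sub>R axis j 1)" by blast
  show ?thesis
    using near[of a b] a b s by (intro bexI[of _ "x + a *\<^sub>R axis i 1 + b *\<^sub>R axis j 1"])
      (auto simp: G_def power2_eq_square algebra_simps)
qed

text \<open>By \<open>second_difference_mvt\<close> the two mixed derivatives take a common value at
  points arbitrarily close to \<open>x\<close>. If they differed at \<open>x\<close>, continuity
  would keep each within half the gap of its value there, a contradiction.\<close>

lemma partial_deriv_commute: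
  fixes g :: "real^'n::finite \<Rightarrow> real"
  assumes C: "C_partial 2 S g" and S: "open S" "x \<in> S"
  shows "partial_deriv i (partial_deriv j g) x = partial_deriv j (partial_deriv i g) x"
proof (rule ccontr)
  define A where "A = partial_deriv i (partial_deriv j g)"
  define B where "B = partial_deriv j (partial_deriv i g)"
  assume "partial_deriv i (partial_deriv j g) x \<noteq> partial_deriv j (partial_deriv i g) x"
  then have e: "0 < \<bar>A x - B x\<bar> / 2" by (simp add: A_def B_def)
  have "continuous_on S A" "continuous_on S B"
    using C by (simp_all add: A_def B_def numeral_2_eq_2)
  then have "(A \<longlongrightarrow> A x) (nhds x)" "(B \<longlongrightarrow> B x) (nhds x)"
    using S by (simp_all add: continuous_on_eq_continuous_at isCont_def tendsto_at_iff_tendsto_nhds)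
  from this[THEN tendstoD, OF e] eventually_nhds_in_open[OF S]
  have "\<forall>\<^sub>F y in nhds x. dist (A y) (A x) < \<bar>A x - B x\<bar> / 2 \<and> dist (B y) (B x) < \<bar>A x - B x\<bar> / 2 \<and> y \<in> S"
    by eventually_elim auto
  then obtain d where d: "0 < d" "\<And>y. dist y x < d \<Longrightarrow> dist (A y) (A x) < \<bar>A x - B x\<bar> / 2"
    "\<And>y. dist y x < d \<Longrightarrow> dist (B y) (B x) < \<bar>A x - B x\<bar> / 2" "\<And>y. dist y x < d \<Longrightarrow> y \<in> S"
    unfolding eventually_nhds_metric by auto
  define s where "s = d / 4"
  have s: "0 < s" "2 * s < d" using d by (simp_all add: s_def)
  have sub: "cball x (2 * s) \<subseteq> S" using d(4) s by (auto simp: dist_commute)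
  obtain y y' where y: "y \<in> cball x (2 * s)" "y' \<in> cball x (2 * s)" "s\<^sup>2 * B y = s\<^sup>2 * A y'"
    using second_difference_mvt[OF C s(1) sub, of i j] second_difference_mvt[OF C s(1) sub, of j i]
    by (auto simp: A_def B_def algebra_simps)
  then have "B y = A y'" using s by simp
  moreover have "dist (A y') (A x) < \<bar>A x - B x\<bar> / 2" "dist (B y) (B x) < \<bar>A x - B x\<bar> / 2"
    using d(2)[of y'] d(3)[of y] y s by (auto simp: dist_commute)
  ultimately show False by (auto simp: dist_real_def abs_if split: if_splits)
qed

text \<open>The index \<open>i\<close> bubbles to the front: passing the head \<open>k\<close> is
  one use of symmetry for \<open>iter_partial (is @ js) g\<close>, which still has two continuous
  derivatives.\<close>

lemma iter_partial_move:
  assumes "C_partial (length (is @ i # js)) S g" "open S" "x \<in> S"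
  shows "iter_partial (is @ i # js) g x = iter_partial (i # is @ js) g x"
  using assms(1,3)
proof (induction "is" arbitrary: x)
  case (Cons k "is")
  have "iter_partial (is @ i # js) g y = iter_partial (i # is @ js) g y" if "y \<in> S" for y
    using C_partial_Suc_imp[of "length (is @ i # js)" S g] Cons.prems(1) that
    by (intro Cons.IH) (simp_all del: C_partial.simps)
  then have "iter_partial ((k # is) @ i # js) g x = partial_deriv k (iter_partial (i # is @ js) g) x"
    unfolding iter_partial_simps append_Cons by (rule partial_deriv_cong(1)[OF assms(2) Cons.prems(2)])
  also have "\<dots> = partial_deriv i (partial_deriv k (iter_partial (is @ js) g)) x"
    unfolding iter_partial_simps
  proof (rule partial_deriv_commute[OF _ assms(2) Cons.prems(2)])
    show "C_partial 2 S (iter_partial (is @ js) g)"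
      using Cons.prems by (intro C_partial_iter_partial) (simp del: C_partial.simps)
  qed
  finally show ?case by simp
qed simp

text \<open>Makes results independent of the order of differentiation that
  \<open>multi_deriv\<close> fixes by choice.\<close>

lemma iter_partial_mset_cong:
  assumes "C_partial (length is) S g" "open S" "x \<in> S" "mset is = mset js"
  shows "iter_partial is g x = iter_partial js g x"
  using assms(1,3,4)
proof (induction "is" arbitrary: x js)
  case (Cons i "is")
  then have "i \<in> set js" by (metis list.set_intros(1) set_mset_mset)
  then obtain js1 js2 where js: "js = js1 @ i # js2" by (meson split_list)
  with Cons.prems have m: "mset is = mset (js1 @ js2)" by simp
  have "iter_partial is g y = iter_partial (js1 @ js2) g y" if "y \<in> S" for y
    using C_partial_Suc_imp[of "length is" S g] Cons.prems(1) that m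
    by (intro Cons.IH) (simp_all del: C_partial.simps)
  then have "iter_partial (i # is) g x = iter_partial (i # js1 @ js2) g x"
    unfolding iter_partial_simps append_Cons by (rule partial_deriv_cong(1)[OF assms(2) Cons.prems(2)])
  also have "\<dots> = iter_partial js g x"
    unfolding js
  proof (rule iter_partial_move[symmetric, OF _ assms(2) Cons.prems(2)])
    show "C_partial (length (js1 @ i # js2)) S g"
      using Cons.prems(1) mset_eq_length[OF Cons.prems(3)] js by simp
  qed
  finally show ?case .
qed simp

section \<open>Taylor forms and uniform Taylor expansion\<close>

text \<open>Summing over ordered index lists instead of multi-indices makes differentiation along a
  line the mere addition of one index. A multi-index \<open>v\<close> of order \<open>m\<close> is
  hit by \<open>m! / v!\<close> lists, so division by \<open>fact m\<close> leaves the customary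
  \<open>1 / v!\<close>.\<close>

definition taylor_form :: "nat \<Rightarrow> (real^'n::finite \<Rightarrow> real) \<Rightarrow> real^'n \<Rightarrow> real^'n \<Rightarrow> real" where
  "taylor_form m g t u = (\<Sum>is | length is = m. prod_list (map (($) u) is) * iter_partial is g t) / fact m"

lemma finite_lists_length: "finite {is :: 'n::finite list. length is = m}"
  using finite_lists_length_eq[of "UNIV :: 'n set" m] by simp

lemma sum_lists_length_Suc:
  "(\<Sum>is | length is = Suc m. F is) = (\<Sum>is | length is = m. \<Sum>i\<in>UNIV. F (i # is :: 'n::finite list))"
proof -
  have "(\<Sum>is | length is = Suc m. F is) = (\<Sum>(is, i)\<in>{is. length is = m} \<times> UNIV. F (i # is))"
    by (rule sum.reindex_bij_witness[of _ "\<lambda>(is, i). i # is" "\<lambda>xs. (tl xs, hd xs)"]) (auto simp: length_Suc_conv)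
  then show ?thesis by (simp add: sum.cartesian_product)
qed

text \<open>The factor \<open>fact m\<close> turns the form into the \<open>m\<close>-th derivative
  along the line through \<open>t\<close> in direction \<open>u\<close>, the shape that
  \<open>Maclaurin\<close> expects.\<close>

lemma taylor_form_DERIV:
  fixes g :: "real^'n::finite \<Rightarrow> real"
  assumes "C_partial (Suc m) S g" "open S" "t + y *\<^sub>R u \<in> S"
  shows "((\<lambda>y. fact m * taylor_form m g (t + y *\<^sub>R u) u) has_real_derivative fact (Suc m) * taylor_form (Suc m) g (t + y *\<^sub>R u) u) (at y)"
proof -
  have "((\<lambda>y. \<Sum>is | length is = m. prod_list (map (($) u) is) * iter_partial is g (t + y *\<^sub>R u)) has_real_derivative
      (\<Sum>is | length is = m. prod_list (map (($) u) is) * (\<Sum>i\<in>UNIV. u $ i * partial_deriv i (iter_partial is g) (t + y *\<^sub>R u)))) (at y)"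
  proof (intro DERIV_sum DERIV_cmult)
    fix "is" :: "'n list" assume "is \<in> {is. length is = m}"
    then have "C_partial (Suc 0) S (iter_partial is g)"
      using assms(1) by (intro C_partial_iter_partial) simp
    from C_partial_has_derivative[OF this assms(2,3)]
    have D: "(iter_partial is g has_derivative (\<lambda>v. \<Sum>i\<in>UNIV. v $ i * partial_deriv i (iter_partial is g) (t + y *\<^sub>R u))) (at (t + y *\<^sub>R u))" .
    have "((\<lambda>y. t + y *\<^sub>R u) has_derivative (\<lambda>h. h *\<^sub>R u)) (at y)"
      by (auto intro!: derivative_eq_intros)
    from has_derivative_compose[OF this D]
    show "((\<lambda>y. iter_partial is g (t + y *\<^sub>R u)) has_real_derivative (\<Sum>i\<in>UNIV. u $ i * partial_deriv i (iter_partial is g) (t + y *\<^sub>R u))) (at y)"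
      unfolding has_field_derivative_def by (rule has_derivative_eq_rhs) (simp add: fun_eq_iff sum_distrib_left mult_ac)
  qed
  also have "(\<Sum>is | length is = m. prod_list (map (($) u) is) * (\<Sum>i\<in>UNIV. u $ i * partial_deriv i (iter_partial is g) (t + y *\<^sub>R u)))
     = (\<Sum>is | length is = Suc m. prod_list (map (($) u) is) * iter_partial is g (t + y *\<^sub>R u))"
    by (simp add: sum_lists_length_Suc sum_distrib_left mult_ac)
  finally show ?thesis by (simp add: taylor_form_def del: fact_Suc)
qed

lemma prod_list_nth_le:
  "norm u \<le> R \<Longrightarrow> \<bar>prod_list (map (($) u) is)\<bar> \<le> R ^ length (is :: 'n::finite list)"
proof (induction "is")
  case (Cons i "is")
  have "\<bar>u $ i\<bar> \<le> R" using component_le_norm_cart[of u i] Cons.prems by linarith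
  moreover have "0 \<le> R" using norm_ge_zero Cons.prems by (rule order_trans)
  ultimately show ?case using Cons by (auto simp: abs_mult intro!: mult_mono)
qed simp

text \<open>The Lagrange remainder on each ray is compared with the top form at \<open>t\<close>.
  Continuity of the derivatives of order \<open>k\<close> makes the difference small, uniformly in
  \<open>u\<close> because \<open>u\<close> enters only through bounded products of its
  coordinates.\<close>

lemma uniform_taylor:
  fixes g :: "real^'n::finite \<Rightarrow> real"
  assumes C: "C_partial k S g" and S: "open S" "t \<in> S" and k: "0 < k" and R: "0 < R" and e: "0 < e"
  shows "\<exists>d>0. \<forall>h u. 0 < h \<and> h < d \<and> norm u \<le> R \<longrightarrow>
      t + h *\<^sub>R u \<in> S \<and> \<bar>g (t + h *\<^sub>R u) - (\<Sum>m\<le>k. taylor_form m g t u * h ^ m)\<bar> \<le> e * h ^ k"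
proof -
  \<comment> \<open>Number of terms of the form of order \<open>k\<close> times the bound
    \<open>R ^ k\<close> for their coordinate products; the added 1 secures positivity.\<close>
  define N where "N = real (card {is :: 'n list. length is = k}) * R ^ k + 1"
  have N: "0 < N" using R by (simp add: N_def add_nonneg_pos)
  have "\<forall>\<^sub>F y in nhds t. \<bar>iter_partial is g y - iter_partial is g t\<bar> < e / N" if "length is = k" for "is"
  proof -
    have "C_partial 0 S (iter_partial is g)"
      using C that by (intro C_partial_iter_partial) simp
    then have "(iter_partial is g \<longlongrightarrow> iter_partial is g t) (nhds t)"
      using S by (simp add: continuous_on_eq_continuous_at isCont_def tendsto_at_iff_tendsto_nhds)
    from tendstoD[OF this, of "e / N"] show ?thesis
      using e N by (simp add: dist_real_def)
  qed
  then have "\<forall>\<^sub>F y in nhds t. \<forall>is\<in>{is. length is = k}. \<bar>iter_partial is g y - iter_partial is g t\<bar> < e / N"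
    using finite_lists_length by (intro eventually_ball_finite) auto
  moreover have "\<forall>\<^sub>F y in nhds t. y \<in> S"
    using S by (rule eventually_nhds_in_open)
  ultimately have "\<forall>\<^sub>F y in nhds t. (\<forall>is. length is = k \<longrightarrow> \<bar>iter_partial is g y - iter_partial is g t\<bar> < e / N) \<and> y \<in> S"
    by eventually_elim auto
  then obtain d where d: "0 < d" "\<And>y is. dist y t < d \<Longrightarrow> length is = k \<Longrightarrow> \<bar>iter_partial is g y - iter_partial is g t\<bar> < e / N"
    "\<And>y. dist y t < d \<Longrightarrow> y \<in> S"
    unfolding eventually_nhds_metric by auto
  have main: "t + h *\<^sub>R u \<in> S \<and> \<bar>g (t + h *\<^sub>R u) - (\<Sum>m\<le>k. taylor_form m g t u * h ^ m)\<bar> \<le> e * h ^ k"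
    if h: "0 < h" "h < d / R" and u: "norm u \<le> R" for h u
  proof -
    have near: "dist (t + y *\<^sub>R u) t < d" if "0 \<le> y" "y \<le> h" for y
    proof -
      have "y * norm u \<le> h * R" using that u by (intro mult_mono) auto
      also have "\<dots> < d" using h R by (simp add: field_simps)
      finally show ?thesis using that by (simp add: dist_norm)
    qed
    define diff where "diff m y = fact m * taylor_form m g (t + y *\<^sub>R u) u" for m y
    have "\<exists>y>0. y < h \<and> g (t + h *\<^sub>R u) = (\<Sum>m<k. diff m 0 / fact m * h ^ m) + diff k y / fact k * h ^ k"
    proof (rule Maclaurin[OF h(1) k, where f="\<lambda>y. g (t + y *\<^sub>R u)"])
      show "diff 0 = (\<lambda>y. g (t + y *\<^sub>R u))" by (rule ext) (simp add: diff_def taylor_form_def)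
      show "\<forall>m y. m < k \<and> 0 \<le> y \<and> y \<le> h \<longrightarrow> (diff m has_real_derivative diff (Suc m) y) (at y)"
        unfolding diff_def using near d(3) S(1)
        by (auto intro!: taylor_form_DERIV[OF C_partial_mono[OF C]] simp del: fact_Suc C_partial.simps)
    qed
    then obtain y where y: "0 < y" "y < h" and eq: "g (t + h *\<^sub>R u) = (\<Sum>m<k. diff m 0 / fact m * h ^ m) + diff k y / fact k * h ^ k"
      by blast
    have "g (t + h *\<^sub>R u) - (\<Sum>m\<le>k. taylor_form m g t u * h ^ m) = (taylor_form k g (t + y *\<^sub>R u) u - taylor_form k g t u) * h ^ k"
      unfolding eq by (simp add: diff_def lessThan_Suc_atMost[symmetric] algebra_simps)
    moreover have "\<bar>taylor_form k g (t + y *\<^sub>R u) u - taylor_form k g t u\<bar> \<le> e"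
    proof -
      have "fact k * \<bar>taylor_form k g (t + y *\<^sub>R u) u - taylor_form k g t u\<bar>
          = \<bar>\<Sum>is | length is = k. prod_list (map (($) u) is) * (iter_partial is g (t + y *\<^sub>R u) - iter_partial is g t)\<bar>"
        by (simp add: taylor_form_def sum_subtractf right_diff_distrib diff_divide_distrib[symmetric])
      also have "\<dots> \<le> (\<Sum>is | length (is :: 'n list) = k. R ^ k * (e / N))"
      proof (rule order_trans[OF sum_abs], rule sum_mono)
        fix "is" :: "'n list" assume "is \<in> {is. length is = k}"
        then show "\<bar>prod_list (map (($) u) is) * (iter_partial is g (t + y *\<^sub>R u) - iter_partial is g t)\<bar> \<le> R ^ k * (e / N)"
          using prod_list_nth_le[OF u, of "is"] d(2)[OF near, of y "is"] y R
          unfolding abs_mult by (intro mult_mono) auto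
      qed
      also have "\<dots> \<le> e"
        using N e by (simp add: N_def field_simps)
      finally have "fact k * \<bar>taylor_form k g (t + y *\<^sub>R u) u - taylor_form k g t u\<bar> \<le> e" .
      \<comment> \<open>Removing the factorial preserves the bound, since \<open>fact k\<close> is
        at least 1.\<close>
      have "1 * \<bar>taylor_form k g (t + y *\<^sub>R u) u - taylor_form k g t u\<bar> \<le> fact k * \<bar>taylor_form k g (t + y *\<^sub>R u) u - taylor_form k g t u\<bar>"
        by (intro mult_right_mono fact_ge_1) simp
      also have "\<dots> \<le> e" by fact
      finally show ?thesis by simp
    qed
    moreover have "t + h *\<^sub>R u \<in> S" using near[of h] d(3) h by simp
    ultimately show ?thesis using h by (simp add: abs_mult mult_right_mono)
  qed
  show ?thesis using main d(1) R by (intro exI[of _ "d / R"]) auto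
qed

section \<open>From index lists to multi-indices\<close>

lemma prod_list_nth_eq_mi_power: "prod_list (map (($) u) is) = mi_power u (count_list is)"
proof (induction "is")
  case (Cons i "is")
  have "mi_power u (count_list (i # is)) = (\<Prod>j\<in>UNIV. (if j = i then u $ i else 1) * (u $ j) ^ count_list is j)"
    unfolding mi_power_def by (intro prod.cong) auto
  also have "\<dots> = u $ i * mi_power u (count_list is)"
    by (simp add: prod.distrib mi_power_def)
  finally show ?case using Cons by (simp only: list.map prod_list.Cons)
qed (simp add: mi_power_def)

text \<open>The lists with counts \<open>v\<close> are the permutations of the multiset with
  multiplicities \<open>v\<close>, hence counted by a multinomial coefficient.\<close>

lemma card_lists_with_counts:
  fixes v :: "'n::finite \<Rightarrow> nat"
  shows "\<exists>is. count_list is = v"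
    and "real (card {is. count_list is = v}) * mi_fact v = fact (mi_abs v)"
proof -
  have "count (Abs_multiset v) = v" by (intro Abs_multiset_inverse) simp
  then obtain A where A: "count A = v" by blast
  obtain xs where xs: "mset xs = A" using ex_mset by blast
  have eq: "count_list is = v \<longleftrightarrow> mset is = A" for "is"
    by (auto simp: A[symmetric] multiset_eq_iff fun_eq_iff count_mset)
  show "\<exists>is. count_list is = v" using xs eq by blast
  have "(\<Prod>x\<in>set_mset A. fact (count A x)) = (\<Prod>x\<in>UNIV. fact (v x) :: nat)"
    by (intro prod.mono_neutral_cong_left) (auto simp: A not_in_iff)
  moreover have "size A = mi_abs v"
  proof -
    have "size A = (\<Sum>x\<in>set_mset A. count A x)" by (simp add: size_multiset_overloaded_eq)
    also have "\<dots> = mi_abs v"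
      unfolding mi_abs_def by (intro sum.mono_neutral_cong_left) (auto simp: A not_in_iff)
    finally show ?thesis .
  qed
  moreover have "{is. count_list is = v} = permutations_of_multiset A"
    by (auto simp: eq permutations_of_multiset_def)
  ultimately have "card {is. count_list is = v} * (\<Prod>x\<in>UNIV. fact (v x)) = fact (mi_abs v)"
    using card_permutations_of_multiset_aux[of A] by simp
  then have "real (card {is. count_list is = v} * (\<Prod>x\<in>UNIV. fact (v x))) = real (fact (mi_abs v))"
    by (rule arg_cong)
  then show "real (card {is. count_list is = v}) * mi_fact v = fact (mi_abs v)"
    by (simp add: mi_fact_def)
qed

lemma length_eq_mi_abs: "length is = mi_abs (count_list is)"
proof (induction "is")
  case (Cons i "is")
  have "mi_abs (count_list (i # is)) = (\<Sum>j\<in>UNIV. (if j = i then 1 else 0) + count_list is j)"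
    unfolding mi_abs_def by (intro sum.cong) auto
  also have "\<dots> = Suc (mi_abs (count_list is))"
    by (simp add: sum.distrib mi_abs_def)
  finally show ?case using Cons by (simp only: list.size)
qed (simp add: mi_abs_def)

lemma multi_indices_eq: "{v :: 'n::finite \<Rightarrow> nat. mi_abs v = m} = count_list ` {is. length is = m}"
proof (intro equalityI subsetI)
  fix v :: "'n \<Rightarrow> nat" assume v: "v \<in> {v. mi_abs v = m}"
  obtain "is" where "count_list is = v" using card_lists_with_counts(1) by blast
  with v show "v \<in> count_list ` {is. length is = m}" using length_eq_mi_abs[of "is"] by auto
next
  fix v :: "'n \<Rightarrow> nat" assume "v \<in> count_list ` {is. length is = m}"
  then show "v \<in> {v. mi_abs v = m}" by (auto simp flip: length_eq_mi_abs)
qed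

text \<open>Lists are grouped by their counts: inside a group all terms agree by symmetry of the
  derivatives, and the group has \<open>m! / v!\<close> members.\<close>

lemma taylor_form_eq_multi_index_sum:
  fixes g :: "real^'n::finite \<Rightarrow> real"
  assumes "C_partial m S g" "open S" "t \<in> S"
  shows "taylor_form m g t u = (\<Sum>v | mi_abs v = m. mi_power u v * multi_deriv v g t / mi_fact v)"
proof -
  have "(\<Sum>is | length is = m. prod_list (map (($) u) is) * iter_partial is g t)
    = (\<Sum>v\<in>count_list ` {is. length is = m}. \<Sum>is\<in>{is \<in> {is. length is = m}. count_list is = v}.
        prod_list (map (($) u) is) * iter_partial is g t)"
    by (rule sum.image_gen[OF finite_lists_length])
  also have "\<dots> = (\<Sum>v | mi_abs v = m. fact m * (mi_power u v * multi_deriv v g t / mi_fact v))"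
    unfolding multi_indices_eq[symmetric]
  proof (rule sum.cong[OF refl])
    fix v :: "'n \<Rightarrow> nat" assume "v \<in> {v. mi_abs v = m}"
    then have v: "mi_abs v = m" by simp
    have set: "{is \<in> {is. length is = m}. count_list is = v} = {is. count_list is = v}"
      using v length_eq_mi_abs by auto
    have "mi_fact v \<noteq> 0" by (simp add: mi_fact_def)
    have "prod_list (map (($) u) is) * iter_partial is g t = mi_power u v * multi_deriv v g t" if "count_list is = v" for "is"
    proof -
      \<comment> \<open>The list that \<open>multi_deriv\<close> selects for
        \<open>v\<close>.\<close>
      define js where "js = (SOME is. \<forall>i. count_list is i = v i)"
      have "\<forall>i. count_list js i = v i"
        unfolding js_def by (rule someI_ex) (use that in blast)
      then have "mset is = mset js" using that by (auto simp: multiset_eq_iff count_mset)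
      moreover have "length is = m" using that v length_eq_mi_abs by auto
      ultimately have "iter_partial is g t = iter_partial js g t"
        using assms by (intro iter_partial_mset_cong) auto
      then show ?thesis using that by (simp add: prod_list_nth_eq_mi_power multi_deriv_def js_def)
    qed
    then have "(\<Sum>is | count_list is = v. prod_list (map (($) u) is) * iter_partial is g t)
      = real (card {is. count_list is = v}) * (mi_power u v * multi_deriv v g t)" by simp
    also have "\<dots> = fact m * (mi_power u v * multi_deriv v g t / mi_fact v)"
      using card_lists_with_counts(2)[of v] v \<open>mi_fact v \<noteq> 0\<close> by (simp add: field_simps)
    finally show "(\<Sum>is\<in>{is \<in> {is. length is = m}. count_list is = v}. prod_list (map (($) u) is) * iter_partial is g t)
        = fact m * (mi_power u v * multi_deriv v g t / mi_fact v)" unfolding set .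
  qed
  finally show ?thesis unfolding taylor_form_def by (simp only: flip: sum_distrib_left) simp
qed

section \<open>Radial substitution\<close>

lemma
  fixes F :: "'a::euclidean_space \<Rightarrow> real"
  assumes c: "c \<noteq> 0"
  shows integrable_lborel_affine: "integrable lborel F \<Longrightarrow> integrable lborel (\<lambda>x. F (t + c *\<^sub>R x))"
    and integral_lborel_affine: "integrable lborel F \<Longrightarrow> (\<integral>x. F x \<partial>lborel) = \<bar>c\<bar> ^ DIM('a) * (\<integral>x. F (t + c *\<^sub>R x) \<partial>lborel)"
proof -
  assume F: "integrable lborel F"
  then have [measurable]: "F \<in> borel_measurable borel" by simp
  have "integrable (density (distr lborel borel (\<lambda>x. t + c *\<^sub>R x)) (\<lambda>_. ennreal (\<bar>c\<bar> ^ DIM('a)))) F"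
    using F lborel_affine[OF c, of t] by (simp add: ennreal_power)
  then show "integrable lborel (\<lambda>x. F (t + c *\<^sub>R x))"
    using c by (simp add: integrable_density integrable_distr_eq)
  have "(\<integral>x. F x \<partial>lborel) = (\<integral>x. F x \<partial>density (distr lborel borel (\<lambda>x. t + c *\<^sub>R x)) (\<lambda>_. ennreal (\<bar>c\<bar> ^ DIM('a))))"
    using lborel_affine[OF c, of t] by (simp add: ennreal_power)
  then show "(\<integral>x. F x \<partial>lborel) = \<bar>c\<bar> ^ DIM('a) * (\<integral>x. F (t + c *\<^sub>R x) \<partial>lborel)"
    by (simp add: integral_density integral_distr)
qed

text \<open>For fixed \<open>l\<close>, dilation by \<open>l\<close> turns the condition
  \<open>norm z / 2 \<le> l \<le> norm z\<close> into membership in a fixed shell. Of the Jacobian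
  \<open>l ^ d\<close> one power is consumed by the weight \<open>2 / norm z\<close>, which leaves
  the \<open>l ^ (d - 1)\<close> of polar coordinates.\<close>

lemma integral_lborel_shell_eq_ray:
  fixes g :: "'a::euclidean_space \<Rightarrow> real"
  assumes "0 < l"
  defines "H \<equiv> \<lambda>z. 2 / norm z * indicator {norm z / 2..norm z} l * g z"
    and "H2 \<equiv> \<lambda>z. indicator {1..2} (norm z) * (2 / norm z) * (l ^ (DIM('a) - 1) * g (l *\<^sub>R z))"
  shows "integrable lborel H \<Longrightarrow> integrable lborel H2"
    and "integrable lborel H \<Longrightarrow> (\<integral>z. H z \<partial>lborel) = (\<integral>z. H2 z \<partial>lborel)"
proof -
  have eq: "l ^ DIM('a) * H (l *\<^sub>R z) = H2 z" for z
  proof (cases "norm z \<in> {1..2}")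
    case True
    have "DIM('a) = Suc (DIM('a) - 1)" using DIM_positive[where 'a='a] by simp
    then have "l ^ DIM('a) = l * l ^ (DIM('a) - 1)" by (metis power_Suc)
    moreover have "l \<in> {norm (l *\<^sub>R z) / 2..norm (l *\<^sub>R z)}"
      using True assms(1) by (auto simp: field_simps)
    ultimately show ?thesis using True assms(1) by (simp add: H_def H2_def)
  next
    case False
    moreover from False have "l \<notin> {norm (l *\<^sub>R z) / 2..norm (l *\<^sub>R z)}"
      using assms(1) by (auto simp: field_simps not_le)
    ultimately show ?thesis by (simp add: H_def H2_def)
  qed
  assume H: "integrable lborel H"
  have l: "l \<noteq> 0" using assms by simp
  from integrable_lborel_affine[OF l H, of 0] have "integrable lborel (\<lambda>z. l ^ DIM('a) * H (l *\<^sub>R z))"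
    by simp
  then show "integrable lborel H2" by (simp only: eq)
  show "(\<integral>z. H z \<partial>lborel) = (\<integral>z. H2 z \<partial>lborel)"
    using integral_lborel_affine[OF l H, of 0] assms(1) by (simp flip: eq)
qed

text \<open>The average over all dilations \<open>z \<mapsto> z / l\<close> that carry \<open>z\<close> into the shell \<open>1 \<le> |z| \<le> 2\<close> replaces
  the decomposition of Lebesgue measure in polar coordinates.\<close>

lemma integral_eq_0_if_ray_integrals_eq_0:
  fixes g :: "'a::euclidean_space \<Rightarrow> real"
  assumes g: "integrable lborel g"
    and ray: "\<And>z. z \<noteq> 0 \<Longrightarrow> (\<integral>l. indicator {0..} l * (l ^ (DIM('a) - 1) * g (l *\<^sub>R z)) \<partial>lborel) = 0"
  shows "(\<integral>z. g z \<partial>lborel) = 0"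
proof -
  have [measurable]: "g \<in> borel_measurable borel" using g by simp
  \<comment> \<open>The admissible \<open>l\<close> form an interval of length
    \<open>norm z / 2\<close>, so with the weight \<open>2 / norm z\<close> the integral of
    \<open>H z\<close> over \<open>l\<close> is \<open>g z\<close>.\<close>
  define H where "H z l = 2 / norm z * indicator {norm z / 2..norm z} l * g z" for z :: 'a and l :: real
  define H2 where "H2 z l = indicator {0<..} l * (indicator {1..2} (norm z) * (2 / norm z) * (l ^ (DIM('a) - 1) * g (l *\<^sub>R z)))"
    for z :: 'a and l :: real
  have Hset: "H z l = 2 / norm z * of_bool (norm z / 2 \<le> l \<and> l \<le> norm z) * g z" for z l
    by (simp add: H_def indicator_def)
  have [measurable]: "case_prod H \<in> borel_measurable (lborel \<Otimes>\<^sub>M lborel)"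
    unfolding Hset[abs_def] by measurable
  have [measurable]: "case_prod H2 \<in> borel_measurable (lborel \<Otimes>\<^sub>M lborel)"
    unfolding H2_def[abs_def] by measurable
  have Hl: "(\<integral>l. H z l \<partial>lborel) = g z" "(\<integral>l. norm (H z l) \<partial>lborel) = norm (g z)" "integrable lborel (H z)"
    if "z \<noteq> 0" for z
    using that by (auto simp: H_def[abs_def] abs_mult measure_def)
  have AE0: "AE z in lborel. z \<noteq> (0::'a)" by (rule AE_lborel_singleton)
  have Hint: "integrable (lborel \<Otimes>\<^sub>M lborel) (case_prod H)"
  proof (rule lborel_pair.Fubini_integrable)
    have "integrable lborel (\<lambda>z. norm (g z))" using g by simp
    then show "integrable lborel (\<lambda>z. \<integral>l. norm (case_prod H (z, l)) \<partial>lborel)"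
      by (rule integrable_cong_AE_imp) (use AE0 Hl in auto)
    show "AE z in lborel. integrable lborel (\<lambda>l. case_prod H (z, l))"
      using AE0 by eventually_elim (use Hl in simp)
  qed simp
  \<comment> \<open>For nonpositive \<open>l\<close> the condition leaves only \<open>z = 0\<close>,
    where the default value \<open>2 / 0 = 0\<close> annihilates \<open>H\<close>.\<close>
  have H_nonpos: "H z l = 0" if "l \<le> 0" for z l
  proof -
    have "z = 0" if "norm z / 2 \<le> l" using that \<open>l \<le> 0\<close> norm_ge_zero[of z] by (simp flip: norm_le_zero_iff)
    then show ?thesis by (auto simp: Hset)
  qed
  have abs_H2: "indicator {1..2} (norm z) * (2 / norm z) * (l ^ (DIM('a) - 1) * \<bar>g (l *\<^sub>R z)\<bar>) = \<bar>H2 z l\<bar>" if "0 < l" for z l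
    using that by (simp add: H2_def abs_mult)
  \<comment> \<open>The version for absolute values yields integrability of \<open>H2\<close> on the
    product, which the second exchange of integrals requires.\<close>
  have swap: "(\<integral>z. H z l \<partial>lborel) = (\<integral>z. H2 z l \<partial>lborel)" "(\<integral>z. \<bar>H z l\<bar> \<partial>lborel) = (\<integral>z. \<bar>H2 z l\<bar> \<partial>lborel)"
    "integrable lborel (\<lambda>z. H2 z l)" if "integrable lborel (\<lambda>z. H z l)" for l
  proof -
    show "(\<integral>z. H z l \<partial>lborel) = (\<integral>z. H2 z l \<partial>lborel)"
    proof (cases "0 < l")
      case True
      then show ?thesis
        using integral_lborel_shell_eq_ray(2)[of l g] that by (simp add: H_def H2_def)
    next
      case False
      then show ?thesis using H_nonpos[of l] by (simp add: H2_def)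
    qed
    show "integrable lborel (\<lambda>z. H2 z l)"
      using integral_lborel_shell_eq_ray(1)[of l g] that
      by (cases "0 < l") (simp_all add: H_def H2_def)
    have "integrable lborel (\<lambda>z. \<bar>H z l\<bar>)" using that by simp
    then show "(\<integral>z. \<bar>H z l\<bar> \<partial>lborel) = (\<integral>z. \<bar>H2 z l\<bar> \<partial>lborel)"
    proof (cases "0 < l")
      case True
      then show ?thesis
        using integral_lborel_shell_eq_ray(2)[of l "\<lambda>z. \<bar>g z\<bar>"] \<open>integrable lborel (\<lambda>z. \<bar>H z l\<bar>)\<close>
        by (simp only: abs_H2) (simp add: H_def abs_mult)
    next
      case False
      then show ?thesis using H_nonpos[of l] by (simp add: H2_def)
    qed
  qed
  have AEl: "AE l in lborel. integrable lborel (\<lambda>z. H z l)"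
    using lborel_pair.AE_integrable_snd[OF Hint] .
  have H2int: "integrable (lborel \<Otimes>\<^sub>M lborel) (\<lambda>(l, z). H2 z l)"
  proof (rule lborel_pair.Fubini_integrable)
    have "integrable (lborel \<Otimes>\<^sub>M lborel) (\<lambda>(z, l). \<bar>H z l\<bar>)"
      using integrable_abs[OF Hint] by (simp add: case_prod_beta')
    from lborel_pair.integrable_snd[OF this] have "integrable lborel (\<lambda>l. \<integral>z. \<bar>H z l\<bar> \<partial>lborel)" .
    then show "integrable lborel (\<lambda>l. \<integral>z. norm (case (l, z) of (l, z) \<Rightarrow> H2 z l) \<partial>lborel)"
      by (rule integrable_cong_AE_imp) (use AEl in \<open>auto simp: swap\<close>)
    show "AE l in lborel. integrable lborel (\<lambda>z. case (l, z) of (l, z) \<Rightarrow> H2 z l)"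
      using AEl by eventually_elim (simp add: swap)
  qed measurable
  have "(\<integral>z. g z \<partial>lborel) = (\<integral>z. (\<integral>l. H z l \<partial>lborel) \<partial>lborel)"
    by (intro integral_cong_AE) (use AE0 Hl in auto)
  also have "\<dots> = (\<integral>l. (\<integral>z. H z l \<partial>lborel) \<partial>lborel)"
    by (rule lborel_pair.Fubini_integral[OF Hint, symmetric])
  also have "\<dots> = (\<integral>l. (\<integral>z. H2 z l \<partial>lborel) \<partial>lborel)"
    by (intro integral_cong_AE) (use AEl in \<open>auto simp: swap\<close>)
  also have "\<dots> = (\<integral>z. (\<integral>l. H2 z l \<partial>lborel) \<partial>lborel)"
    by (rule lborel_pair.Fubini_integral[OF H2int, symmetric])
  also have "\<dots> = (\<integral>z. 0 \<partial>(lborel :: 'a measure))"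
  proof (rule Bochner_Integration.integral_cong[OF refl])
    fix z :: 'a
    have "(\<integral>l. H2 z l \<partial>lborel) = (\<integral>l. (indicator {1..2} (norm z) * (2 / norm z)) * (indicator {0..} l * (l ^ (DIM('a) - 1) * g (l *\<^sub>R z))) \<partial>lborel)"
    \<comment> \<open>\<open>H2\<close> excludes \<open>l = 0\<close> and the ray hypothesis
      includes it; the difference is a null set.\<close>
    proof (intro integral_cong_AE)
      show "AE l in lborel. H2 z l = (indicator {1..2} (norm z) * (2 / norm z)) * (indicator {0..} l * (l ^ (DIM('a) - 1) * g (l *\<^sub>R z)))"
        using AE_lborel_singleton[of "0::real"] by eventually_elim (auto simp: H2_def indicator_def)
    qed (simp_all add: H2_def)
    also have "\<dots> = 0"
      using ray[of z] by (cases "z = 0") simp_all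
    finally show "(\<integral>l. H2 z l \<partial>lborel) = 0" .
  qed
  finally show ?thesis by simp
qed

lemma continuous_compact_support_integrable:
  fixes Q :: "'a::euclidean_space \<Rightarrow> real"
  assumes "continuous_on UNIV Q" "\<And>u. S \<le> norm u \<Longrightarrow> Q u = 0"
  shows "integrable lborel Q"
proof -
  have "Q = (\<lambda>u. indicator (cball 0 S) u *\<^sub>R Q u)"
    using assms(2) by (auto simp: fun_eq_iff indicator_def)
  moreover have "integrable lborel (\<lambda>u. indicator (cball 0 S) u *\<^sub>R Q u)"
    by (rule borel_integrable_compact) (auto intro: continuous_on_subset[OF assms(1)])
  ultimately show ?thesis by simp
qed

text \<open>On the ray through \<open>z\<close> the map sends \<open>l\<close> to
  \<open>w l = l * \<kappa> (l *\<^sub>R z)\<close> with derivative \<open>J\<close>, and the power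
  of \<open>\<kappa>\<close> completes the radial Jacobian. One-dimensional substitution then makes
  the ray integrals of the two integrands equal. It is an identity of oriented integrals, so
  \<open>w\<close> may fail to be monotone and \<open>J\<close> may change sign. Assumption
  \<open>big\<close> ensures that the image of each ray segment reaches the end of the support of
  \<open>Q\<close>.\<close>

lemma integral_radial_substitution:
  fixes Q \<kappa> J :: "'a::euclidean_space \<Rightarrow> real"
  assumes Q: "continuous_on UNIV Q" and supp: "\<And>u. S \<le> norm u \<Longrightarrow> Q u = 0"
    and R: "0 < R" and cont: "continuous_on (cball 0 R) \<kappa>" "continuous_on (cball 0 R) J"
    and nonneg: "\<And>u. norm u \<le> R \<Longrightarrow> 0 \<le> \<kappa> u"
    and deriv: "\<And>l z. 0 \<le> l \<Longrightarrow> norm (l *\<^sub>R z) \<le> R \<Longrightarrow> ((\<lambda>l. l * \<kappa> (l *\<^sub>R z)) has_real_derivative J (l *\<^sub>R z)) (at l)"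
    and big: "\<And>u. norm u = R \<Longrightarrow> S \<le> \<kappa> u * R"
  shows "(\<integral>u. indicator (cball 0 R) u * (Q (\<kappa> u *\<^sub>R u) * \<kappa> u ^ (DIM('a) - 1) * J u) \<partial>lborel) = (\<integral>u. Q u \<partial>lborel)"
proof -
  let ?d = "DIM('a) - 1"
  define P where "P u = Q (\<kappa> u *\<^sub>R u) * \<kappa> u ^ ?d * J u" for u
  have P: "continuous_on (cball 0 R) P"
    unfolding P_def by (intro continuous_intros cont continuous_on_compose2[OF Q]) auto
  have intP: "integrable lborel (\<lambda>u. indicator (cball 0 R) u * P u)"
    using borel_integrable_compact[OF compact_cball P] by simp
  have intQ: "integrable lborel Q"
    by (rule continuous_compact_support_integrable[OF Q supp])
  have "(\<integral>u. indicator (cball 0 R) u * P u - Q u \<partial>lborel) = 0"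
  proof (rule integral_eq_0_if_ray_integrals_eq_0)
    show "integrable lborel (\<lambda>u. indicator (cball 0 R) u * P u - Q u)"
      using intP intQ by simp
    fix z :: 'a assume z: "z \<noteq> 0"
    define L where "L = R / norm z"
    define w where "w l = l * \<kappa> (l *\<^sub>R z)" for l
    have L: "0 < L" using R z by (simp add: L_def)
    have in_ball: "norm (l *\<^sub>R z) \<le> R \<longleftrightarrow> l \<le> L" if "0 \<le> l" for l
      using that z by (simp add: L_def field_simps)
    have wL: "S \<le> w L * norm z"
      using big[of "L *\<^sub>R z"] z R by (simp add: L_def w_def mult.commute)
    define q where "q v = v ^ ?d * Q (v *\<^sub>R z)" for v
    have q: "continuous_on A q" for A
      unfolding q_def by (intro continuous_intros continuous_on_compose2[OF Q]) auto
    have w0: "w 0 = 0" by (simp add: w_def)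
    have w_nonneg: "0 \<le> w l" if "l \<in> {0..L}" for l
      using that nonneg[of "l *\<^sub>R z"] in_ball[of l] by (simp add: w_def)
    have w_deriv: "(w has_field_derivative J (l *\<^sub>R z)) (at l within {0..L})" if "l \<in> {0..L}" for l
      using has_field_derivative_at_within[OF deriv[of l z]] in_ball[of l] that unfolding w_def by auto
    have "continuous_on {0..L} w"
      using w_deriv by (rule DERIV_continuous_on)
    then have "bounded (w ` {0..L})"
      by (intro compact_imp_bounded compact_continuous_image) auto
    then obtain B where B: "\<And>l. l \<in> {0..L} \<Longrightarrow> \<bar>w l\<bar> \<le> B"
      unfolding bounded_iff real_norm_def by blast
    have sub: "((\<lambda>l. J (l *\<^sub>R z) *\<^sub>R q (w l)) has_integral integral {w 0..w L} q) {0..L}"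
    proof (rule has_integral_substitution)
      \<comment> \<open>\<open>w\<close> may overshoot \<open>w L\<close> on the way, so the
        integrand has to be continuous on an interval containing the whole range of
        \<open>w\<close>.\<close>
      show "w ` {0..L} \<subseteq> {0..B}" using B w_nonneg by (force simp: abs_le_iff)
      show "w 0 \<le> w L" using w0 w_nonneg L by simp
    qed (use L q w_deriv in auto)
    have eq1: "l ^ ?d * P (l *\<^sub>R z) = J (l *\<^sub>R z) *\<^sub>R q (w l)" for l
      by (simp add: P_def q_def w_def power_mult_distrib mult_ac)
    have cJ: "continuous_on {0..L} (\<lambda>l. l ^ ?d * P (l *\<^sub>R z))"
      by (intro continuous_intros continuous_on_compose2[OF P]) (use in_ball in auto)
    have "(\<integral>l. indicator {0..} l * (l ^ ?d * (indicator (cball 0 R) (l *\<^sub>R z) * P (l *\<^sub>R z))) \<partial>lborel)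
        = (LINT l:{0..L}|lborel. l ^ ?d * P (l *\<^sub>R z))"
      unfolding set_lebesgue_integral_def
      by (intro Bochner_Integration.integral_cong refl) (use in_ball in \<open>auto simp: indicator_def\<close>)
    also have "\<dots> = integral {0..L} (\<lambda>l. l ^ ?d * P (l *\<^sub>R z))"
      by (intro set_borel_integral_eq_integral borel_integrable_atLeastAtMost' cJ)
    also have "\<dots> = integral {0..w L} q"
      unfolding eq1 using sub w0 by (simp add: integral_unique)
    also have "\<dots> = (LINT l:{0..w L}|lborel. q l)"
      by (rule set_borel_integral_eq_integral(2)[symmetric]) (intro borel_integrable_atLeastAtMost' q)
    also have "\<dots> = (\<integral>l. indicator {0..} l * (l ^ ?d * Q (l *\<^sub>R z)) \<partial>lborel)"
    proof -
      have "Q (l *\<^sub>R z) = 0" if "0 \<le> l" "\<not> l \<le> w L" for l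
      proof (rule supp)
        have "w L * norm z \<le> l * norm z" using that by (intro mult_right_mono) auto
        then show "S \<le> norm (l *\<^sub>R z)" using wL that by simp
      qed
      then show ?thesis
        unfolding set_lebesgue_integral_def q_def
        by (intro Bochner_Integration.integral_cong refl) (auto simp: indicator_def)
    qed
    finally have *: "(\<integral>l. indicator {0..} l * (l ^ ?d * (indicator (cball 0 R) (l *\<^sub>R z) * P (l *\<^sub>R z))) \<partial>lborel)
      = (\<integral>l. indicator {0..} l * (l ^ ?d * Q (l *\<^sub>R z)) \<partial>lborel)" .
    have i1: "integrable lborel (\<lambda>l. indicator {0..} l * (l ^ ?d * (indicator (cball 0 R) (l *\<^sub>R z) * P (l *\<^sub>R z))))"
    proof -
      have "integrable lborel (\<lambda>l. indicator {0..L} l *\<^sub>R (l ^ ?d * P (l *\<^sub>R z)))"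
        by (intro borel_integrable_compact cJ) auto
      then show ?thesis
        by (rule Bochner_Integration.integrable_cong[THEN iffD1, rotated 2]) (use in_ball in \<open>auto simp: indicator_def\<close>)
    qed
    have i2: "integrable lborel (\<lambda>l. indicator {0..} l * (l ^ ?d * Q (l *\<^sub>R z)))"
    proof -
      have "integrable lborel (\<lambda>l. indicator {0..S / norm z} l *\<^sub>R q l)"
        by (intro borel_integrable_compact q) auto
      moreover have "Q (l *\<^sub>R z) = 0" if "0 \<le> l" "\<not> l \<le> S / norm z" for l
        using that z by (intro supp) (simp add: field_simps)
      ultimately show ?thesis
        by (elim Bochner_Integration.integrable_cong[THEN iffD1, rotated 2]) (auto simp: indicator_def q_def)
    qed
    show "(\<integral>l. indicator {0..} l * (l ^ ?d * (indicator (cball 0 R) (l *\<^sub>R z) * P (l *\<^sub>R z) - Q (l *\<^sub>R z))) \<partial>lborel) = 0"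
      using Bochner_Integration.integral_diff[OF i1 i2] * by (simp add: algebra_simps)
  qed
  with intP intQ show ?thesis by (simp add: P_def)
qed

section \<open>Expansion of the square root law\<close>

text \<open>The derivative \<open>\<Phi>1\<close>, being differentiable, is continuous and hence
  bounded on a compact interval covering the support. Beyond it \<open>\<Phi>\<close> vanishes, and
  clamping the arguments at \<open>S\<close> carries the Lipschitz bound to the half-line.\<close>

lemma kernel_profile_lipschitz:
  assumes "kernel_profile \<Phi> T"
  obtains \<Lambda> B S where "0 < S" "\<And>s. S \<le> s \<Longrightarrow> \<Phi> s = 0" "\<And>s. 0 \<le> s \<Longrightarrow> \<bar>\<Phi> s\<bar> \<le> B"
    "\<And>a b. 0 \<le> a \<Longrightarrow> 0 \<le> b \<Longrightarrow> \<bar>\<Phi> a - \<Phi> b\<bar> \<le> \<Lambda> * \<bar>a - b\<bar>" "continuous_on {0..} \<Phi>" "0 \<le> \<Lambda>"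
proof -
  obtain \<Phi>1 \<Phi>2 where d: "\<And>s. 0 \<le> s \<Longrightarrow> (\<Phi> has_real_derivative \<Phi>1 s) (at s within {0..})"
    "\<And>s. 0 \<le> s \<Longrightarrow> (\<Phi>1 has_real_derivative \<Phi>2 s) (at s within {0..})"
    and cl: "closure {s\<in>{0..}. \<Phi> s \<noteq> 0} \<subseteq> {0..T}"
    using assms unfolding kernel_profile_def by blast
  \<comment> \<open>Positive even for negative \<open>T\<close>, and strictly beyond the support, so
    that \<open>\<Phi>\<close> vanishes at \<open>S\<close> itself.\<close>
  define S where "S = max T 0 + 1"
  have S: "0 < S" "T < S" by (auto simp: S_def)
  have zero: "\<Phi> s = 0" if "S \<le> s" for s
  proof (rule ccontr)
    assume "\<Phi> s \<noteq> 0"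
    then have "s \<in> closure {s\<in>{0..}. \<Phi> s \<noteq> 0}"
      using that S by (intro closure_subset[THEN subsetD]) auto
    then show False using cl that S by auto
  qed
  have c\<Phi>: "continuous_on {0..} \<Phi>" "continuous_on {0..} \<Phi>1"
    using d by (auto intro: DERIV_continuous_on)
  then have "bounded (\<Phi> ` {0..S})" "bounded (\<Phi>1 ` {0..S})"
    by (auto intro!: compact_imp_bounded compact_continuous_image intro: continuous_on_subset)
  then obtain B \<Lambda> where B: "\<And>s. s \<in> {0..S} \<Longrightarrow> \<bar>\<Phi> s\<bar> \<le> B" and \<Lambda>: "\<And>s. s \<in> {0..S} \<Longrightarrow> \<bar>\<Phi>1 s\<bar> \<le> \<Lambda>"
    unfolding bounded_iff real_norm_def by blast
  have \<Lambda>0: "0 \<le> \<Lambda>" using \<Lambda>[of 0] S by (auto intro: order_trans[OF abs_ge_zero])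
  have clamp: "\<Phi> s = \<Phi> (min s S)" if "0 \<le> s" for s
    using zero[of s] zero[of S] by (auto simp: min_def)
  have lip: "\<bar>\<Phi> a - \<Phi> b\<bar> \<le> \<Lambda> * \<bar>a - b\<bar>" if "0 \<le> a" "0 \<le> b" for a b
  proof -
    have "norm (\<Phi> (min a S) - \<Phi> (min b S)) \<le> \<Lambda> * norm (min a S - min b S)"
    proof (rule field_differentiable_bound[of "{0..S}" \<Phi> \<Phi>1])
      show "(\<Phi> has_field_derivative \<Phi>1 z) (at z within {0..S})" if "z \<in> {0..S}" for z
        using d(1)[of z] that by (auto intro: DERIV_subset)
    qed (use \<Lambda> that S in auto)
    also have "\<dots> \<le> \<Lambda> * \<bar>a - b\<bar>"
      using \<Lambda>0 by (intro mult_left_mono) (auto simp: min_def)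
    finally show ?thesis using clamp that by simp
  qed
  have bound: "\<bar>\<Phi> s\<bar> \<le> B" if "0 \<le> s" for s
    unfolding clamp[OF that] using that S by (intro B) auto
  show ?thesis using that[OF S(1) zero bound lip c\<Phi>(1) \<Lambda>0] by simp
qed

lemma power_diff_le:
  fixes x y :: real
  assumes "\<bar>x\<bar> \<le> M" "\<bar>y\<bar> \<le> M"
  shows "\<bar>x ^ n - y ^ n\<bar> \<le> real n * M ^ (n - 1) * \<bar>x - y\<bar>"
proof -
  have M: "0 \<le> M" using assms by linarith
  have "\<bar>x ^ Suc n - y ^ Suc n\<bar> \<le> real (Suc n) * M ^ n * \<bar>x - y\<bar>" for n
  proof (induction n)
    case (Suc n)
    have "x ^ Suc (Suc n) - y ^ Suc (Suc n) = x * (x ^ Suc n - y ^ Suc n) + (x - y) * y ^ Suc n"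
      by (simp add: algebra_simps)
    then have "\<bar>x ^ Suc (Suc n) - y ^ Suc (Suc n)\<bar> \<le> \<bar>x\<bar> * \<bar>x ^ Suc n - y ^ Suc n\<bar> + \<bar>x - y\<bar> * \<bar>y\<bar> ^ Suc n"
      by (metis abs_mult abs_triangle_ineq power_abs)
    also have "\<dots> \<le> M * (real (Suc n) * M ^ n * \<bar>x - y\<bar>) + \<bar>x - y\<bar> * M ^ Suc n"
      using assms M Suc by (intro add_mono mult_mono power_mono) auto
    also have "\<dots> = real (Suc (Suc n)) * M ^ Suc n * \<bar>x - y\<bar>" by (simp add: algebra_simps)
    finally show ?case .
  qed simp
  from this[of "n - 1"] show ?thesis by (cases n) auto
qed

text \<open>The bandwidth factor enters the integrand as a power and inside \<open>\<Phi>\<close>.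
  This bound, uniform in \<open>m\<close>, passes an error \<open>o(h^4)\<close> of the factor on to
  the integrand.\<close>

lemma radial_profile_lipschitz:
  fixes \<Phi> :: "real \<Rightarrow> real"
  assumes B: "\<And>s. 0 \<le> s \<Longrightarrow> \<bar>\<Phi> s\<bar> \<le> B"
    and lip: "\<And>a b. 0 \<le> a \<Longrightarrow> 0 \<le> b \<Longrightarrow> \<bar>\<Phi> a - \<Phi> b\<bar> \<le> \<Lambda> * \<bar>a - b\<bar>" "0 \<le> \<Lambda>"
    and x: "\<bar>x\<bar> \<le> M" and y: "\<bar>y\<bar> \<le> M" and m: "0 \<le> m" "m \<le> W"
  shows "\<bar>x ^ n * \<Phi> (x\<^sup>2 * m) - y ^ n * \<Phi> (y\<^sup>2 * m)\<bar>
    \<le> (real n * M ^ (n - 1) * B + M ^ n * (\<Lambda> * (2 * M * W))) * \<bar>x - y\<bar>"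
proof -
  have M: "0 \<le> M" using x by linarith
  have B0: "0 \<le> B" using B[of 0] by linarith
  have "x ^ n * \<Phi> (x\<^sup>2 * m) - y ^ n * \<Phi> (y\<^sup>2 * m)
      = (x ^ n - y ^ n) * \<Phi> (x\<^sup>2 * m) + y ^ n * (\<Phi> (x\<^sup>2 * m) - \<Phi> (y\<^sup>2 * m))"
    by (simp add: algebra_simps)
  then have "\<bar>x ^ n * \<Phi> (x\<^sup>2 * m) - y ^ n * \<Phi> (y\<^sup>2 * m)\<bar>
      \<le> \<bar>x ^ n - y ^ n\<bar> * \<bar>\<Phi> (x\<^sup>2 * m)\<bar> + \<bar>y\<bar> ^ n * \<bar>\<Phi> (x\<^sup>2 * m) - \<Phi> (y\<^sup>2 * m)\<bar>"
    by (metis abs_mult abs_triangle_ineq power_abs)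
  also have "\<dots> \<le> (real n * M ^ (n - 1) * \<bar>x - y\<bar>) * B + M ^ n * (\<Lambda> * (2 * M * W * \<bar>x - y\<bar>))"
  proof (intro add_mono mult_mono power_diff_le x y B power_mono)
    have "\<bar>\<Phi> (x\<^sup>2 * m) - \<Phi> (y\<^sup>2 * m)\<bar> \<le> \<Lambda> * \<bar>x\<^sup>2 * m - y\<^sup>2 * m\<bar>"
      using m by (intro lip) auto
    also have "\<bar>x\<^sup>2 * m - y\<^sup>2 * m\<bar> = \<bar>x + y\<bar> * m * \<bar>x - y\<bar>"
      using m by (simp add: power2_eq_square square_diff_square_factored left_diff_distrib[symmetric] abs_mult)
    also have "\<dots> \<le> (2 * M) * W * \<bar>x - y\<bar>"
      using x y m by (intro mult_right_mono mult_mono) auto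
    finally show "\<bar>\<Phi> (x\<^sup>2 * m) - \<Phi> (y\<^sup>2 * m)\<bar> \<le> \<Lambda> * (2 * M * W * \<bar>x - y\<bar>)"
      using lip(2) by (simp add: mult_left_mono)
  qed (use M m B0 in auto)
  finally show ?thesis by (simp add: algebra_simps)
qed

text \<open>With \<open>g = \<rho>\<^sup>2\<close> and \<open>\<rho> = e0 + e1 h + e2 h\<^sup>2 + e3 h\<^sup>3 + e4 h\<^sup>4\<close>, the first factor is \<open>\<rho> - h \<rho>'\<close>; the
  coefficient of \<open>h\<^sup>4\<close> in the second factor is the one of \<open>\<rho>\<^sup>2\<close>, and the absence of an \<open>h\<^sup>2\<close> term is the
  bias reduction of the square root law.\<close>

lemma square_root_law_expansion:
  fixes h e0 e1 e2 e3 e4 \<rho> :: real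
  assumes e0: "e0 \<noteq> 0" and \<rho>: "\<rho> = e0 + e1 * h + e2 * h^2 + e3 * h^3 + e4 * h^4" and \<rho>0: "\<rho> \<noteq> 0"
  defines "c2 \<equiv> e2 + e3 * h + e4 * h^2"
  defines "c1 \<equiv> e1 + h * c2"
  defines "r \<equiv> c1 / \<rho> / e0"
  defines "r' \<equiv> c2 / e0^2 - c1 * r / e0"
  defines "r2 \<equiv> r^2 - 2 * r' / e0"
  defines "r3 \<equiv> - 3 * r / e0^2 + 3 * h * r^2 / e0 - h^2 * r^3"
  defines "F4 \<equiv> 2 * e0 * e4 + 2 * e1 * e3 + e2^2"
  defines "s2 \<equiv> e2 / e0^2" and "s3 \<equiv> 2 * e3 / e0^2" and "s4 \<equiv> 3 * e4 / e0^2 + e2^2 / e0^3"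
  shows "(e0 - e2 * h^2 - 2 * e3 * h^3 - 3 * e4 * h^4) *
      (\<rho> / e0^2 - e1 / e0^2 * h + e3 * h^3 / \<rho>^2 + F4 * h^4 / \<rho>^3)
    = 1 + h^5 * ((e0 - e2 * h^2 - 2 * e3 * h^3 - 3 * e4 * h^4) * (e3 * r2 + F4 * r3)
        - (e2 * s3 + 2 * e3 * s2) - h * (e2 * s4 + 2 * e3 * s3 + 3 * e4 * s2)
        - h^2 * (2 * e3 * s4 + 3 * e4 * s3) - h^3 * (3 * e4 * s4))"
proof -
  have \<rho>1: "\<rho> = e0 + h * c1"
    unfolding \<rho> c1_def c2_def by (simp add: algebra_simps power2_eq_square power3_eq_cube power4_eq_xxxx)
  \<comment> \<open>\<open>r\<close>, \<open>r2\<close> and \<open>r3\<close> are exact remainders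
    for \<open>1 / \<rho>\<close>, its square and its cube, and \<open>r'\<close> is the remainder
    of \<open>r\<close> itself. No limit is involved; uniformity follows later from boundedness of
    the remainders.\<close>
  have w: "1 / \<rho> = 1 / e0 - h * r"
  proof -
    have "h * c1 = \<rho> - e0" using \<rho>1 by simp
    then have "h * r = (\<rho> - e0) / (\<rho> * e0)" by (simp add: r_def)
    then show ?thesis using e0 \<rho>0 by (simp add: field_simps)
  qed
  have r: "r = e1 / e0^2 + h * r'"
  proof -
    have "r = c1 / e0 * (1 / \<rho>)" by (simp add: r_def)
    also have "\<dots> = c1 / e0^2 - h * (c1 * r / e0)" unfolding w using e0 by (simp add: field_simps power2_eq_square)
    also have "\<dots> = e1 / e0^2 + h * r'" unfolding r'_def by (simp add: c1_def field_simps add_divide_distrib)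
    finally show ?thesis .
  qed
  have w2: "1 / \<rho>^2 = 1 / e0^2 - 2 * h * e1 / e0^3 + h^2 * r2"
  proof -
    have "1 / \<rho>^2 = (1 / e0 - h * r)^2" by (simp add: w[symmetric] power_divide)
    also have "\<dots> = 1 / e0^2 - 2 * h * r / e0 + h^2 * r^2" using e0 by (simp add: power2_eq_square field_simps)
    also have "2 * h * r / e0 = 2 * h * e1 / e0^3 + h^2 * (2 * r' / e0)"
      by (subst r) (use e0 in \<open>simp add: field_simps power2_eq_square power3_eq_cube\<close>)
    finally show ?thesis by (simp add: r2_def algebra_simps)
  qed
  have w3: "1 / \<rho>^3 = 1 / e0^3 + h * r3"
  proof -
    have "1 / \<rho>^3 = (1 / e0 - h * r)^3" by (simp add: w[symmetric] power_divide)
    also have "\<dots> = 1 / e0^3 + h * r3" unfolding r3_def using e0 by (simp add: power2_eq_square power3_eq_cube field_simps)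
    finally show ?thesis .
  qed
  have "\<rho> / e0^2 - e1 / e0^2 * h + e3 * h^3 / \<rho>^2 + F4 * h^4 / \<rho>^3
     = \<rho> / e0^2 - e1 / e0^2 * h + e3 * h^3 * (1 / \<rho>^2) + F4 * h^4 * (1 / \<rho>^3)" by simp
  also have "\<dots> = 1 / e0 + s2 * h^2 + s3 * h^3 + s4 * h^4 + h^5 * (e3 * r2 + F4 * r3)"
  proof -
    have a: "\<rho> / e0^2 = 1 / e0 + e1 / e0^2 * h + s2 * h^2 + e3 / e0^2 * h^3 + e4 / e0^2 * h^4"
      unfolding \<rho> s2_def using e0 by (simp add: field_simps power2_eq_square)
    have b: "e3 * h^3 * (1 / \<rho>^2) = e3 / e0^2 * h^3 - 2 * e1 * e3 / e0^3 * h^4 + h^5 * (e3 * r2)"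
      unfolding w2 by (simp add: algebra_simps eval_nat_numeral)
    have c: "F4 * h^4 * (1 / \<rho>^3) = F4 / e0^3 * h^4 + h^5 * (F4 * r3)"
      unfolding w3 by (simp add: algebra_simps eval_nat_numeral)
    have s4: "s4 = e4 / e0^2 - 2 * e1 * e3 / e0^3 + F4 / e0^3"
      unfolding s4_def F4_def using e0 by (simp add: field_simps eval_nat_numeral)
    have s3: "s3 = 2 * (e3 / e0^2)" by (simp add: s3_def)
    show ?thesis unfolding a b c s3 s4 by (simp add: algebra_simps)
  qed
  finally have second: "\<rho> / e0^2 - e1 / e0^2 * h + e3 * h^3 / \<rho>^2 + F4 * h^4 / \<rho>^3
      = 1 / e0 + s2 * h^2 + s3 * h^3 + s4 * h^4 + h^5 * (e3 * r2 + F4 * r3)" .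
  \<comment> \<open>Exactly these relations cancel the coefficients of \<open>h^2\<close>,
    \<open>h^3\<close> and \<open>h^4\<close> in the product of the two factors.\<close>
  have k: "e0 * s2 = e2 / e0" "e0 * s3 = 2 * e3 / e0" "e0 * s4 = 3 * e4 / e0 + e2 * s2"
    using e0 by (auto simp: s2_def s3_def s4_def field_simps eval_nat_numeral)
  define Z where "Z = e3 * r2 + F4 * r3"
  have "(e0 - e2 * h^2 - 2 * e3 * h^3 - 3 * e4 * h^4) * (1 / e0 + s2 * h^2 + s3 * h^3 + s4 * h^4)
     = 1 + h^2 * (e0 * s2 - e2 / e0) + h^3 * (e0 * s3 - 2 * e3 / e0) + h^4 * (e0 * s4 - e2 * s2 - 3 * e4 / e0)
       - h^5 * (e2 * s3 + 2 * e3 * s2) - h^6 * (e2 * s4 + 2 * e3 * s3 + 3 * e4 * s2)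
        - h^7 * (2 * e3 * s4 + 3 * e4 * s3) - h^8 * (3 * e4 * s4)"
    using e0 by (simp add: algebra_simps add_divide_distrib diff_divide_distrib eval_nat_numeral)
  then have first: "(e0 - e2 * h^2 - 2 * e3 * h^3 - 3 * e4 * h^4) * (1 / e0 + s2 * h^2 + s3 * h^3 + s4 * h^4)
     = 1 - h^5 * (e2 * s3 + 2 * e3 * s2) - h^6 * (e2 * s4 + 2 * e3 * s3 + 3 * e4 * s2)
        - h^7 * (2 * e3 * s4 + 3 * e4 * s3) - h^8 * (3 * e4 * s4)"
    by (simp add: k)
  have pw: "h^6 = h^5 * h" "h^7 = h^5 * h^2" "h^8 = h^5 * h^3" by (simp_all add: eval_nat_numeral)
  show ?thesis
    unfolding second Z_def[symmetric] distrib_left[of _ _ "h^5 * Z"] first pw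
    by (simp add: right_diff_distrib mult.left_commute mult.assoc)
qed

section \<open>Error bounds uniform in the direction\<close>

text \<open>Introduction rules that reduce boundedness of an explicit expression to that of its
  ingredients.\<close>

lemma bigo_1_closure:
  fixes f g :: "'a \<Rightarrow> real"
  shows "(\<lambda>_. c) \<in> O[F](\<lambda>_. 1)"
    and "f \<in> O[F](\<lambda>_. 1) \<Longrightarrow> g \<in> O[F](\<lambda>_. 1) \<Longrightarrow> (\<lambda>x. f x + g x) \<in> O[F](\<lambda>_. 1)"
    and "f \<in> O[F](\<lambda>_. 1) \<Longrightarrow> g \<in> O[F](\<lambda>_. 1) \<Longrightarrow> (\<lambda>x. f x - g x) \<in> O[F](\<lambda>_. 1)"
    and "f \<in> O[F](\<lambda>_. 1) \<Longrightarrow> g \<in> O[F](\<lambda>_. 1) \<Longrightarrow> (\<lambda>x. f x * g x) \<in> O[F](\<lambda>_. 1)"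
    and "f \<in> O[F](\<lambda>_. 1) \<Longrightarrow> (\<lambda>x. f x ^ k) \<in> O[F](\<lambda>_. 1)"
    and "f \<in> O[F](\<lambda>_. 1) \<Longrightarrow> (\<lambda>x. f x / c) \<in> O[F](\<lambda>_. 1)"
    and "(f \<longlongrightarrow> l) F \<Longrightarrow> f \<in> O[F](\<lambda>_. 1)"
proof -
  assume f: "f \<in> O[F](\<lambda>_. 1)"
  show "(\<lambda>x. f x ^ k) \<in> O[F](\<lambda>_. 1)" using landau_o.big_power[OF f, of k] by simp
  show "(\<lambda>x. f x / c) \<in> O[F](\<lambda>_. 1)"
    using landau_o.big.mult_in_1[OF f, of "\<lambda>_. inverse c"] by (simp add: divide_inverse)
qed (auto intro: sum_in_bigo landau_o.big.mult_in_1 bigoI_tendsto)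

lemma bigo_1_mult_tendsto_0:
  fixes f g :: "'a \<Rightarrow> real"
  assumes "f \<in> O[F](\<lambda>_. 1)" "(g \<longlongrightarrow> 0) F"
  shows "((\<lambda>x. f x * g x) \<longlongrightarrow> 0) F"
proof -
  have "g \<in> o[F](\<lambda>_. 1)" using assms(2) by (intro smalloI_tendsto) auto
  from landau_o.big_small_mult[OF assms(1) this] show ?thesis
    by (auto dest: smalloD_tendsto)
qed

text \<open>The factor \<open>principal U\<close> of the filter makes the Landau symbols uniform in
  \<open>u\<close>. Here \<open>q\<close> is the bandwidth factor and \<open>1 / \<rho>\<close> its
  approximation. First the Lipschitz bound replaces \<open>q\<close> by \<open>1 / \<rho>\<close>;
  then \<open>square_root_law_expansion\<close> replaces one factor \<open>1 / \<rho>\<close> by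
  \<open>A * G\<close>, with an error of order \<open>h^5\<close>. What remains beside
  \<open>G\<close> is shaped like the Jacobian of the radial substitution.\<close>

lemma square_root_law_uniform:
  fixes e1 e2 e3 e4 m :: "'a \<Rightarrow> real" and q :: "real \<times> 'a \<Rightarrow> real" and \<Phi> :: "real \<Rightarrow> real"
  assumes e0: "0 < e0"
    and bnd: "\<And>u. u \<in> U \<Longrightarrow> \<bar>e1 u\<bar> \<le> E" "\<And>u. u \<in> U \<Longrightarrow> \<bar>e2 u\<bar> \<le> E"
      "\<And>u. u \<in> U \<Longrightarrow> \<bar>e3 u\<bar> \<le> E" "\<And>u. u \<in> U \<Longrightarrow> \<bar>e4 u\<bar> \<le> E"
    and m: "\<And>u. u \<in> U \<Longrightarrow> 0 \<le> m u" "\<And>u. u \<in> U \<Longrightarrow> m u \<le> W"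
    and B: "\<And>s. 0 \<le> s \<Longrightarrow> \<bar>\<Phi> s\<bar> \<le> B"
    and lip: "\<And>a b. 0 \<le> a \<Longrightarrow> 0 \<le> b \<Longrightarrow> \<bar>\<Phi> a - \<Phi> b\<bar> \<le> \<Lambda> * \<bar>a - b\<bar>" "0 \<le> \<Lambda>"
  defines "F \<equiv> at_right 0 \<times>\<^sub>F principal U"
  defines "\<rho> \<equiv> \<lambda>(h, u). e0 + e1 u * h + e2 u * h^2 + e3 u * h^3 + e4 u * h^4"
  assumes pos: "\<forall>\<^sub>F p in F. 0 < q p"
    and q: "(\<lambda>p. 1 / (q p)\<^sup>2 - (\<rho> p)\<^sup>2) \<in> o[F](\<lambda>p. fst p ^ 4)"
  defines "A \<equiv> \<lambda>(h, u). e0 - e2 u * h^2 - 2 * e3 u * h^3 - 3 * e4 u * h^4"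
  defines "G \<equiv> \<lambda>u v. 1 / e0^2 - e1 u / e0^2 * v + e3 u * v^3 + (2 * e0 * e4 u + 2 * e1 u * e3 u + (e2 u)^2) * v^4"
  shows "(\<rho> \<longlongrightarrow> e0) F"
    and "(\<lambda>p. q p ^ Suc n * \<Phi> ((q p)\<^sup>2 * m (snd p)) - \<Phi> ((1 / \<rho> p)\<^sup>2 * m (snd p)) * (1 / \<rho> p) ^ n * (A p * G (snd p) (fst p / \<rho> p)))
       \<in> o[F](\<lambda>p. fst p ^ 4)"
proof -
  have inU: "\<forall>\<^sub>F p in F. snd p \<in> U"
    using filterlim_snd[where F="at_right (0::real)" and G="principal U"] by (simp add: filterlim_principal F_def)
  have hpos: "\<forall>\<^sub>F p in F. 0 < fst p"
    using filterlim_fst[where F="at_right (0::real)" and G="principal U"]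
    unfolding F_def filterlim_iff by (auto simp: eventually_at_right_less)
  have h0: "(fst \<longlongrightarrow> 0) F"
    unfolding F_def by (rule filterlim_mono[OF filterlim_fst _ order_refl]) (simp add: at_within_def)
  have "(\<lambda>p. e (snd p)) \<in> O[F](\<lambda>_. 1)" if "\<And>u. u \<in> U \<Longrightarrow> \<bar>e u\<bar> \<le> E" for e :: "'a \<Rightarrow> real"
    using inU by (intro bigoI[of _ E]) (auto elim!: eventually_mono intro: that)
  note O_e = this[OF bnd(1)] this[OF bnd(2)] this[OF bnd(3)] this[OF bnd(4)]
  have hk: "((\<lambda>p. fst p ^ k) \<longlongrightarrow> 0) F" if "0 < k" for k
    using tendsto_power[OF h0, of k] that by (simp add: zero_power)
  have O_h: "fst \<in> O[F](\<lambda>_. 1)" using h0 by (rule bigo_1_closure)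
  have \<rho>: "\<rho> p = e0 + e1 (snd p) * fst p + e2 (snd p) * fst p^2 + e3 (snd p) * fst p^3 + e4 (snd p) * fst p^4" for p
    by (simp add: \<rho>_def case_prod_beta)
  have "((\<lambda>p. e0 + e1 (snd p) * fst p + e2 (snd p) * fst p^2 + e3 (snd p) * fst p^3 + e4 (snd p) * fst p^4) \<longlongrightarrow> e0 + 0 + 0 + 0 + 0) F"
    by (intro tendsto_add tendsto_const bigo_1_mult_tendsto_0 O_e hk h0) simp_all
  then show lim: "(\<rho> \<longlongrightarrow> e0) F" by (simp add: \<rho>[abs_def])
  have \<rho>pos: "\<forall>\<^sub>F p in F. e0 / 2 < \<rho> p"
    using lim e0 by (intro order_tendstoD(1)) auto
  have "((\<lambda>p. (1 / (q p)\<^sup>2 - (\<rho> p)\<^sup>2) * 1) \<longlongrightarrow> 0) F"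
  proof (rule Lim_transform_eventually)
    have "((\<lambda>p. (1 / (q p)\<^sup>2 - (\<rho> p)\<^sup>2) / fst p ^ 4) \<longlongrightarrow> 0) F"
      using q by (rule smalloD_tendsto)
    from tendsto_mult[OF this hk[of 4]]
    show "((\<lambda>p. (1 / (q p)\<^sup>2 - (\<rho> p)\<^sup>2) / fst p ^ 4 * fst p ^ 4) \<longlongrightarrow> 0) F" by simp
  qed (use hpos in \<open>auto elim!: eventually_mono\<close>)
  from tendsto_add[OF this tendsto_power[OF lim, of 2]]
  have "((\<lambda>p. 1 / (q p)\<^sup>2) \<longlongrightarrow> e0\<^sup>2) F" by simp
  from tendsto_real_sqrt[OF this] have "((\<lambda>p. 1 / \<bar>q p\<bar>) \<longlongrightarrow> e0) F"
    using e0 by (simp add: real_sqrt_divide)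
  from tendsto_divide[OF tendsto_const[of 1] this] have qlim': "((\<lambda>p. \<bar>q p\<bar>) \<longlongrightarrow> 1 / e0) F" using e0 by simp
  have qlim: "(q \<longlongrightarrow> 1 / e0) F"
    by (rule Lim_transform_eventually[OF qlim']) (use pos in \<open>auto elim!: eventually_mono\<close>)
  have O_w: "(\<lambda>p. 1 / \<rho> p) \<in> O[F](\<lambda>_. 1)"
    by (rule bigo_1_closure(7)[OF tendsto_divide[OF tendsto_const lim]]) (use e0 in simp)
  have qw: "(\<lambda>p. q p - 1 / \<rho> p) \<in> o[F](\<lambda>p. fst p ^ 4)"
  proof -
    \<comment> \<open>The prefactor arises on factoring \<open>1 / q^2 - \<rho>^2\<close> as a
      difference of squares and solving for \<open>q - 1 / \<rho>\<close>; it converges and is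
      therefore bounded.\<close>
    have "((\<lambda>p. q p / (\<rho> p * (\<rho> p + 1 / q p))) \<longlongrightarrow> (1 / e0) / (e0 * (e0 + 1 / (1 / e0)))) F"
      using e0 by (intro tendsto_intros qlim lim) auto
    from landau_o.big_small_mult[OF bigo_1_closure(7)[OF this] q]
    have *: "(\<lambda>p. q p / (\<rho> p * (\<rho> p + 1 / q p)) * (1 / (q p)\<^sup>2 - (\<rho> p)\<^sup>2)) \<in> o[F](\<lambda>p. fst p ^ 4)" by simp
    have "\<forall>\<^sub>F p in F. q p / (\<rho> p * (\<rho> p + 1 / q p)) * (1 / (q p)\<^sup>2 - (\<rho> p)\<^sup>2) = - (q p - 1 / \<rho> p)"
      using pos \<rho>pos
    proof eventually_elim
      case (elim p)
      then have "0 < \<rho> p" "0 < q p" using e0 by auto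
      then have "\<rho> p + 1 / q p \<noteq> 0" by (simp add: add_pos_pos less_imp_neq[symmetric])
      have "1 / (q p)\<^sup>2 - (\<rho> p)\<^sup>2 = (1 / q p - \<rho> p) * (\<rho> p + 1 / q p)"
        by (simp add: algebra_simps power2_eq_square)
      then have "q p / (\<rho> p * (\<rho> p + 1 / q p)) * (1 / (q p)\<^sup>2 - (\<rho> p)\<^sup>2) = q p / \<rho> p * (1 / q p - \<rho> p)"
        using \<open>\<rho> p + 1 / q p \<noteq> 0\<close> by simp
      also have "q p / \<rho> p * (1 / q p - \<rho> p) = - (q p - 1 / \<rho> p)"
        using \<open>0 < \<rho> p\<close> \<open>0 < q p\<close> by (simp add: field_simps)
      finally show ?case .
    qed
    from landau_o.small.in_cong[OF this] * have "(\<lambda>p. - (q p - 1 / \<rho> p)) \<in> o[F](\<lambda>p. fst p ^ 4)" by simp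
    then show ?thesis by (simp only: landau_o.small.uminus_in_iff)
  qed
  \<comment> \<open>Both \<open>q\<close> and \<open>1 / \<rho>\<close> tend to
    \<open>1 / e0\<close>, so \<open>2 / e0\<close> eventually serves as the \<open>M\<close> of
    \<open>radial_profile_lipschitz\<close>.\<close>
  define C where "C = real (Suc n) * (2 / e0) ^ n * B + (2 / e0) ^ Suc n * (\<Lambda> * (2 * (2 / e0) * W))"
  have part1: "(\<lambda>p. q p ^ Suc n * \<Phi> ((q p)\<^sup>2 * m (snd p)) - (1 / \<rho> p) ^ Suc n * \<Phi> ((1 / \<rho> p)\<^sup>2 * m (snd p))) \<in> o[F](\<lambda>p. fst p ^ 4)"
  proof (rule landau_o.big_small_trans[OF _ qw], rule bigoI)
    have "\<forall>\<^sub>F p in F. q p < 2 / e0"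
      using qlim e0 by (intro order_tendstoD(2)) (auto simp: field_simps)
    then show "\<forall>\<^sub>F p in F. norm (q p ^ Suc n * \<Phi> ((q p)\<^sup>2 * m (snd p)) - (1 / \<rho> p) ^ Suc n * \<Phi> ((1 / \<rho> p)\<^sup>2 * m (snd p)))
        \<le> C * norm (q p - 1 / \<rho> p)"
      using pos \<rho>pos inU
    proof eventually_elim
      case (elim p)
      have "0 < \<rho> p" using elim e0 by linarith
      have "1 / \<rho> p \<le> 1 / (e0 / 2)" using elim e0 by (intro divide_left_mono) auto
      then have "\<bar>1 / \<rho> p\<bar> \<le> 2 / e0" using \<open>0 < \<rho> p\<close> by simp
      from radial_profile_lipschitz[where \<Phi>=\<Phi> and n="Suc n", OF B lip _ this m(1)[OF elim(4)] m(2)[OF elim(4)], of "q p"] elim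
      show ?case by (simp add: C_def)
    qed
  qed
  define c2 where "c2 p = e2 (snd p) + e3 (snd p) * fst p + e4 (snd p) * fst p^2" for p
  define c1 where "c1 p = e1 (snd p) + fst p * c2 p" for p
  define r where "r p = c1 p * (1 / \<rho> p) / e0" for p
  define r' where "r' p = c2 p / e0^2 - c1 p * r p / e0" for p
  define r2 where "r2 p = (r p)^2 - 2 * r' p / e0" for p
  define r3 where "r3 p = - 3 * r p / e0^2 + 3 * fst p * (r p)^2 / e0 - fst p^2 * (r p)^3" for p
  define F4 where "F4 p = 2 * e0 * e4 (snd p) + 2 * e1 (snd p) * e3 (snd p) + (e2 (snd p))^2" for p :: "real \<times> 'a"
  define s2 where "s2 p = e2 (snd p) / e0^2" for p :: "real \<times> 'a"
  define s3 where "s3 p = 2 * e3 (snd p) / e0^2" for p :: "real \<times> 'a"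
  define s4 where "s4 p = 3 * e4 (snd p) / e0^2 + (e2 (snd p))^2 / e0^3" for p :: "real \<times> 'a"
  define Z where "Z p = (e0 - e2 (snd p) * fst p^2 - 2 * e3 (snd p) * fst p^3 - 3 * e4 (snd p) * fst p^4) * (e3 (snd p) * r2 p + F4 p * r3 p)
        - (e2 (snd p) * s3 p + 2 * e3 (snd p) * s2 p) - fst p * (e2 (snd p) * s4 p + 2 * e3 (snd p) * s3 p + 3 * e4 (snd p) * s2 p)
        - fst p^2 * (2 * e3 (snd p) * s4 p + 3 * e4 (snd p) * s3 p) - fst p^3 * (3 * e4 (snd p) * s4 p)" for p
  note cl = bigo_1_closure(1-6) O_e O_h O_w
  have O1: "c2 \<in> O[F](\<lambda>_. 1)" unfolding c2_def[abs_def] by (intro cl)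
  have O2: "c1 \<in> O[F](\<lambda>_. 1)" unfolding c1_def[abs_def] by (intro cl O1)
  have O3: "r \<in> O[F](\<lambda>_. 1)" unfolding r_def[abs_def] by (intro cl O2)
  have O4: "r' \<in> O[F](\<lambda>_. 1)" unfolding r'_def[abs_def] by (intro cl O1 O2 O3)
  have O5: "r2 \<in> O[F](\<lambda>_. 1)" unfolding r2_def[abs_def] by (intro cl O3 O4)
  have O6: "r3 \<in> O[F](\<lambda>_. 1)" unfolding r3_def[abs_def] by (intro cl O3)
  have O7: "F4 \<in> O[F](\<lambda>_. 1)" unfolding F4_def[abs_def] by (intro cl)
  have O8: "s2 \<in> O[F](\<lambda>_. 1)" unfolding s2_def[abs_def] by (intro cl)
  have O9: "s3 \<in> O[F](\<lambda>_. 1)" unfolding s3_def[abs_def] by (intro cl)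
  have O10: "s4 \<in> O[F](\<lambda>_. 1)" unfolding s4_def[abs_def] by (intro cl)
  have OZ: "Z \<in> O[F](\<lambda>_. 1)" unfolding Z_def[abs_def] by (intro cl O5 O6 O7 O8 O9 O10)
  have O\<Phi>: "(\<lambda>p. \<Phi> ((1 / \<rho> p)\<^sup>2 * m (snd p))) \<in> O[F](\<lambda>_. 1)"
    by (rule bigoI[of _ B]) (use inU in \<open>auto elim!: eventually_mono intro!: B mult_nonneg_nonneg m\<close>)
  \<comment> \<open>The exact identity says that \<open>A * G\<close> equals
    \<open>(1 + h^5 * Z) / \<rho>\<close>; the surplus \<open>h^5\<close> is split into a vanishing
    factor \<open>h\<close> and the required \<open>h^4\<close>.\<close>
  have key: "\<forall>\<^sub>F p in F. (1 / \<rho> p) ^ Suc n * \<Phi> ((1 / \<rho> p)\<^sup>2 * m (snd p)) - \<Phi> ((1 / \<rho> p)\<^sup>2 * m (snd p)) * (1 / \<rho> p) ^ n * (A p * G (snd p) (fst p / \<rho> p))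
      = - ((1 / \<rho> p) ^ Suc n * \<Phi> ((1 / \<rho> p)\<^sup>2 * m (snd p)) * Z p * fst p) * fst p ^ 4"
    using \<rho>pos
  proof eventually_elim
    case (elim p)
    then have \<rho>0: "\<rho> p \<noteq> 0" using e0 by auto
    have e0': "e0 \<noteq> 0" using e0 by simp
    have "A p * (\<rho> p / e0^2 - e1 (snd p) / e0^2 * fst p + e3 (snd p) * fst p^3 / (\<rho> p)^2 + F4 p * fst p^4 / (\<rho> p)^3) = 1 + fst p^5 * Z p"
      using square_root_law_expansion[OF e0' \<rho> \<rho>0]
      by (simp add: A_def case_prod_beta Z_def F4_def r_def r'_def r2_def r3_def s2_def s3_def s4_def c1_def c2_def)
    also have "\<rho> p / e0^2 - e1 (snd p) / e0^2 * fst p + e3 (snd p) * fst p^3 / (\<rho> p)^2 + F4 p * fst p^4 / (\<rho> p)^3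
        = \<rho> p * G (snd p) (fst p / \<rho> p)"
      using \<rho>0 by (simp add: G_def F4_def distrib_left right_diff_distrib power_divide eval_nat_numeral)
    finally have "A p * G (snd p) (fst p / \<rho> p) = (1 / \<rho> p) * (1 + fst p^5 * Z p)"
      using \<rho>0 by (simp add: field_simps)
    then show ?case by (simp add: algebra_simps eval_nat_numeral)
  qed
  have "(\<lambda>p. - ((1 / \<rho> p) ^ Suc n * \<Phi> ((1 / \<rho> p)\<^sup>2 * m (snd p)) * Z p * fst p) * fst p ^ 4) \<in> o[F](\<lambda>p. fst p ^ 4)"
  proof -
    have "((\<lambda>p. ((1 / \<rho> p) ^ Suc n * \<Phi> ((1 / \<rho> p)\<^sup>2 * m (snd p)) * Z p) * fst p) \<longlongrightarrow> 0) F"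
      by (intro bigo_1_mult_tendsto_0 h0 cl O\<Phi> OZ)
    then have "(\<lambda>p. ((1 / \<rho> p) ^ Suc n * \<Phi> ((1 / \<rho> p)\<^sup>2 * m (snd p)) * Z p) * fst p) \<in> o[F](\<lambda>_. 1)"
      by (intro smalloI_tendsto) auto
    from landau_o.small_big_mult[OF this landau_o.big_refl[of "\<lambda>p. fst p ^ 4"]] show ?thesis
      by simp
  qed
  then have part2: "(\<lambda>p. (1 / \<rho> p) ^ Suc n * \<Phi> ((1 / \<rho> p)\<^sup>2 * m (snd p)) - \<Phi> ((1 / \<rho> p)\<^sup>2 * m (snd p)) * (1 / \<rho> p) ^ n * (A p * G (snd p) (fst p / \<rho> p))) \<in> o[F](\<lambda>p. fst p ^ 4)"
    using landau_o.small.in_cong[OF key] by blast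
  from sum_in_smallo(1)[OF part1 part2]
  show "(\<lambda>p. q p ^ Suc n * \<Phi> ((q p)\<^sup>2 * m (snd p)) - \<Phi> ((1 / \<rho> p)\<^sup>2 * m (snd p)) * (1 / \<rho> p) ^ n * (A p * G (snd p) (fst p / \<rho> p)))
       \<in> o[F](\<lambda>p. fst p ^ 4)" by simp
qed

section \<open>The bias of order four\<close>

lemma taylor_form_0 [simp]: "taylor_form 0 g t u = g t"
  by (simp add: taylor_form_def)

lemma taylor_form_scaleR: "taylor_form m g t (c *\<^sub>R u) = c ^ m * taylor_form m g t u"
proof -
  have "prod_list (map (($) (c *\<^sub>R u)) is) = c ^ length is * prod_list (map (($) u) is)" for "is"
    by (induction "is") auto
  then show ?thesis by (simp add: taylor_form_def sum_distrib_left mult.assoc)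
qed

lemma continuous_on_mi_power: "continuous_on A (\<lambda>u. mi_power u v)"
  unfolding mi_power_def by (intro continuous_intros)

lemma continuous_on_taylor_form: "continuous_on A (taylor_form m g t)"
  unfolding taylor_form_def[abs_def] prod_list_nth_eq_mi_power
  by (intro continuous_intros continuous_on_mi_power) auto

lemma integral_odd_eq_0:
  fixes F :: "'a::euclidean_space \<Rightarrow> real"
  assumes "integrable lborel F" "\<And>u. F (- u) = - F u"
  shows "(\<integral>u. F u \<partial>lborel) = 0"
  using integral_lborel_affine[of "-1" F 0] assms by simp

lemma eventually_at_right_prod_principal:
  "eventually P (at_right (0::real) \<times>\<^sub>F principal U) \<longleftrightarrow> (\<exists>d>0. \<forall>h u. 0 < h \<and> h < d \<and> u \<in> U \<longrightarrow> P (h, u))"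
proof
  assume "eventually P (at_right (0::real) \<times>\<^sub>F principal U)"
  then obtain Pf Pg where "eventually Pf (at_right (0::real))" "eventually Pg (principal U)" "\<And>x y. Pf x \<Longrightarrow> Pg y \<Longrightarrow> P (x, y)"
    unfolding eventually_prod_filter by blast
  then show "\<exists>d>0. \<forall>h u. 0 < h \<and> h < d \<and> u \<in> U \<longrightarrow> P (h, u)"
    unfolding eventually_at_right_field eventually_principal by blast
next
  assume "\<exists>d>0. \<forall>h u. 0 < h \<and> h < d \<and> u \<in> U \<longrightarrow> P (h, u)"
  then obtain d where d: "0 < d" "\<And>h u. 0 < h \<Longrightarrow> h < d \<Longrightarrow> u \<in> U \<Longrightarrow> P (h, u)" by blast
  then have "eventually (\<lambda>h. 0 < h \<and> h < d) (at_right (0::real))"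
    unfolding eventually_at_right_field by blast
  then show "eventually P (at_right (0::real) \<times>\<^sub>F principal U)"
    unfolding eventually_prod_filter eventually_principal
    using d by (intro exI[of _ "\<lambda>h. 0 < h \<and> h < d"] exI[of _ "\<lambda>u. u \<in> U"]) auto
qed

lemma continuous_on_kernel:
  assumes "kernel_profile \<Phi> T" "\<And>u. K u = \<Phi> ((norm u)\<^sup>2)"
  shows "continuous_on A (K :: 'a::real_normed_vector \<Rightarrow> real)"
proof -
  have c: "continuous_on {0..} \<Phi>" by (rule kernel_profile_lipschitz[OF assms(1)])
  have "continuous_on A (\<lambda>u::'a. \<Phi> ((norm u)\<^sup>2))"
    by (intro continuous_on_compose2[OF c] continuous_intros) auto
  then show ?thesis by (simp add: assms(2)[abs_def])
qed

text \<open>Against an even kernel the odd terms integrate to zero, so only the constant and the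
  form of order 4 survive, the latter through the moments of \<open>K\<close>.\<close>

lemma integral_kernel_taylor:
  fixes K g :: "real^'n::finite \<Rightarrow> real" and e1 e3 :: "real^'n \<Rightarrow> real"
  assumes K: "continuous_on UNIV K" "\<And>u. s \<le> norm u \<Longrightarrow> K u = 0" "\<And>u. K (- u) = K u" "has_bochner_integral lborel K 1"
    and e: "continuous_on UNIV e1" "continuous_on UNIV e3" "\<And>u. e1 (- u) = - e1 u" "\<And>u. e3 (- u) = - e3 u"
    and g: "C_partial 4 S g" "open S" "t \<in> S"
  shows "(\<integral>v. K v * (a - e1 v * h + e3 v * h^3 + taylor_form 4 g t v * h^4) \<partial>lborel)
    = a + h^4 * (\<Sum>v | mi_abs v = 4. kernel_moment K v * multi_deriv v g t / mi_fact v)"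
proof -
  have int: "integrable lborel (\<lambda>u. K u * P u)" if "continuous_on UNIV P" for P
    by (rule continuous_compact_support_integrable[where S=s]) (use K that in \<open>auto intro!: continuous_intros\<close>)
  note i = int[OF e(1)] int[OF e(2)] int[OF continuous_on_taylor_form[of UNIV 4 g t]]
  have iK: "integrable lborel K" "(\<integral>v. K v \<partial>lborel) = 1" using K(4) by (auto simp: has_bochner_integral_iff)
  have z: "(\<integral>v. K v * e1 v \<partial>lborel) = 0" "(\<integral>v. K v * e3 v \<partial>lborel) = 0"
    using i K e by (auto intro!: integral_odd_eq_0)
  have "(\<integral>v. K v * (a - e1 v * h + e3 v * h^3 + taylor_form 4 g t v * h^4) \<partial>lborel)
     = (\<integral>v. K v * a - K v * e1 v * h + K v * e3 v * h^3 + K v * taylor_form 4 g t v * h^4 \<partial>lborel)"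
    by (simp add: algebra_simps)
  also have "\<dots> = a + h^4 * (\<integral>v. K v * taylor_form 4 g t v \<partial>lborel)"
    using i iK z by simp
  also have "(\<integral>v. K v * taylor_form 4 g t v \<partial>lborel)
     = (\<integral>x. (\<Sum>v | mi_abs v = 4. mi_power x v * K x * (multi_deriv v g t / mi_fact v)) \<partial>lborel)"
    unfolding taylor_form_eq_multi_index_sum[OF g] by (simp add: sum_distrib_left mult_ac)
  also have "\<dots> = (\<Sum>v | mi_abs v = 4. (\<integral>x. mi_power x v * K x * (multi_deriv v g t / mi_fact v) \<partial>lborel))"
    using int[OF continuous_on_mi_power] by (intro Bochner_Integration.integral_sum) (simp add: mult.commute)
  also have "\<dots> = (\<Sum>v | mi_abs v = 4. kernel_moment K v * multi_deriv v g t / mi_fact v)"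
    by (simp add: kernel_moment_def)
  finally show ?thesis .
qed

theorem square_root_law_bias:
  fixes f K :: "real^'n::finite \<Rightarrow> real"
  assumes prof: "kernel_profile \<Phi> T" and K: "\<And>u. K u = \<Phi> ((norm u)\<^sup>2)"
    and K1: "has_bochner_integral lborel K 1"
    and f: "C_partial 4 UNIV f" and ft: "0 < f t"
  shows "\<exists>R0. \<forall>R\<ge>R0. ((\<lambda>h. ((\<integral>u. indicator (cball 0 R) u *
      (sqrt (f (t + h *\<^sub>R u)) ^ (CARD('n) + 2) * K (sqrt (f (t + h *\<^sub>R u)) *\<^sub>R u)) \<partial>lborel) - f t) / h ^ 4) \<longlongrightarrow>
    (\<Sum>v | mi_abs v = 4. kernel_moment K v * multi_deriv v (\<lambda>x. 1 / f x) t / mi_fact v)) (at_right 0)"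
proof -
  obtain \<Lambda> B S where S: "0 < S" "\<And>s. S \<le> s \<Longrightarrow> \<Phi> s = 0" and \<Phi>B: "\<And>s. 0 \<le> s \<Longrightarrow> \<bar>\<Phi> s\<bar> \<le> B"
    and lip: "\<And>a b. 0 \<le> a \<Longrightarrow> 0 \<le> b \<Longrightarrow> \<bar>\<Phi> a - \<Phi> b\<bar> \<le> \<Lambda> * \<bar>a - b\<bar>" "0 \<le> \<Lambda>"
    by (rule kernel_profile_lipschitz[OF prof]) blast
  have contK: "continuous_on A K" for A by (rule continuous_on_kernel[OF prof K])
  have contf: "continuous_on A f" for A
    using C_partial_continuous[OF f] by (rule continuous_on_subset) simp
  define e0 where "e0 = sqrt (1 / f t)"
  have e0: "0 < e0" "e0\<^sup>2 = 1 / f t" using ft by (auto simp: e0_def)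
  define S' where "S' = {x. 0 < f x}"
  define g where "g = (\<lambda>x. 1 / f x)"
  have S': "open S'" "t \<in> S'" using ft contf[of UNIV] by (auto simp: S'_def intro!: open_Collect_less)
  have "C_partial 4 S' f"
    using f by (rule C_partial_subset) simp
  then have g: "C_partial 4 S' g"
    unfolding g_def using S' by (intro C_partial_inverse) (auto simp: S'_def)
  \<comment> \<open>Coefficients of the square root of the Taylor polynomial of \<open>g\<close>,
    found degree by degree from the equation for its square.\<close>
  define e1 where "e1 u = taylor_form 1 g t u / (2 * e0)" for u
  define e2 where "e2 u = (taylor_form 2 g t u - (e1 u)\<^sup>2) / (2 * e0)" for u
  define e3 where "e3 u = (taylor_form 3 g t u - 2 * e1 u * e2 u) / (2 * e0)" for u
  define e4 where "e4 u = (taylor_form 4 g t u - 2 * e1 u * e3 u - (e2 u)\<^sup>2) / (2 * e0)" for u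
  \<comment> \<open>Homogeneity makes \<open>\<rho> (h, l *\<^sub>R z)\<close> a function of
    \<open>h * l\<close>, so differentiation along a ray amounts to differentiation in
    \<open>h\<close>. It also turns the expansion at \<open>u / \<rho>\<close> into powers of
    \<open>h / \<rho>\<close>.\<close>
  have hom: "e1 (c *\<^sub>R u) = c * e1 u" "e2 (c *\<^sub>R u) = c\<^sup>2 * e2 u" "e3 (c *\<^sub>R u) = c^3 * e3 u" "e4 (c *\<^sub>R u) = c^4 * e4 u" for c u
  proof -
    show h1: "e1 (c *\<^sub>R u) = c * e1 u" by (simp add: e1_def taylor_form_scaleR)
    show h2: "e2 (c *\<^sub>R u) = c\<^sup>2 * e2 u" unfolding e2_def h1 taylor_form_scaleR using e0 by (simp add: field_simps)
    show h3: "e3 (c *\<^sub>R u) = c^3 * e3 u" unfolding e3_def h1 h2 taylor_form_scaleR using e0 by (simp add: field_simps eval_nat_numeral)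
    show "e4 (c *\<^sub>R u) = c^4 * e4 u" unfolding e4_def h1 h2 h3 taylor_form_scaleR using e0 by (simp add: field_simps eval_nat_numeral)
  qed
  have e_eq: "2 * e0 * e1 u = taylor_form 1 g t u" "2 * e0 * e2 u = taylor_form 2 g t u - (e1 u)\<^sup>2"
    "2 * e0 * e3 u = taylor_form 3 g t u - 2 * e1 u * e2 u"
    "2 * e0 * e4 u = taylor_form 4 g t u - 2 * e1 u * e3 u - (e2 u)\<^sup>2" for u
    using e0 by (auto simp: e1_def e2_def e3_def e4_def)
  have c1: "continuous_on A e1" for A
    unfolding e1_def[abs_def] using e0 by (intro continuous_intros continuous_on_taylor_form) auto
  have c2: "continuous_on A e2" for A
    unfolding e2_def[abs_def] using e0 by (intro continuous_intros continuous_on_taylor_form c1) auto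
  have c3: "continuous_on A e3" for A
    unfolding e3_def[abs_def] using e0 by (intro continuous_intros continuous_on_taylor_form c1 c2) auto
  have c4: "continuous_on A e4" for A
    unfolding e4_def[abs_def] using e0 by (intro continuous_intros continuous_on_taylor_form c1 c2 c3) auto
  define \<beta> where "\<beta> = (\<Sum>v | mi_abs v = 4. kernel_moment K v * multi_deriv v g t / mi_fact v)"
  \<comment> \<open>For small \<open>h\<close> one has \<open>\<rho> < 2 * e0\<close>, so dividing
    by \<open>\<rho>\<close> carries the sphere of radius \<open>R\<close> beyond the support radius
    \<open>sqrt S\<close> of \<open>K\<close>.\<close>
  define R0 where "R0 = max 1 (2 * e0 * sqrt S)"
  have "((\<lambda>h. ((\<integral>u. indicator (cball 0 R) u *
      (sqrt (f (t + h *\<^sub>R u)) ^ (CARD('n) + 2) * K (sqrt (f (t + h *\<^sub>R u)) *\<^sub>R u)) \<partial>lborel) - f t) / h ^ 4) \<longlongrightarrow> \<beta>) (at_right 0)"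
    if R: "R0 \<le> R" for R
  proof -
    have R': "1 \<le> R" "0 < R" "2 * e0 * sqrt S \<le> R" using R by (auto simp: R0_def)
    define U where "U = cball (0 :: real^'n) R"
    have U: "compact U" by (simp add: U_def)
    define F where "F = at_right (0::real) \<times>\<^sub>F principal U"
    define \<rho> where "\<rho> = (\<lambda>(h, u). e0 + e1 u * h + e2 u * h^2 + e3 u * h^3 + e4 u * h^4)"
    define A where "A = (\<lambda>(h, u). e0 - e2 u * h^2 - 2 * e3 u * h^3 - 3 * e4 u * h^4)"
    define G where "G = (\<lambda>u v. 1 / e0^2 - e1 u / e0^2 * v + e3 u * v^3 + (2 * e0 * e4 u + 2 * e1 u * e3 u + (e2 u)^2) * v^4)"
    define q where "q p = sqrt (f (t + fst p *\<^sub>R snd p))" for p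
    have "\<exists>E. \<forall>u\<in>U. \<bar>e u\<bar> \<le> E" if "continuous_on U e" for e :: "real^'n \<Rightarrow> real"
    proof -
      have "bounded (e ` U)" using that U by (intro compact_imp_bounded compact_continuous_image)
      then show ?thesis by (auto simp: bounded_iff)
    qed
    from this[OF c1] this[OF c2] this[OF c3] this[OF c4]
    obtain E1 E2 E3 E4 where "\<forall>u\<in>U. \<bar>e1 u\<bar> \<le> E1" "\<forall>u\<in>U. \<bar>e2 u\<bar> \<le> E2" "\<forall>u\<in>U. \<bar>e3 u\<bar> \<le> E3" "\<forall>u\<in>U. \<bar>e4 u\<bar> \<le> E4"
      by blast
    then obtain E where E: "\<And>u. u \<in> U \<Longrightarrow> \<bar>e1 u\<bar> \<le> E" "\<And>u. u \<in> U \<Longrightarrow> \<bar>e2 u\<bar> \<le> E" "\<And>u. u \<in> U \<Longrightarrow> \<bar>e3 u\<bar> \<le> E" "\<And>u. u \<in> U \<Longrightarrow> \<bar>e4 u\<bar> \<le> E"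
      by (intro that[of "max (max E1 E2) (max E3 E4)"]) (auto simp: le_max_iff_disj)
    note taylor = uniform_taylor[OF g S', of R, OF _ R'(2), simplified]
    have pos: "\<forall>\<^sub>F p in F. 0 < q p"
      unfolding F_def eventually_at_right_prod_principal
      using taylor[of 1] by (auto simp: U_def q_def S'_def)
    define P where "P p = (\<Sum>m\<le>4. taylor_form m g t (snd p) * fst p ^ m)" for p
    have "(\<lambda>p. g (t + fst p *\<^sub>R snd p) - P p) \<in> o[F](\<lambda>p. fst p ^ 4)"
    proof (rule landau_o.smallI)
      fix c :: real assume "0 < c"
      from taylor[OF this] show "\<forall>\<^sub>F p in F. norm (g (t + fst p *\<^sub>R snd p) - P p) \<le> c * norm (fst p ^ 4)"
        unfolding F_def eventually_at_right_prod_principal by (auto simp: U_def P_def)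
    qed
    moreover have "(\<lambda>p. (\<rho> p)\<^sup>2 - P p) \<in> o[F](\<lambda>p. fst p ^ 4)"
    proof -
      \<comment> \<open>The part of \<open>\<rho>^2\<close> of orders 5 to 8 in \<open>h\<close>,
        divided by \<open>h^5\<close>.\<close>
      define Z where "Z p = 2 * e1 (snd p) * e4 (snd p) + 2 * e2 (snd p) * e3 (snd p) + (2 * e2 (snd p) * e4 (snd p) + (e3 (snd p))\<^sup>2) * fst p
        + 2 * e3 (snd p) * e4 (snd p) * fst p^2 + (e4 (snd p))\<^sup>2 * fst p ^ 3" for p :: "real \<times> (real^'n)"
      have eq: "(\<rho> p)\<^sup>2 - P p = (Z p * fst p) * fst p ^ 4" for p
      proof -
        have "taylor_form 0 g t (snd p) = e0\<^sup>2" by (simp add: g_def e0)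
        then have "P p = e0\<^sup>2 + 2 * e0 * e1 (snd p) * fst p + (2 * e0 * e2 (snd p) + (e1 (snd p))\<^sup>2) * fst p ^ 2
          + (2 * e0 * e3 (snd p) + 2 * e1 (snd p) * e2 (snd p)) * fst p ^ 3
          + (2 * e0 * e4 (snd p) + 2 * e1 (snd p) * e3 (snd p) + (e2 (snd p))\<^sup>2) * fst p ^ 4"
          unfolding P_def e_eq by (simp add: eval_nat_numeral)
        then show ?thesis
          by (simp add: \<rho>_def case_prod_beta Z_def algebra_simps eval_nat_numeral)
      qed
      have inU: "\<forall>\<^sub>F p in F. snd p \<in> U"
        unfolding F_def eventually_at_right_prod_principal by (auto intro: zero_less_one)
      have Oe: "(\<lambda>p. e (snd p)) \<in> O[F](\<lambda>_. 1)" if "\<And>u. u \<in> U \<Longrightarrow> \<bar>e u\<bar> \<le> E" for e :: "real^'n \<Rightarrow> real"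
        using inU by (intro bigoI[of _ E]) (auto elim!: eventually_mono intro: that)
      have h0: "(fst \<longlongrightarrow> 0) F"
        unfolding F_def by (rule filterlim_mono[OF filterlim_fst _ order_refl]) (simp add: at_within_def)
      have "((\<lambda>p. Z p * fst p) \<longlongrightarrow> 0) F"
        unfolding Z_def by (intro bigo_1_mult_tendsto_0 h0 bigo_1_closure(1-6) bigo_1_closure(7)[OF h0] Oe E)
      then have "(\<lambda>p. Z p * fst p) \<in> o[F](\<lambda>_. 1)"
        by (intro smalloI_tendsto) auto
      from landau_o.small_big_mult[OF this landau_o.big_refl[of "\<lambda>p. fst p ^ 4"]] show ?thesis
        by (simp add: eq)
    qed
    ultimately have "(\<lambda>p. (g (t + fst p *\<^sub>R snd p) - P p) - ((\<rho> p)\<^sup>2 - P p)) \<in> o[F](\<lambda>p. fst p ^ 4)"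
      by (rule sum_in_smallo(2))
    then have q0: "(\<lambda>p. g (t + fst p *\<^sub>R snd p) - (\<rho> p)\<^sup>2) \<in> o[F](\<lambda>p. fst p ^ 4)" by simp
    have ev: "\<forall>\<^sub>F p in F. g (t + fst p *\<^sub>R snd p) - (\<rho> p)\<^sup>2 = 1 / (q p)\<^sup>2 - (\<rho> p)\<^sup>2"
      using pos by eventually_elim (auto simp: g_def q_def)
    have q: "(\<lambda>p. 1 / (q p)\<^sup>2 - (\<rho> p)\<^sup>2) \<in> o[F](\<lambda>p. fst p ^ 4)"
      by (rule iffD1[OF landau_o.small.in_cong[OF ev] q0])
    define m where "m = (\<lambda>u::real^'n. (norm u)\<^sup>2)"
    have m: "0 \<le> m u" "m u \<le> R\<^sup>2" if "u \<in> U" for u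
      using that by (auto simp: m_def U_def intro!: power_mono)
    note unif_facts = e0(1) E m \<Phi>B lip pos[unfolded F_def] q[unfolded F_def \<rho>_def]
    have unif1: "(\<rho> \<longlongrightarrow> e0) F"
      unfolding F_def \<rho>_def by (rule square_root_law_uniform(1)[where m=m, OF unif_facts])
    define D where "D = (\<lambda>p. q p ^ Suc (CARD('n) + 1) * \<Phi> ((q p)\<^sup>2 * m (snd p)) - \<Phi> ((1 / \<rho> p)\<^sup>2 * m (snd p)) * (1 / \<rho> p) ^ (CARD('n) + 1) * (A p * G (snd p) (fst p / \<rho> p)))"
    have D: "D \<in> o[F](\<lambda>p. fst p ^ 4)" 
      unfolding D_def F_def \<rho>_def A_def G_def by (rule square_root_law_uniform(2)[where m=m, OF unif_facts])
    have \<rho>ev: "\<forall>\<^sub>F p in F. \<rho> p < 2 * e0 \<and> 0 < \<rho> p"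
      using order_tendstoD[OF unif1] e0 by (intro eventually_conj) auto
    then obtain d0 where d0: "0 < d0" "\<And>h u. 0 < h \<Longrightarrow> h < d0 \<Longrightarrow> u \<in> U \<Longrightarrow> \<rho> (h, u) < 2 * e0 \<and> 0 < \<rho> (h, u)"
      unfolding F_def eventually_at_right_prod_principal by blast
    \<comment> \<open>For fixed \<open>h\<close> the approximating integral is evaluated exactly as
      \<open>f t + h^4 * \<beta>\<close>, so only \<open>D\<close> has to be estimated.\<close>
    have main: "\<bar>(\<integral>u. indicator U u * (q (h, u) ^ (CARD('n) + 2) * K (q (h, u) *\<^sub>R u)) \<partial>lborel) - f t - h^4 * \<beta>\<bar> \<le> \<epsilon> * h^4 * measure lborel U"
      if h: "0 < h" "h < d0" and Dh: "\<And>u. u \<in> U \<Longrightarrow> \<bar>D (h, u)\<bar> \<le> \<epsilon> * h^4" for h \<epsilon>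
    proof -
      define Q where "Q v = K v * (1 / e0^2 - (e1 v / e0^2) * h + e3 v * h^3 + taylor_form 4 g t v * h^4)" for v
      have cQ: "continuous_on UNIV Q"
        unfolding Q_def[abs_def] by (intro continuous_intros contK c1 c3 continuous_on_taylor_form) (use e0 in auto)
      have suppK: "K u = 0" if "sqrt S \<le> norm u" for u
      proof -
        have "(sqrt S)\<^sup>2 \<le> (norm u)\<^sup>2" using that S by (intro power_mono) auto
        then show ?thesis using S by (simp add: K)
      qed
      have \<rho>h: "\<rho> (h, u) < 2 * e0" "0 < \<rho> (h, u)" if "u \<in> U" for u
        using d0(2)[OF h that] by auto
      have \<rho>ne: "norm u \<le> R \<Longrightarrow> \<rho> (h, u) \<noteq> 0" for u
        using \<rho>h(2)[of u] by (simp add: U_def)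
      have c\<rho>: "continuous_on U (\<lambda>u. \<rho> (h, u))"
        unfolding \<rho>_def prod.case by (intro continuous_intros c1 c2 c3 c4)
      have cA: "continuous_on U (\<lambda>u. A (h, u))"
        unfolding A_def prod.case by (intro continuous_intros c1 c2 c3 c4)
      \<comment> \<open>Radial substitution with \<open>1 / \<rho>\<close> for
        \<open>\<kappa>\<close>; then \<open>J\<close> is the derivative of
        \<open>l / \<rho> (h, l *\<^sub>R z)\<close> in \<open>l\<close>, which is
        \<open>A / \<rho>^2\<close>.\<close>
      have "(\<integral>u. indicator (cball 0 R) u * (Q ((1 / \<rho> (h, u)) *\<^sub>R u) * (1 / \<rho> (h, u)) ^ (DIM(real^'n) - 1) * (A (h, u) / (\<rho> (h, u))\<^sup>2)) \<partial>lborel) = (\<integral>u. Q u \<partial>lborel)"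
      proof (rule integral_radial_substitution[OF cQ _ R'(2)])
        show "Q u = 0" if "sqrt S \<le> norm u" for u using suppK[OF that] by (simp add: Q_def)
        show "continuous_on (cball 0 R) (\<lambda>u. 1 / \<rho> (h, u))"
          using c\<rho> by (intro continuous_intros) (use \<rho>ne in \<open>auto simp: U_def\<close>)
        show "continuous_on (cball 0 R) (\<lambda>u. A (h, u) / (\<rho> (h, u))\<^sup>2)"
          using c\<rho> cA by (intro continuous_intros) (use \<rho>ne in \<open>auto simp: U_def\<close>)
        show "0 \<le> 1 / \<rho> (h, u)" if "norm u \<le> R" for u
          using \<rho>h(2)[of u] that by (simp add: U_def)
        show "sqrt S \<le> 1 / \<rho> (h, u) * R" if "norm u = R" for u
        proof -
          have u: "u \<in> U" using that by (simp add: U_def)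
          have "sqrt S * \<rho> (h, u) \<le> sqrt S * (2 * e0)"
            using \<rho>h[OF u] S by (intro mult_left_mono) auto
          also have "\<dots> \<le> R" using R' by (simp add: mult_ac)
          finally show ?thesis using \<rho>h(2)[OF u] by (simp add: field_simps)
        qed
        fix l and z :: "real^'n" assume l: "0 \<le> l" "norm (l *\<^sub>R z) \<le> R"
        have \<rho>l: "\<rho> (h, x *\<^sub>R z) = e0 + e1 z * (h * x) + e2 z * (h * x)^2 + e3 z * (h * x)^3 + e4 z * (h * x)^4" for x
          by (simp add: \<rho>_def hom power_mult_distrib mult_ac)
        have Al: "A (h, x *\<^sub>R z) = e0 - e2 z * (h * x)^2 - 2 * e3 z * (h * x)^3 - 3 * e4 z * (h * x)^4" for x
          by (simp add: A_def hom power_mult_distrib mult_ac)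
        have pos: "\<rho> (h, l *\<^sub>R z) \<noteq> 0" using \<rho>h(2)[of "l *\<^sub>R z"] l by (auto simp: U_def)
        have "((\<lambda>l. l / (e0 + e1 z * (h * l) + e2 z * (h * l)^2 + e3 z * (h * l)^3 + e4 z * (h * l)^4)) has_real_derivative
           (e0 - e2 z * (h * l)^2 - 2 * e3 z * (h * l)^3 - 3 * e4 z * (h * l)^4) / (e0 + e1 z * (h * l) + e2 z * (h * l)^2 + e3 z * (h * l)^3 + e4 z * (h * l)^4)\<^sup>2) (at l)"
          using pos unfolding \<rho>l
          by (auto intro!: derivative_eq_intros) (simp add: power2_eq_square, simp add: algebra_simps eval_nat_numeral)
        then show "((\<lambda>l. l * (1 / \<rho> (h, l *\<^sub>R z))) has_real_derivative A (h, l *\<^sub>R z) / (\<rho> (h, l *\<^sub>R z))\<^sup>2) (at l)"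
          by (simp add: \<rho>l Al)
      qed
      also have "(\<integral>u. Q u \<partial>lborel) = 1 / e0^2 + h^4 * \<beta>"
        unfolding Q_def \<beta>_def
      proof (rule integral_kernel_taylor[where s="sqrt S" and ?e1.0="\<lambda>v. e1 v / e0^2" and ?e3.0=e3])
        show "e1 (- u) / e0\<^sup>2 = - (e1 u / e0\<^sup>2)" "e3 (- u) = - e3 u" for u
          using hom[of "-1" u] by simp_all
        show "continuous_on UNIV (\<lambda>v. e1 v / e0\<^sup>2)" using e0 by (intro continuous_intros c1) auto
        show "K (- u) = K u" for u by (simp add: K)
      qed (use suppK contK c3 K1 g S' in auto)
      also have "1 / e0^2 = f t" using e0 by simp
      also have "(\<lambda>u. indicator (cball 0 R) u * (Q ((1 / \<rho> (h, u)) *\<^sub>R u) * (1 / \<rho> (h, u)) ^ (DIM(real^'n) - 1) * (A (h, u) / (\<rho> (h, u))\<^sup>2)))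
        = (\<lambda>u. indicator U u * (\<Phi> ((1 / \<rho> (h, u))\<^sup>2 * m u) * (1 / \<rho> (h, u)) ^ (CARD('n) + 1) * (A (h, u) * G u (h / \<rho> (h, u)))))"
      proof (rule ext)
        fix u
        have "K ((1 / \<rho> (h, u)) *\<^sub>R u) = \<Phi> ((1 / \<rho> (h, u))\<^sup>2 * m u)"
          by (simp add: K m_def power_mult_distrib power_divide)
        moreover have "1 / e0\<^sup>2 - e1 ((1 / \<rho> (h, u)) *\<^sub>R u) / e0\<^sup>2 * h + e3 ((1 / \<rho> (h, u)) *\<^sub>R u) * h ^ 3 +
            taylor_form 4 g t ((1 / \<rho> (h, u)) *\<^sub>R u) * h ^ 4 = G u (h / \<rho> (h, u))"
          unfolding hom taylor_form_scaleR G_def e_eq by (simp add: power_divide)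
        ultimately have Qu: "Q ((1 / \<rho> (h, u)) *\<^sub>R u) = \<Phi> ((1 / \<rho> (h, u))\<^sup>2 * m u) * G u (h / \<rho> (h, u))"
          by (simp add: Q_def)
        \<comment> \<open>The last two powers are the \<open>1 / \<rho>^2\<close> contained in
          \<open>J\<close>.\<close>
        have "CARD('n) + 1 = (DIM(real^'n) - 1) + 2" using zero_less_card_finite[where 'a='n] by simp
        then have pw: "(1 / \<rho> (h, u)) ^ (CARD('n) + 1) = (1 / \<rho> (h, u)) ^ (DIM(real^'n) - 1) * (1 / (\<rho> (h, u))\<^sup>2)"
          by (simp only: power_add) (simp add: power_divide)
        show "indicator (cball 0 R) u * (Q ((1 / \<rho> (h, u)) *\<^sub>R u) * (1 / \<rho> (h, u)) ^ (DIM(real^'n) - 1) * (A (h, u) / (\<rho> (h, u))\<^sup>2))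
          = indicator U u * (\<Phi> ((1 / \<rho> (h, u))\<^sup>2 * m u) * (1 / \<rho> (h, u)) ^ (CARD('n) + 1) * (A (h, u) * G u (h / \<rho> (h, u))))"
          unfolding Qu pw U_def by simp
      qed
      finally have I2: "(\<integral>u. indicator U u * (\<Phi> ((1 / \<rho> (h, u))\<^sup>2 * m u) * (1 / \<rho> (h, u)) ^ (CARD('n) + 1) * (A (h, u) * G u (h / \<rho> (h, u)))) \<partial>lborel)
        = f t + h^4 * \<beta>" .
      have c\<Phi>: "continuous_on U (\<lambda>u. \<Phi> ((1 / \<rho> (h, u))\<^sup>2 * m u))"
      proof -
        have "continuous_on U (\<lambda>u. K ((1 / \<rho> (h, u)) *\<^sub>R u))"
          by (intro continuous_on_compose2[OF contK[of UNIV]] continuous_intros c\<rho>) (use \<rho>ne in \<open>auto simp: U_def\<close>)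
        then show ?thesis by (simp add: K m_def power_mult_distrib power_divide)
      qed
      have i1: "integrable lborel (\<lambda>u. indicator U u * (q (h, u) ^ (CARD('n) + 2) * K (q (h, u) *\<^sub>R u)))"
        unfolding q_def fst_conv snd_conv real_scaleR_def[symmetric]
        by (intro borel_integrable_compact U continuous_intros continuous_on_compose2[OF contK[of UNIV]] continuous_on_compose2[OF contf[of UNIV]]) auto
      have i2: "integrable lborel (\<lambda>u. indicator U u * (\<Phi> ((1 / \<rho> (h, u))\<^sup>2 * m u) * (1 / \<rho> (h, u)) ^ (CARD('n) + 1) * (A (h, u) * G u (h / \<rho> (h, u)))))"
      proof -
        have "integrable lborel (\<lambda>u. indicator U u *\<^sub>R (\<Phi> ((1 / \<rho> (h, u))\<^sup>2 * m u) * (1 / \<rho> (h, u)) ^ (CARD('n) + 1) * (A (h, u) * G u (h / \<rho> (h, u)))))"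
          unfolding G_def
          by (intro borel_integrable_compact U continuous_intros c\<Phi> c\<rho> cA c1 c2 c3 c4) (use \<rho>ne e0 in \<open>auto simp: U_def\<close>)
        then show ?thesis by simp
      qed
      have "(\<integral>u. indicator U u * (q (h, u) ^ (CARD('n) + 2) * K (q (h, u) *\<^sub>R u)) \<partial>lborel) - (f t + h^4 * \<beta>)
        = (\<integral>u. indicator U u * D (h, u) \<partial>lborel)"
        unfolding I2[symmetric]
        by (subst Bochner_Integration.integral_diff[OF i1 i2, symmetric])
           (simp add: D_def right_diff_distrib K m_def power_mult_distrib)
      also have "\<bar>\<dots>\<bar> \<le> (\<integral>u. indicator U u * (\<epsilon> * h^4) \<partial>lborel)"
      proof (rule integral_abs_bound_integral)
        have "integrable lborel (\<lambda>u. indicator U u *\<^sub>R (\<epsilon> * h^4))"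
          by (intro borel_integrable_compact U continuous_intros)
        then show "integrable lborel (\<lambda>u. indicator U u * (\<epsilon> * h^4))" by simp
        have "integrable lborel (\<lambda>u. indicator U u * (q (h, u) ^ (CARD('n) + 2) * K (q (h, u) *\<^sub>R u)) - indicator U u * (\<Phi> ((1 / \<rho> (h, u))\<^sup>2 * m u) * (1 / \<rho> (h, u)) ^ (CARD('n) + 1) * (A (h, u) * G u (h / \<rho> (h, u)))))"
          using i1 i2 by simp
        then show "integrable lborel (\<lambda>u. indicator U u * D (h, u))"
          by (simp add: D_def right_diff_distrib K m_def power_mult_distrib)
        show "\<bar>indicator U u * D (h, u)\<bar> \<le> indicator U u * (\<epsilon> * h^4)" for u
          using Dh[of u] by (auto simp: indicator_def)
      qed
      also have "\<dots> = \<epsilon> * h^4 * measure lborel U" by simp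
      finally show ?thesis by (simp add: algebra_simps)
    qed
    define V where "V = measure lborel U"
    have V: "0 \<le> V" by (simp add: V_def)
    show ?thesis
    proof (rule tendstoI)
      fix \<epsilon> :: real assume \<epsilon>: "0 < \<epsilon>"
      define \<epsilon>' where "\<epsilon>' = \<epsilon> / (V + 1)"
      have \<epsilon>': "0 < \<epsilon>'" "\<epsilon>' * V < \<epsilon>" using \<epsilon> V by (auto simp: \<epsilon>'_def field_simps)
      have "\<forall>\<^sub>F p in F. norm (D p) \<le> \<epsilon>' * norm (fst p ^ 4)"
        by (rule landau_o.smallD[OF D \<epsilon>'(1)])
      then obtain d1 where d1: "0 < d1" "\<And>h u. 0 < h \<Longrightarrow> h < d1 \<Longrightarrow> u \<in> U \<Longrightarrow> \<bar>D (h, u)\<bar> \<le> \<epsilon>' * h^4"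
        unfolding F_def eventually_at_right_prod_principal by auto
      have "\<forall>\<^sub>F h in at_right 0. 0 < h \<and> h < min d0 d1"
        unfolding eventually_at_right_field using d0(1) d1(1) by (intro exI[of _ "min d0 d1"]) auto
      then show "\<forall>\<^sub>F h in at_right 0. dist (((\<integral>u. indicator (cball 0 R) u *
         (sqrt (f (t + h *\<^sub>R u)) ^ (CARD('n) + 2) * K (sqrt (f (t + h *\<^sub>R u)) *\<^sub>R u)) \<partial>lborel) - f t) / h ^ 4) \<beta> < \<epsilon>"
      proof eventually_elim
        case (elim h)
        define I where "I = (\<integral>u. indicator U u * (q (h, u) ^ (CARD('n) + 2) * K (q (h, u) *\<^sub>R u)) \<partial>lborel)"
        have "\<bar>I - f t - h^4 * \<beta>\<bar> \<le> \<epsilon>' * h^4 * V"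
          unfolding I_def V_def by (rule main) (use elim d1 in auto)
        then have "\<bar>I - f t - h^4 * \<beta>\<bar> / h^4 \<le> \<epsilon>' * V"
          using elim by (simp add: field_simps)
        moreover have "(I - f t) / h^4 - \<beta> = (I - f t - h^4 * \<beta>) / h^4"
          using elim by (simp add: field_simps)
        ultimately have "\<bar>(I - f t) / h^4 - \<beta>\<bar> < \<epsilon>"
          using \<epsilon>'(2) elim by (simp add: abs_divide)
        then show ?case by (simp add: I_def U_def q_def dist_real_def)
      qed
    qed
  qed
  then show ?thesis unfolding \<beta>_def g_def by blast
qed

section \<open>Limit theorem for triangular arrays\<close>

lemma real_distribution_normal_law:
  assumes "0 \<le> v"
  shows "real_distribution (normal_law m v)"
proof (cases "v = 0")
  case True
  then show ?thesis
    using prob_space_return[of m borel] by (auto simp: normal_law_def real_distribution_def real_distribution_axioms_def)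
next
  case False
  with assms have "0 < sqrt v" by simp
  then show ?thesis
    using False prob_space_normal_density[of "sqrt v" m]
    by (auto simp: normal_law_def real_distribution_def real_distribution_axioms_def)
qed

text \<open>Transported from the standard normal law by an affine map. The point mass at variance 0
  obeys the same formula, so the limit theorem includes degenerate limits without a case
  distinction.\<close>

lemma char_normal_law:
  assumes "0 \<le> v"
  shows "char (normal_law m v) t = iexp (t * m) * complex_of_real (exp (- (t\<^sup>2 * v / 2)))"
proof (cases "v = 0")
  case True
  then show ?thesis by (simp add: normal_law_def char_def integral_return)
next
  case False
  define s where "s = sqrt v"
  have s: "0 < s" "s\<^sup>2 = v" using False assms by (auto simp: s_def)
  interpret N: prob_space std_normal_distribution using real_dist_normal_dist by (simp add: real_distribution_def)
  have id: "distributed std_normal_distribution lborel (\<lambda>x. x) std_normal_density"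
    by (auto simp: distributed_def intro!: distr_id2)
  have "distributed std_normal_distribution lborel (\<lambda>x. m + s * x) (normal_density (m + s * 0) (\<bar>s\<bar> * 1))"
    by (rule N.normal_density_affine[OF id]) (use s in auto)
  then have d: "distr std_normal_distribution lborel (\<lambda>x. m + s * x) = normal_law m v"
    using s False by (simp add: distributed_def normal_law_def s_def)
  have "char (normal_law m v) t = (CLINT x|std_normal_distribution. iexp (t * (m + s * x)))"
    unfolding char_def d[symmetric] by (subst integral_distr) auto
  also have "\<dots> = (CLINT x|std_normal_distribution. iexp (t * m) * iexp ((t * s) * x))"
    by (intro Bochner_Integration.integral_cong) (auto simp: algebra_simps exp_add[symmetric])
  also have "\<dots> = iexp (t * m) * char std_normal_distribution (t * s)"
    by (simp add: char_def)
  also have "\<dots> = iexp (t * m) * complex_of_real (exp (- (t\<^sup>2 * v / 2)))"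
    by (simp add: char_std_normal_distribution power_mult_distrib s)
  finally show ?thesis .
qed

text \<open>The uniform bound \<open>\<epsilon> n\<close> stands in for the Lindeberg condition: the
  third-order error of a characteristic function is at most a constant times
  \<open>\<epsilon> n * v n\<close>, and \<open>n\<close> such errors vanish because
  \<open>n * v n\<close> converges. The product is compared with \<open>(1 + x / n) ^ n\<close>, and
  the shift \<open>b n\<close> contributes only a phase.\<close>

lemma (in prob_space) triangular_array_clt:
  fixes Y :: "nat \<Rightarrow> nat \<Rightarrow> 'a \<Rightarrow> real"
  assumes indep: "\<And>n. indep_vars (\<lambda>_. borel) (Y n) UNIV"
    and mean: "\<And>n i. expectation (Y n i) = 0"
    and bound: "\<And>n i \<omega>. \<bar>Y n i \<omega>\<bar> \<le> \<epsilon> n"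
    and eps: "\<epsilon> \<longlonglongrightarrow> 0"
    and var: "\<And>n i. expectation (\<lambda>\<omega>. (Y n i \<omega>)\<^sup>2) = v n"
    and lim: "(\<lambda>n. real n * v n) \<longlonglongrightarrow> w"
    and b: "b \<longlonglongrightarrow> m"
  shows "weak_conv_m (\<lambda>n. distr M borel (\<lambda>\<omega>. (\<Sum>i<n. Y n i \<omega>) + b n)) (normal_law m w)"
proof -
  have rv[measurable]: "random_variable borel (Y n i)" for n i
    using indep[of n] unfolding indep_vars_def2 by simp
  have eps0: "0 \<le> \<epsilon> n" for n
    \<comment> \<open>The bound holds at every point, so an arbitrary one will do.\<close>
    using bound[of n 0 undefined] by linarith
  have int: "integrable M (Y n i)" for n i
    by (rule integrable_const_bound[where B="\<epsilon> n"]) (use bound in auto)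
  have sq: "(Y n i \<omega>)\<^sup>2 \<le> (\<epsilon> n)\<^sup>2" for n i \<omega>
    using bound[of n i \<omega>] by (metis abs_ge_zero power2_abs power_mono)
  have int2: "integrable M (\<lambda>\<omega>. (Y n i \<omega>)\<^sup>2)" for n i
    by (rule integrable_const_bound[where B="(\<epsilon> n)\<^sup>2"]) (use sq in auto)
  have v0: "0 \<le> v n" for n
    unfolding var[of n 0, symmetric] by simp
  have w0: "0 \<le> w"
    by (rule LIMSEQ_le_const[OF lim]) (use v0 in auto)
  show ?thesis
  proof (rule levy_continuity)
    show "real_distribution (distr M borel (\<lambda>\<omega>. (\<Sum>i<n. Y n i \<omega>) + b n))" for n
      by (rule real_distribution_distr) simp
    show "real_distribution (normal_law m w)"
      by (rule real_distribution_normal_law[OF w0])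
    fix t :: real
    define \<phi> where "\<phi> n i = char (distr M borel (Y n i)) t" for n i
    have fac: "char (distr M borel (\<lambda>\<omega>. (\<Sum>i<n. Y n i \<omega>) + b n)) t = iexp (t * b n) * (\<Prod>i<n. \<phi> n i)" for n
    proof -
      have "char (distr M borel (\<lambda>\<omega>. (\<Sum>i<n. Y n i \<omega>) + b n)) t
          = (CLINT \<omega>|M. iexp (t * b n) * iexp (t * (\<Sum>i<n. Y n i \<omega>)))"
        unfolding char_def by (subst integral_distr)
          (auto simp: algebra_simps exp_add[symmetric] intro!: Bochner_Integration.integral_cong)
      also have "\<dots> = iexp (t * b n) * char (distr M borel (\<lambda>\<omega>. \<Sum>i<n. Y n i \<omega>)) t"
        unfolding char_def by (subst integral_distr) auto
      also have "char (distr M borel (\<lambda>\<omega>. \<Sum>i<n. Y n i \<omega>)) t = (\<Prod>i<n. \<phi> n i)"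
        unfolding \<phi>_def by (rule char_distr_sum) (rule indep_vars_subset[OF indep], simp)
      finally show ?thesis .
    qed
    define x where "x = - (t\<^sup>2 * w / 2)"
    have x0: "x \<le> 0" using w0 by (simp add: x_def)
    have approx: "norm (\<phi> n i - (1 + of_real x / of_nat n)) \<le> \<bar>t\<bar>^3 / 6 * \<epsilon> n * v n + t\<^sup>2 / 2 * \<bar>v n - w / n\<bar>" for n i
    proof -
      have "norm (\<phi> n i - (1 - of_real (t\<^sup>2 * v n / 2))) \<le> (t\<^sup>2 / 6) * expectation (\<lambda>\<omega>. min (6 * (Y n i \<omega>)\<^sup>2) (\<bar>t\<bar> * \<bar>Y n i \<omega>\<bar>^3))"
        unfolding \<phi>_def using char_approx3'[OF rv int int2 mean _ refl, of n i "v n" t] mean var by simp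
      also have "\<dots> \<le> (t\<^sup>2 / 6) * expectation (\<lambda>\<omega>. (\<bar>t\<bar> * \<epsilon> n) * (Y n i \<omega>)\<^sup>2)"
      proof (intro mult_left_mono integral_mono)
        show "integrable M (\<lambda>\<omega>. min (6 * (Y n i \<omega>)\<^sup>2) (\<bar>t\<bar> * \<bar>Y n i \<omega>\<bar>^3))"
        proof (rule integrable_const_bound[where B="6 * (\<epsilon> n)\<^sup>2"])
          have "norm (min (6 * (Y n i \<omega>)\<^sup>2) (\<bar>t\<bar> * \<bar>Y n i \<omega>\<bar>^3)) \<le> 6 * (\<epsilon> n)\<^sup>2" for \<omega>
          proof -
            have "0 \<le> \<bar>t\<bar> * \<bar>Y n i \<omega>\<bar>^3" "0 \<le> 6 * (Y n i \<omega>)\<^sup>2" by simp_all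
            then show ?thesis unfolding real_norm_def using sq[of n i \<omega>] by linarith
          qed
          then show "AE \<omega> in M. norm (min (6 * (Y n i \<omega>)\<^sup>2) (\<bar>t\<bar> * \<bar>Y n i \<omega>\<bar>^3)) \<le> 6 * (\<epsilon> n)\<^sup>2"
            by simp
        qed simp
        show "min (6 * (Y n i \<omega>)\<^sup>2) (\<bar>t\<bar> * \<bar>Y n i \<omega>\<bar>^3) \<le> (\<bar>t\<bar> * \<epsilon> n) * (Y n i \<omega>)\<^sup>2" for \<omega>
        proof -
          have "\<bar>t\<bar> * \<bar>Y n i \<omega>\<bar>^3 = (\<bar>t\<bar> * \<bar>Y n i \<omega>\<bar>) * (Y n i \<omega>)\<^sup>2"
            by (simp add: power3_eq_cube power2_eq_square)
          also have "\<dots> \<le> (\<bar>t\<bar> * \<epsilon> n) * (Y n i \<omega>)\<^sup>2"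
            using bound by (intro mult_right_mono mult_left_mono) auto
          finally show ?thesis by linarith
        qed
      qed (use int2 in auto)
      also have "\<dots> = \<bar>t\<bar>^3 / 6 * \<epsilon> n * v n"
        by (subst Bochner_Integration.integral_mult_right_zero, subst var) (simp add: power3_eq_cube power2_eq_square)
      finally have 1: "norm (\<phi> n i - (1 - of_real (t\<^sup>2 * v n / 2))) \<le> \<bar>t\<bar>^3 / 6 * \<epsilon> n * v n" .
      have "(1 - of_real (t\<^sup>2 * v n / 2)) - (1 + of_real x / of_nat n) = complex_of_real (- (t\<^sup>2 / 2 * (v n - w / n)))"
        by (simp add: x_def field_simps)
      then have 2: "norm ((1 - of_real (t\<^sup>2 * v n / 2)) - (1 + of_real x / complex_of_nat n)) = t\<^sup>2 / 2 * \<bar>v n - w / n\<bar>"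
        by (simp only: norm_of_real) (simp add: abs_mult)
      show ?thesis
        using norm_triangle_le[of "\<phi> n i - (1 - of_real (t\<^sup>2 * v n / 2))" "(1 - of_real (t\<^sup>2 * v n / 2)) - (1 + of_real x / of_nat n)"] 1 2
        by (simp add: algebra_simps)
    qed
    have "(\<lambda>n. (\<Prod>i<n. \<phi> n i) - (1 + of_real x / of_nat n) ^ n) \<longlonglongrightarrow> 0"
    proof (rule Lim_null_comparison)
      show "\<forall>\<^sub>F n in sequentially. norm ((\<Prod>i<n. \<phi> n i) - (1 + of_real x / of_nat n) ^ n)
          \<le> \<bar>t\<bar>^3 / 6 * \<epsilon> n * (real n * v n) + t\<^sup>2 / 2 * \<bar>real n * v n - w\<bar>"
      proof (rule eventually_sequentiallyI)
        \<comment> \<open>From here on \<open>1 + x / n\<close> lies between 0 and 1; comparing the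
          products needs factors of norm at most 1.\<close>
        fix n assume n: "n \<ge> max 1 (nat \<lceil>-x\<rceil>)"
        then have n': "0 < real n" "- x \<le> real n" by linarith+
        then have "norm (1 + of_real x / complex_of_nat n) \<le> 1"
        proof -
          have "1 + of_real x / complex_of_nat n = of_real (1 + x / n)" by simp
          moreover have "\<bar>1 + x / real n\<bar> \<le> 1" using n' x0 by (auto simp: abs_le_iff field_simps)
          ultimately show ?thesis by (simp only: norm_of_real)
        qed
        moreover have "norm (\<phi> n i) \<le> 1" for i
          unfolding \<phi>_def by (intro real_distribution.cmod_char_le_1 real_distribution_distr rv)
        ultimately have "norm ((\<Prod>i<n. \<phi> n i) - (\<Prod>i<n. 1 + of_real x / of_nat n))
            \<le> (\<Sum>i<n. norm (\<phi> n i - (1 + of_real x / of_nat n)))"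
          by (intro norm_prod_diff) auto
        also have "\<dots> \<le> (\<Sum>i<n. \<bar>t\<bar>^3 / 6 * \<epsilon> n * v n + t\<^sup>2 / 2 * \<bar>v n - w / n\<bar>)"
          by (intro sum_mono approx)
        also have "\<dots> = \<bar>t\<bar>^3 / 6 * \<epsilon> n * (real n * v n) + t\<^sup>2 / 2 * (real n * \<bar>v n - w / n\<bar>)"
          by (simp add: algebra_simps)
        also have "real n * \<bar>v n - w / n\<bar> = \<bar>real n * (v n - w / n)\<bar>"
          by (simp only: abs_mult abs_of_nat)
        also have "real n * (v n - w / n) = real n * v n - w"
          using n' by (simp add: field_simps)
        finally show "norm ((\<Prod>i<n. \<phi> n i) - (1 + of_real x / of_nat n) ^ n)
          \<le> \<bar>t\<bar>^3 / 6 * \<epsilon> n * (real n * v n) + t\<^sup>2 / 2 * \<bar>real n * v n - w\<bar>" by simp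
      qed
      have "(\<lambda>n. \<bar>t\<bar>^3 / 6 * \<epsilon> n * (real n * v n) + t\<^sup>2 / 2 * \<bar>real n * v n - w\<bar>) \<longlonglongrightarrow> \<bar>t\<bar>^3 / 6 * 0 * w + t\<^sup>2 / 2 * \<bar>w - w\<bar>"
        by (intro tendsto_intros eps lim)
      then show "(\<lambda>n. \<bar>t\<bar>^3 / 6 * \<epsilon> n * (real n * v n) + t\<^sup>2 / 2 * \<bar>real n * v n - w\<bar>) \<longlonglongrightarrow> 0" by simp
    qed
    moreover have "(\<lambda>n. complex_of_real ((1 + x / n) ^ n)) \<longlonglongrightarrow> complex_of_real (exp x)"
      by (rule isCont_tendsto_compose[OF _ tendsto_exp_limit_sequentially]) auto
    then have "(\<lambda>n. (1 + of_real x / of_nat n) ^ n) \<longlonglongrightarrow> complex_of_real (exp x)" by simp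
    ultimately have "(\<lambda>n. \<Prod>i<n. \<phi> n i) \<longlonglongrightarrow> complex_of_real (exp x)"
      by (rule Lim_transform[rotated])
    moreover have "(\<lambda>n. iexp (t * b n)) \<longlonglongrightarrow> iexp (t * m)"
      by (intro tendsto_intros b)
    ultimately have "(\<lambda>n. iexp (t * b n) * (\<Prod>i<n. \<phi> n i)) \<longlonglongrightarrow> iexp (t * m) * complex_of_real (exp x)"
      by (rule tendsto_mult[rotated])
    then show "(\<lambda>n. char (distr M borel (\<lambda>\<omega>. (\<Sum>i<n. Y n i \<omega>) + b n)) t) \<longlonglongrightarrow> char (normal_law m w) t"
      by (simp add: fac char_normal_law[OF w0] x_def)
  qed
qed

section \<open>The ideal estimator\<close>

text \<open>Collects the continuity and the bounds behind the moment limits. The upper bound on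
  \<open>\<alpha>\<close> is imposed only at values of \<open>f\<close>, since a clipped square root
  is unbounded; the lower bound \<open>c\<close> confines all rescaled kernels to one ball of radius
  \<open>s / c\<close>.\<close>

locale ideal_kernel_smoothing =
  fixes f K :: "real^'n::finite \<Rightarrow> real" and \<alpha> :: "real \<Rightarrow> real" and c s A B C :: real and t :: "real^'n"
  assumes f_cont: "continuous_on UNIV f" and f_nonneg: "0 \<le> f x" and f_le: "f x \<le> C"
    and \<alpha>_cont: "continuous_on UNIV \<alpha>" and c_pos: "0 < c" and \<alpha>_ge: "c \<le> \<alpha> y" and \<alpha>_le: "\<alpha> (f x) \<le> A"
    and K_cont: "continuous_on UNIV K" and K_supp: "s \<le> norm u \<Longrightarrow> K u = 0"
    and K_le: "\<bar>K u\<bar> \<le> B" and K_even: "K (- u) = K u"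
begin

text \<open>The \<open>k\<close>-th moment of a summand of the estimator, divided by \<open>h\<^sup>d\<close>, after the substitution
  \<open>x = t + h u\<close>; \<open>smoothed 1 h\<close> is the expectation of the estimator.\<close>

definition smoothed :: "nat \<Rightarrow> real \<Rightarrow> real" where
  "smoothed k h = (\<integral>u. f (t + h *\<^sub>R u) * (\<alpha> (f (t + h *\<^sub>R u)) ^ CARD('n) * K (\<alpha> (f (t + h *\<^sub>R u)) *\<^sub>R u)) ^ k \<partial>lborel)"

lemma \<alpha>_pos: "0 < \<alpha> y"
  using \<alpha>_ge[of y] c_pos by linarith

lemma K_scaled_eq_0:
  assumes "s / c \<le> norm u"
  shows "K (\<alpha> y *\<^sub>R u) = 0"
proof (rule K_supp)
  have "s \<le> c * norm u" using assms c_pos by (simp add: field_simps)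
  also have "\<dots> \<le> \<alpha> y * norm u" using \<alpha>_ge by (intro mult_right_mono) auto
  finally show "s \<le> norm (\<alpha> y *\<^sub>R u)" using \<alpha>_pos[of y] by simp
qed

lemma summand_bound: "\<bar>\<alpha> (f x) ^ CARD('n) * K u\<bar> \<le> A ^ CARD('n) * B"
  unfolding abs_mult using \<alpha>_pos[of "f x"] \<alpha>_le[of x] K_le[of u]
  by (intro mult_mono) (auto simp: power_abs intro!: power_mono)

lemma integrand_continuous:
  "continuous_on UNIV (\<lambda>u. f (t + h *\<^sub>R u) * (\<alpha> (f (t + h *\<^sub>R u)) ^ CARD('n) * K (\<alpha> (f (t + h *\<^sub>R u)) *\<^sub>R u)) ^ k)"
  by (intro continuous_intros continuous_on_compose2[OF f_cont] continuous_on_compose2[OF \<alpha>_cont]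
      continuous_on_compose2[OF K_cont]) auto

lemma summand_continuous:
  "continuous_on UNIV (\<lambda>y. \<alpha> (f y) ^ CARD('n) * K ((inverse h * \<alpha> (f y)) *\<^sub>R (t - y)))"
  by (intro continuous_intros f_cont continuous_on_compose2[OF \<alpha>_cont f_cont] continuous_on_compose2[OF K_cont]) auto

text \<open>Evenness of \<open>K\<close> absorbs the sign of \<open>t - y = - h u\<close>, and for
  positive \<open>k\<close> the kernel gives the integrand compact support.\<close>

lemma integral_summand:
  assumes h: "0 < h" and k: "0 < k"
  shows "(\<integral>y. f y * (\<alpha> (f y) ^ CARD('n) * K ((inverse h * \<alpha> (f y)) *\<^sub>R (t - y))) ^ k \<partial>lborel) = h ^ CARD('n) * smoothed k h"
proof -
  let ?F = "\<lambda>y. f y * (\<alpha> (f y) ^ CARD('n) * K ((inverse h * \<alpha> (f y)) *\<^sub>R (t - y))) ^ k"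
  have "integrable lborel ?F"
  proof (rule continuous_compact_support_integrable)
    show "continuous_on UNIV ?F"
      by (intro continuous_on_mult f_cont continuous_on_power summand_continuous)
    fix y :: "real^'n" assume "norm t + h * (s / c) \<le> norm y"
    then have "h * (s / c) \<le> norm (t - y)"
      using norm_triangle_sub[of y t] by (simp add: norm_minus_commute)
    then have "s / c \<le> norm (inverse h *\<^sub>R (t - y))"
      unfolding norm_scaleR using h by (simp add: field_simps)
    from K_scaled_eq_0[OF this, of "f y"] show "?F y = 0"
      using k by (simp add: mult.commute zero_power)
  qed
  from integral_lborel_affine[OF _ this, of h t] h
  have "(\<integral>y. ?F y \<partial>lborel) = h ^ CARD('n) * (\<integral>u. ?F (t + h *\<^sub>R u) \<partial>lborel)" by simp
  also have "(\<integral>u. ?F (t + h *\<^sub>R u) \<partial>lborel) = smoothed k h"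
    unfolding smoothed_def
  proof (rule Bochner_Integration.integral_cong[OF refl])
    fix u
    have "(inverse h * \<alpha> (f (t + h *\<^sub>R u))) *\<^sub>R (t - (t + h *\<^sub>R u)) = - (\<alpha> (f (t + h *\<^sub>R u)) *\<^sub>R u)"
      using h by simp
    then show "?F (t + h *\<^sub>R u) = f (t + h *\<^sub>R u) * (\<alpha> (f (t + h *\<^sub>R u)) ^ CARD('n) * K (\<alpha> (f (t + h *\<^sub>R u)) *\<^sub>R u)) ^ k"
      by (simp only: K_even)
  qed
  finally show ?thesis .
qed

text \<open>Dominated convergence on the common ball of radius \<open>s / c\<close>. In the limit
  the power \<open>CARD('n) * k\<close> of \<open>\<alpha> (f t)\<close> comes from the prefactor,
  and the division from rescaling the argument of \<open>K\<close>.\<close>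

lemma smoothed_tendsto:
  assumes h: "h \<longlonglongrightarrow> 0" and k: "0 < k"
  shows "(\<lambda>n. smoothed k (h n)) \<longlonglongrightarrow> f t * \<alpha> (f t) ^ (CARD('n) * k) / \<alpha> (f t) ^ CARD('n) * (\<integral>u. K u ^ k \<partial>lborel)"
proof -
  let ?I = "\<lambda>h u. f (t + h *\<^sub>R u) * (\<alpha> (f (t + h *\<^sub>R u)) ^ CARD('n) * K (\<alpha> (f (t + h *\<^sub>R u)) *\<^sub>R u)) ^ k"
  define a where "a = \<alpha> (f t)"
  have a: "0 < a" unfolding a_def by (rule \<alpha>_pos)
  have meas: "?I r \<in> borel_measurable lborel" for r
    using integrand_continuous[of r k] by (simp add: borel_measurable_continuous_onI)
  have "(\<lambda>n. smoothed k (h n)) \<longlonglongrightarrow> (\<integral>u. ?I 0 u \<partial>lborel)"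
    unfolding smoothed_def
  proof (rule integral_dominated_convergence[where w="\<lambda>u. indicator (cball 0 (s / c)) u * (C * (A ^ CARD('n) * B) ^ k)"])
    have "integrable lborel (\<lambda>u::real^'n. indicator (cball 0 (s / c)) u *\<^sub>R (C * (A ^ CARD('n) * B) ^ k))"
      by (intro borel_integrable_compact continuous_intros) auto
    then show "integrable lborel (\<lambda>u::real^'n. indicator (cball 0 (s / c)) u * (C * (A ^ CARD('n) * B) ^ k))" by simp
    show "AE u in lborel. (\<lambda>n. ?I (h n) u) \<longlonglongrightarrow> ?I 0 u"
    proof (rule AE_I2)
      fix u
      have "continuous_on UNIV (\<lambda>r. ?I r u)"
        by (intro continuous_intros continuous_on_compose2[OF f_cont] continuous_on_compose2[OF \<alpha>_cont]
            continuous_on_compose2[OF K_cont]) auto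
      then have "isCont (\<lambda>r. ?I r u) 0" by (simp add: continuous_on_eq_continuous_at)
      from isCont_tendsto_compose[OF this h] show "(\<lambda>n. ?I (h n) u) \<longlonglongrightarrow> ?I 0 u" .
    qed
    show "AE u in lborel. norm (?I (h n) u) \<le> indicator (cball 0 (s / c)) u * (C * (A ^ CARD('n) * B) ^ k)" for n
    proof (rule AE_I2)
      fix u
      show "norm (?I (h n) u) \<le> indicator (cball 0 (s / c)) u * (C * (A ^ CARD('n) * B) ^ k)"
      proof (cases "norm u \<le> s / c")
        case True
        define x where "x = t + h n *\<^sub>R u"
        have "norm (?I (h n) u) = f x * \<bar>\<alpha> (f x) ^ CARD('n) * K (\<alpha> (f x) *\<^sub>R u)\<bar> ^ k"
          unfolding x_def[symmetric] by (simp only: real_norm_def abs_mult[of "f x"] power_abs abs_of_nonneg[OF f_nonneg])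
        also have "\<dots> \<le> C * (A ^ CARD('n) * B) ^ k"
          using f_nonneg f_le order_trans[OF f_nonneg f_le] by (intro mult_mono power_mono summand_bound) auto
        finally have "norm (?I (h n) u) \<le> C * (A ^ CARD('n) * B) ^ k" .
        then show ?thesis using True by simp
      next
        case False
        then have "K (\<alpha> (f (t + h n *\<^sub>R u)) *\<^sub>R u) = 0" by (intro K_scaled_eq_0) simp
        then show ?thesis using False k by (simp add: zero_power)
      qed
    qed
  qed (use meas meas[of 0] in simp_all)
  also have "(\<integral>u. ?I 0 u \<partial>lborel) = f t * a ^ (CARD('n) * k) * (\<integral>u. K (a *\<^sub>R u) ^ k \<partial>lborel)"
    by (simp add: a_def power_mult_distrib power_mult mult.assoc[symmetric])
  also have "(\<integral>u. K (a *\<^sub>R u) ^ k \<partial>lborel) = (\<integral>u. K u ^ k \<partial>lborel) / a ^ CARD('n)"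
  proof -
    have "integrable lborel (\<lambda>u. K u ^ k)"
      by (rule continuous_compact_support_integrable[where S=s])
        (use k in \<open>auto intro!: continuous_intros K_cont simp: K_supp zero_power\<close>)
    from integral_lborel_affine[OF _ this, of a 0] a show ?thesis by (simp add: field_simps)
  qed
  finally show ?thesis by (simp add: a_def)
qed

text \<open>Two choices reduce this to \<open>square_root_law_bias\<close>: a radius so large that
  the rescaled kernel vanishes outside the ball, and \<open>h\<close> so small that the ball is
  mapped into the region \<open>b < f\<close>, where the bandwidth factor is the plain square
  root.\<close>

lemma smoothed_bias:
  assumes prof: "kernel_profile \<Phi> T" and K: "\<And>u. K u = \<Phi> ((norm u)\<^sup>2)"
    and K1: "has_bochner_integral lborel K 1"
    and f4: "C_partial 4 UNIV f" and b: "0 \<le> b" "b < f t" and root: "\<And>y. b \<le> y \<Longrightarrow> \<alpha> y = sqrt y"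
  shows "((\<lambda>h. (smoothed 1 h - f t) / h ^ 4) \<longlongrightarrow>
    (\<Sum>v | mi_abs v = 4. kernel_moment K v * multi_deriv v (\<lambda>x. 1 / f x) t / mi_fact v)) (at_right 0)"
    (is "(_ \<longlongrightarrow> ?\<beta>) _")
proof -
  have "0 < f t" using b by linarith
  from square_root_law_bias[where f=f and t=t, OF prof K K1 f4 this] obtain R0 where
    R0: "\<And>R. R0 \<le> R \<Longrightarrow> ((\<lambda>h. ((\<integral>u. indicator (cball 0 R) u *
      (sqrt (f (t + h *\<^sub>R u)) ^ (CARD('n) + 2) * K (sqrt (f (t + h *\<^sub>R u)) *\<^sub>R u)) \<partial>lborel) - f t) / h ^ 4) \<longlongrightarrow> ?\<beta>) (at_right 0)"
    by blast
  define R where "R = max 1 (max R0 (s / c))"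
  have R: "0 < R" "R0 \<le> R" "s / c \<le> R" by (auto simp: R_def)
  have "open {x. b < f x}" using f_cont by (intro open_Collect_less) auto
  then obtain d where d: "0 < d" "\<And>x. dist x t < d \<Longrightarrow> b < f x"
    using b(2) unfolding open_dist by auto
  have eq: "(\<integral>u. indicator (cball 0 R) u * (sqrt (f (t + h *\<^sub>R u)) ^ (CARD('n) + 2) * K (sqrt (f (t + h *\<^sub>R u)) *\<^sub>R u)) \<partial>lborel) = smoothed 1 h"
    if h: "0 < h" "h < d / R" for h
    unfolding smoothed_def
  proof (rule Bochner_Integration.integral_cong[OF refl])
    fix u :: "real^'n"
    show "indicator (cball 0 R) u * (sqrt (f (t + h *\<^sub>R u)) ^ (CARD('n) + 2) * K (sqrt (f (t + h *\<^sub>R u)) *\<^sub>R u))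
      = f (t + h *\<^sub>R u) * (\<alpha> (f (t + h *\<^sub>R u)) ^ CARD('n) * K (\<alpha> (f (t + h *\<^sub>R u)) *\<^sub>R u)) ^ 1"
    proof (cases "norm u \<le> R")
      case True
      have "h * norm u \<le> h * R" using True h by (intro mult_left_mono) auto
      also have "\<dots> < d" using h R by (simp add: field_simps)
      finally have "b < f (t + h *\<^sub>R u)" using h by (intro d) (simp add: dist_norm)
      then show ?thesis using True f_nonneg[of "t + h *\<^sub>R u"] by (simp add: root power_add)
    next
      case False
      then have "K (\<alpha> (f (t + h *\<^sub>R u)) *\<^sub>R u) = 0" using R by (intro K_scaled_eq_0) simp
      then show ?thesis using False by simp
    qed
  qed
  have "\<forall>\<^sub>F h in at_right 0. 0 < h \<and> h < d / R"
    unfolding eventually_at_right_field using d(1) R(1) by (intro exI[of _ "d / R"]) auto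
  then have "\<forall>\<^sub>F h in at_right 0. ((\<integral>u. indicator (cball 0 R) u *
      (sqrt (f (t + h *\<^sub>R u)) ^ (CARD('n) + 2) * K (sqrt (f (t + h *\<^sub>R u)) *\<^sub>R u)) \<partial>lborel) - f t) / h ^ 4 = (smoothed 1 h - f t) / h ^ 4"
    by eventually_elim (simp only: eq)
  then show ?thesis
    by (rule Lim_transform_eventually[OF R0[OF R(2)]])
qed

end

section \<open>Sampling: the central limit theorem for the estimator\<close>

lemma (in prob_space) expectation_density:
  assumes X: "distributed M lborel X (\<lambda>x. ennreal (f x))" and f: "\<And>x. 0 \<le> f x"
    and g: "continuous_on UNIV (g :: 'b::euclidean_space \<Rightarrow> real)"
  shows "expectation (\<lambda>\<omega>. g (X \<omega>)) = (\<integral>x. f x * g x \<partial>lborel)"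
  using distributed_integral[OF X, of g] f g by (simp add: borel_measurable_continuous_onI)

text \<open>The deterministic sequence \<open>b\<close> is carried along so that one statement
  serves both claims: zero for centring at the mean, the scaled bias for centring at
  \<open>f t\<close>. The condition that \<open>n * h n ^ CARD('n)\<close> tends to infinity makes
  the bound on the normalised summands vanish.\<close>

lemma (in prob_space) ideal_estimator_clt:
  fixes X :: "nat \<Rightarrow> 'a \<Rightarrow> real^'n::finite" and t :: "real^'n"
  assumes smoothing: "ideal_kernel_smoothing f K \<alpha> c s A B C"
    and indep: "indep_vars (\<lambda>_. borel) X UNIV"
    and X: "\<And>i. distributed M lborel (X i) (\<lambda>x. ennreal (f x))"
    and h_pos: "\<forall>n\<ge>1. 0 < h n" and h_0: "h \<longlonglongrightarrow> 0"
    and nh: "filterlim (\<lambda>n. real n * h n ^ CARD('n)) at_top sequentially"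
    and b: "b \<longlonglongrightarrow> m"
  defines "fbar \<equiv> (\<lambda>n \<omega>. ideal_estimator \<alpha> f K n (h n) (\<lambda>i. X i \<omega>) t)"
  shows "converges_in_distribution M
      (\<lambda>n \<omega>. sqrt (real n * h n ^ CARD('n)) * (fbar n \<omega> - expectation (fbar n)) + b n)
      (normal_law m (\<alpha> (f t) ^ CARD('n) * f t * (LINT u|lborel. (K u)\<^sup>2)))"
    and "\<forall>n\<ge>1. expectation (fbar n) = ideal_kernel_smoothing.smoothed f K \<alpha> t 1 (h n)"
proof -
  interpret ideal_kernel_smoothing f K \<alpha> c s A B C t by (rule smoothing)
  note h = h_pos[rule_format] h_0
  define Y where "Y n y = \<alpha> (f y) ^ CARD('n) * K ((inverse (h n) * \<alpha> (f y)) *\<^sub>R (t - y))" for n y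
  have Yc: "continuous_on UNIV (Y n)" for n
    unfolding Y_def by (rule summand_continuous)
  have Ym[measurable]: "Y n \<in> borel_measurable borel" for n
    using Yc by (rule borel_measurable_continuous_onI)
  have Xm[measurable]: "X i \<in> borel_measurable M" for i
    using indep by (simp add: indep_vars_def2)
  have Yb: "\<bar>Y n y\<bar> \<le> A ^ CARD('n) * B" for n y
    unfolding Y_def by (rule summand_bound)
  have intY: "integrable M (\<lambda>\<omega>. Y n (X i \<omega>) ^ k)" for n i k
    by (rule integrable_const_bound[where B="(A ^ CARD('n) * B) ^ k"])
      (use Yb in \<open>auto simp: power_abs intro!: power_mono\<close>)
  define m1 where "m1 n = (\<integral>y. f y * Y n y \<partial>lborel)" for n
  have EY: "expectation (\<lambda>\<omega>. Y n (X i \<omega>)) = m1 n" for n i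
    unfolding m1_def by (rule expectation_density[OF X f_nonneg Yc])
  define m2 where "m2 n = (\<integral>y. f y * Y n y ^ 2 \<partial>lborel)" for n
  have EY2: "expectation (\<lambda>\<omega>. Y n (X i \<omega>) ^ 2) = m2 n" for n i
    unfolding m2_def by (rule expectation_density[OF X f_nonneg]) (intro continuous_intros Yc)
  have m1: "m1 n = h n ^ CARD('n) * smoothed 1 (h n)" and m2: "m2 n = h n ^ CARD('n) * smoothed 2 (h n)" if "1 \<le> n" for n
    using integral_summand[OF h(1)[OF that], of 1] integral_summand[OF h(1)[OF that], of 2]
    by (simp_all add: m1_def m2_def Y_def)
  define N where "N n = sqrt (real n * h n ^ CARD('n))" for n
  have N2: "(N n)\<^sup>2 = real n * h n ^ CARD('n)" "0 < N n" if "1 \<le> n" for n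
    using h(1)[OF that] that by (auto simp: N_def)
  \<comment> \<open>Nothing is assumed about \<open>h 0\<close>. As \<open>N 0 = 0\<close> and
    division by zero gives 0, the row \<open>W 0\<close> vanishes, so requirements of
    \<open>triangular_array_clt\<close> stated for all \<open>n\<close> hold there too.\<close>
  have N0: "N 0 = 0" by (simp add: N_def)
  have Ninf: "filterlim N at_top sequentially"
    unfolding N_def by (rule filterlim_compose[OF sqrt_at_top nh])
  have fbar: "fbar n \<omega> = 1 / (real n * h n ^ CARD('n)) * (\<Sum>i<n. Y n (X i \<omega>))" for n \<omega>
    by (simp add: fbar_def ideal_estimator_def Y_def)
  have Efbar: "expectation (fbar n) = m1 n / h n ^ CARD('n)" if "1 \<le> n" for n
  proof -
    have "expectation (fbar n) = 1 / (real n * h n ^ CARD('n)) * (\<Sum>i<n. expectation (\<lambda>\<omega>. Y n (X i \<omega>)))"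
      unfolding fbar using intY[of n _ 1] by (subst integral_mult_right_zero, subst Bochner_Integration.integral_sum) simp_all
    then show ?thesis using that by (simp add: EY)
  qed
  show "\<forall>n\<ge>1. expectation (fbar n) = smoothed 1 (h n)"
  proof (intro allI impI)
    fix n :: nat assume n: "1 \<le> n"
    show "expectation (fbar n) = smoothed 1 (h n)"
      using h(1)[OF n] by (simp add: Efbar[OF n] m1[OF n])
  qed
  define W where "W n i \<omega> = (Y n (X i \<omega>) - m1 n) / N n" for n i \<omega>
  define v where "v n = (m2 n - (m1 n)\<^sup>2) / (N n)\<^sup>2" for n
  have sum_W: "(\<Sum>i<n. W n i \<omega>) = N n * (fbar n \<omega> - expectation (fbar n))" for n \<omega>
  proof (cases "n = 0")
    case False
    then have n: "1 \<le> n" by simp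
    have hd: "0 < h n ^ CARD('n)" using h(1)[OF n] by simp
    have "N n * (\<Sum>i<n. W n i \<omega>) = (\<Sum>i<n. Y n (X i \<omega>)) - real n * m1 n"
      using N2[OF n] by (simp add: W_def sum_distrib_left sum_subtractf)
    also have "\<dots> = (N n)\<^sup>2 * (fbar n \<omega> - expectation (fbar n))"
      unfolding N2(1)[OF n] Efbar[OF n] fbar using h(1)[OF n] n by (simp add: right_diff_distrib)
    finally show ?thesis using N2(2)[OF n] by (simp add: power2_eq_square)
  qed (simp add: N0)
  have "weak_conv_m (\<lambda>n. distr M borel (\<lambda>\<omega>. (\<Sum>i<n. W n i \<omega>) + b n)) (normal_law m (\<alpha> (f t) ^ CARD('n) * f t * (LINT u|lborel. (K u)\<^sup>2)))"
  proof (rule triangular_array_clt[where v=v and \<epsilon>="\<lambda>n. (A ^ CARD('n) * B + \<bar>m1 n\<bar>) / N n"])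
    show "indep_vars (\<lambda>_. borel) (W n) UNIV" for n
      unfolding W_def by (rule indep_vars_compose2[OF indep]) measurable
    show "expectation (W n i) = 0" for n i
      unfolding W_def using EY[of n i] intY[of n i 1] by (simp add: prob_space)
    show "\<bar>W n i \<omega>\<bar> \<le> (A ^ CARD('n) * B + \<bar>m1 n\<bar>) / N n" for n i \<omega>
    proof -
      have "0 \<le> N n" using N2(2)[of n] N0 by (cases n) (auto intro: less_imp_le)
      moreover have "\<bar>Y n (X i \<omega>) - m1 n\<bar> \<le> A ^ CARD('n) * B + \<bar>m1 n\<bar>"
        using Yb[of n "X i \<omega>"] by linarith
      ultimately show ?thesis by (simp add: W_def divide_right_mono)
    qed
    show "expectation (\<lambda>\<omega>. (W n i \<omega>)\<^sup>2) = v n" for n i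
    proof -
      have "expectation (\<lambda>\<omega>. (W n i \<omega>)\<^sup>2) = expectation (\<lambda>\<omega>. (Y n (X i \<omega>) ^ 2 - 2 * m1 n * Y n (X i \<omega>) + (m1 n)\<^sup>2) / (N n)\<^sup>2)"
        by (simp add: W_def power_divide power2_diff algebra_simps)
      also have "\<dots> = (m2 n - 2 * m1 n * m1 n + (m1 n)\<^sup>2) / (N n)\<^sup>2"
        using intY[of n i 1] intY[of n i 2] by (simp add: EY EY2 prob_space)
      also have "\<dots> = v n"
        by (simp add: v_def power2_eq_square)
      finally show ?thesis .
    qed
    have h_pow: "(\<lambda>n. h n ^ CARD('n)) \<longlonglongrightarrow> 0"
      using tendsto_power[OF h(2), of "CARD('n)"] by (simp add: zero_power)
    define L1 where "L1 = f t * \<alpha> (f t) ^ (CARD('n) * 1) / \<alpha> (f t) ^ CARD('n) * (LINT u|lborel. K u ^ 1)"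
    have s1: "(\<lambda>n. smoothed 1 (h n)) \<longlonglongrightarrow> L1"
      unfolding L1_def by (rule smoothed_tendsto[OF h(2)]) simp
    have "f t * \<alpha> (f t) ^ (CARD('n) * 2) / \<alpha> (f t) ^ CARD('n) * (LINT u|lborel. (K u)\<^sup>2)
        = \<alpha> (f t) ^ CARD('n) * f t * (LINT u|lborel. (K u)\<^sup>2)"
      using \<alpha>_pos[of "f t"] by (simp add: power_mult power2_eq_square)
    then have s2: "(\<lambda>n. smoothed 2 (h n)) \<longlonglongrightarrow> \<alpha> (f t) ^ CARD('n) * f t * (LINT u|lborel. (K u)\<^sup>2)"
      using smoothed_tendsto[OF h(2), of 2] by simp
    \<comment> \<open>For \<open>n\<close> at least 1 this is \<open>n * v n\<close>; the squared
      mean carries an extra factor \<open>h n ^ CARD('n)\<close> and disappears in the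
      limit.\<close>
    have "(\<lambda>n. smoothed 2 (h n) - h n ^ CARD('n) * (smoothed 1 (h n))\<^sup>2) \<longlonglongrightarrow>
        \<alpha> (f t) ^ CARD('n) * f t * (LINT u|lborel. (K u)\<^sup>2) - 0 * L1\<^sup>2"
      by (intro tendsto_diff tendsto_mult tendsto_power s1 s2 h_pow)
    also have "\<alpha> (f t) ^ CARD('n) * f t * (LINT u|lborel. (K u)\<^sup>2) - 0 * L1\<^sup>2 = \<alpha> (f t) ^ CARD('n) * f t * (LINT u|lborel. (K u)\<^sup>2)"
      by simp
    finally show "(\<lambda>n. real n * v n) \<longlonglongrightarrow> \<alpha> (f t) ^ CARD('n) * f t * (LINT u|lborel. (K u)\<^sup>2)"
    proof (rule Lim_transform_eventually)
      show "\<forall>\<^sub>F n in sequentially. smoothed 2 (h n) - h n ^ CARD('n) * (smoothed 1 (h n))\<^sup>2 = real n * v n"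
      proof (rule eventually_sequentiallyI)
        fix n :: nat assume n: "1 \<le> n"
        show "smoothed 2 (h n) - h n ^ CARD('n) * (smoothed 1 (h n))\<^sup>2 = real n * v n"
          unfolding v_def N2(1)[OF n] m1[OF n] m2[OF n] using h(1)[OF n] n by (simp add: field_simps power2_eq_square)
      qed
    qed
    have "(\<lambda>n. A ^ CARD('n) * B + \<bar>h n ^ CARD('n) * smoothed 1 (h n)\<bar>) \<longlonglongrightarrow> A ^ CARD('n) * B + \<bar>0 * L1\<bar>"
      by (intro tendsto_add tendsto_const tendsto_rabs tendsto_mult s1 h_pow)
    from tendsto_divide_0[OF this filterlim_at_top_imp_at_infinity[OF Ninf]]
    show "(\<lambda>n. (A ^ CARD('n) * B + \<bar>m1 n\<bar>) / N n) \<longlonglongrightarrow> 0"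
      by (rule Lim_transform_eventually) (auto simp: m1 intro!: eventually_sequentiallyI[of 1])
  qed (rule b)
  then show "converges_in_distribution M
      (\<lambda>n \<omega>. sqrt (real n * h n ^ CARD('n)) * (fbar n \<omega> - expectation (fbar n)) + b n)
      (normal_law m (\<alpha> (f t) ^ CARD('n) * f t * (LINT u|lborel. (K u)\<^sup>2)))"
    by (simp add: converges_in_distribution_def sum_W N_def)
qed

section \<open>The clipped square root law and the two limit laws\<close>

lemma bandwidth_factor_props:
  assumes "0 < c" "clipping_function p t0"
  shows "continuous_on UNIV (bandwidth_factor c p)" "c \<le> bandwidth_factor c p y"
    "y \<le> z \<Longrightarrow> bandwidth_factor c p y \<le> bandwidth_factor c p z"
    "t0 * c\<^sup>2 \<le> y \<Longrightarrow> bandwidth_factor c p y = sqrt y"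
proof -
  have p: "mono p" "\<And>x. 1 \<le> p x" "\<And>x. t0 \<le> x \<Longrightarrow> p x = x"
    using assms(2) by (auto simp: clipping_function_def)
  \<comment> \<open>The clause \<open>j = 0\<close> of the definition is differentiability of
    \<open>p\<close> itself.\<close>
  have "\<forall>x. ((deriv ^^ 0) p) differentiable (at x)"
    using assms(2) unfolding clipping_function_def by (meson zero_less_numeral)
  then have pc: "continuous_on UNIV p"
    by (auto simp: continuous_on_eq_continuous_at intro: differentiable_imp_continuous_within)
  then show "continuous_on UNIV (bandwidth_factor c p)"
    unfolding bandwidth_factor_def[abs_def] using assms(1)
    by (intro continuous_intros continuous_on_compose2[OF pc]) auto
  show "c \<le> bandwidth_factor c p y"
    using p(2)[of "y / c\<^sup>2"] assms(1) by (simp add: bandwidth_factor_def)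
  show "y \<le> z \<Longrightarrow> bandwidth_factor c p y \<le> bandwidth_factor c p z"
    using assms(1) p(1) by (auto simp: bandwidth_factor_def divide_right_mono monoD)
  show "bandwidth_factor c p y = sqrt y" if "t0 * c\<^sup>2 \<le> y"
  proof -
    have "p (y / c\<^sup>2) = y / c\<^sup>2" using that assms(1) by (intro p(3)) (simp add: field_simps)
    then show ?thesis using assms(1) by (simp add: bandwidth_factor_def real_sqrt_divide)
  qed
qed

theorem mainTheorem2:
  fixes M :: "'w measure"
    and X :: "nat \<Rightarrow> 'w \<Rightarrow> real^'n::finite"
    and f K :: "real^'n \<Rightarrow> real"
    and \<Phi> p \<alpha> :: "real \<Rightarrow> real"
    and C T c t0 \<mu>0 :: real
    and h :: "nat \<Rightarrow> real"
    and fbar :: "nat \<Rightarrow> real^'n \<Rightarrow> 'w \<Rightarrow> real"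
  assumes "prob_space M"
    and "prob_space.indep_vars M (\<lambda>_. borel) X UNIV"
    and "\<And>i. distributed M lborel (X i) (\<lambda>x. ennreal (f x))"
    and "f \<in> density_class C 4"
    and "kernel_profile \<Phi> T"
    and "\<And>u. K u = \<Phi> ((norm u)\<^sup>2)"
    and "\<And>u. 0 \<le> K u"
    and "has_bochner_integral lborel K 1"
    and "0 < c"
    and "clipping_function p t0"
    and "\<And>n. 1 \<le> n \<Longrightarrow> 0 < h n"
    and "h \<longlonglongrightarrow> 0"
    and "filterlim (\<lambda>n. real n * h n ^ CARD('n)) at_top sequentially"
  defines "\<alpha> \<equiv> bandwidth_factor c p"
    and "\<mu>0 \<equiv> (LINT u|lborel. (K u)\<^sup>2)"
    and "fbar \<equiv> (\<lambda>n t \<omega>. ideal_estimator \<alpha> f K n (h n) (\<lambda>i. X i \<omega>) t)"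
  shows "(\<forall>t. converges_in_distribution M
            (\<lambda>n \<omega>. sqrt (real n * h n ^ CARD('n)) * (fbar n t \<omega> - prob_space.expectation M (fbar n t)))
            (normal_law 0 (\<alpha> (f t) ^ CARD('n) * f t * \<mu>0)))
       \<and> (\<forall>c2>0. (\<forall>n\<ge>1. h n = c2 * real n powr (- 1 / (8 + real CARD('n)))) \<longrightarrow>
            (\<forall>r>0. \<forall>t\<in>good_region f t0 c r. converges_in_distribution M
              (\<lambda>n \<omega>. sqrt (real n * h n ^ CARD('n)) * (fbar n t \<omega> - f t))
              (normal_law
                (c2 powr ((real CARD('n) + 8) / 2) *
                   (\<Sum>v\<in>{v::'n \<Rightarrow> nat. mi_abs v = 4}.
                      kernel_moment K v * multi_deriv v (\<lambda>x. 1 / f x) t / mi_fact v))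
                (\<alpha> (f t) ^ CARD('n) * f t * \<mu>0))))"
proof -
  interpret prob_space M by fact
  note dens = assms(4)
  have f4: "C_partial 4 UNIV f" by (rule density_class_C_partial[OF dens])
  have f0: "0 \<le> f x" for x using dens by (simp add: density_class_def)
  have "length ([] :: 'n list) \<le> 4 \<longrightarrow> (\<forall>x. \<bar>iter_partial [] f x\<bar> \<le> C) \<and> uniformly_continuous_on UNIV (iter_partial [] f)"
    using dens unfolding density_class_def by blast
  then have fC: "f x \<le> C" for x by (simp add: abs_le_iff)
  obtain \<Lambda> B S where S: "0 < S" "\<And>s. S \<le> s \<Longrightarrow> \<Phi> s = 0" and \<Phi>B: "\<And>s. 0 \<le> s \<Longrightarrow> \<bar>\<Phi> s\<bar> \<le> B"
    by (rule kernel_profile_lipschitz[OF assms(5)]) blast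
  note bw = bandwidth_factor_props[OF assms(9,10), folded \<alpha>_def]
  \<comment> \<open>The support radius is \<open>sqrt S\<close> because \<open>\<Phi>\<close> is
    evaluated at the squared norm; \<open>\<alpha> C\<close> bounds the bandwidth factors since
    \<open>\<alpha>\<close> is nondecreasing and \<open>f\<close> is at most
    \<open>C\<close>.\<close>
  have smoothing: "ideal_kernel_smoothing f K \<alpha> c (sqrt S) (\<alpha> C) B C"
  proof
    show "continuous_on UNIV K" by (rule continuous_on_kernel[OF assms(5,6)])
    show "K u = 0" if "sqrt S \<le> norm u" for u
    proof -
      have "(sqrt S)\<^sup>2 \<le> (norm u)\<^sup>2" using that S by (intro power_mono) auto
      then show ?thesis using S by (simp add: assms(6))
    qed
    show "\<bar>K u\<bar> \<le> B" for u using \<Phi>B[of "(norm u)\<^sup>2"] by (simp add: assms(6))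
  qed (use C_partial_continuous[OF f4] f0 fC bw assms(6,9) in auto)
  have "\<forall>n\<ge>1. 0 < h n" using assms(11) by blast
  note clt = ideal_estimator_clt[OF smoothing assms(2,3) this assms(12,13)]
  have "converges_in_distribution M
      (\<lambda>n \<omega>. sqrt (real n * h n ^ CARD('n)) * (fbar n t \<omega> - expectation (fbar n t)))
      (normal_law 0 (\<alpha> (f t) ^ CARD('n) * f t * \<mu>0))" for t
    using clt(1)[where t=t, OF tendsto_const[of 0]] by (simp add: fbar_def \<mu>0_def)
  moreover have "converges_in_distribution M
      (\<lambda>n \<omega>. sqrt (real n * h n ^ CARD('n)) * (fbar n t \<omega> - f t))
      (normal_law (c2 powr ((real CARD('n) + 8) / 2) *
        (\<Sum>v\<in>{v::'n \<Rightarrow> nat. mi_abs v = 4}. kernel_moment K v * multi_deriv v (\<lambda>x. 1 / f x) t / mi_fact v))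
        (\<alpha> (f t) ^ CARD('n) * f t * \<mu>0))"
    if c2: "0 < c2" and hn: "\<forall>n\<ge>1. h n = c2 * real n powr (- 1 / (8 + real CARD('n)))"
      and t: "t \<in> good_region f t0 c r" for c2 r t
  proof -
    interpret sm: ideal_kernel_smoothing f K \<alpha> c "sqrt S" "\<alpha> C" B C t by (rule smoothing)
    define \<beta> where "\<beta> = (\<Sum>v\<in>{v::'n \<Rightarrow> nat. mi_abs v = 4}. kernel_moment K v * multi_deriv v (\<lambda>x. 1 / f x) t / mi_fact v)"
    define b where "b n = sqrt (real n * h n ^ CARD('n)) * (expectation (fbar n t) - f t)" for n
    have "1 \<le> t0" using assms(10) by (simp add: clipping_function_def)
    then have t0c: "0 \<le> t0 * c\<^sup>2" "t0 * c\<^sup>2 < f t" using t by (auto simp: good_region_def)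
    have lim: "((\<lambda>h. (sm.smoothed 1 h - f t) / h ^ 4) \<longlongrightarrow> \<beta>) (at_right 0)"
      unfolding \<beta>_def by (rule sm.smoothed_bias[OF assms(5,6,8) f4 t0c bw(4)])
    have "filterlim h (at_right 0) sequentially"
      unfolding filterlim_at using assms(12) eventually_sequentiallyI[of 1 "\<lambda>n. 0 < h n", OF assms(11)]
      by (auto elim: eventually_mono)
    \<comment> \<open>The exponent \<open>- 1 / (8 + d)\<close> makes
      \<open>sqrt (n * h^d) * h^4\<close> equal to the constant \<open>c2 powr ((d + 8) / 2)\<close>
      for every \<open>n\<close> at least 1. The scaled bias is therefore this constant times the
      quotient treated by \<open>smoothed_bias\<close>.\<close>
    from tendsto_mult[OF tendsto_const[of "c2 powr ((real CARD('n) + 8) / 2)"] filterlim_compose[OF lim this]]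
    have blim: "b \<longlonglongrightarrow> c2 powr ((real CARD('n) + 8) / 2) * \<beta>"
    proof (rule Lim_transform_eventually)
      show "\<forall>\<^sub>F n in sequentially. c2 powr ((real CARD('n) + 8) / 2) * ((sm.smoothed 1 (h n) - f t) / h n ^ 4) = b n"
      proof (rule eventually_sequentiallyI)
        fix n :: nat assume n: "1 \<le> n"
        have h0: "0 < h n" using assms(11)[OF n] .
        have n0: "0 < real n" using n by simp
        have h_eq: "h n = c2 * real n powr (- 1 / (8 + real CARD('n)))" using hn n by blast
        have "h n powr (real CARD('n) + 8) = c2 powr (real CARD('n) + 8) * real n powr (- 1)"
        proof -
          have "0 < 8 + real CARD('n)" by (rule add_pos_nonneg) simp_all
          then have ex: "- 1 / (8 + real CARD('n)) * (real CARD('n) + 8) = - 1" by (simp add: field_simps)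
          have "h n powr (real CARD('n) + 8) = c2 powr (real CARD('n) + 8) * (real n powr (- 1 / (8 + real CARD('n)))) powr (real CARD('n) + 8)"
            unfolding h_eq by (rule powr_mult)
          then show ?thesis by (simp only: powr_powr ex)
        qed
        then have "real n * h n powr (real CARD('n) + 8) = c2 powr (real CARD('n) + 8)"
          using n0 by (simp add: powr_minus field_simps)
        moreover have "h n powr (real CARD('n) + 8) = h n ^ CARD('n) * (h n ^ 4)\<^sup>2"
          using h0 powr_realpow[of "h n" "CARD('n) + 8"] by (simp add: power_add power_mult[symmetric])
        ultimately have "real n * h n ^ CARD('n) * (h n ^ 4)\<^sup>2 = c2 powr (real CARD('n) + 8)"
          by (simp add: mult.assoc)
        then have "sqrt (real n * h n ^ CARD('n) * (h n ^ 4)\<^sup>2) = sqrt (c2 powr (real CARD('n) + 8))" by simp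
        moreover have "sqrt (real n * h n ^ CARD('n) * (h n ^ 4)\<^sup>2) = sqrt (real n * h n ^ CARD('n)) * h n ^ 4"
          using h0 by (subst real_sqrt_mult, subst real_sqrt_abs) simp
        moreover have "sqrt (c2 powr (real CARD('n) + 8)) = c2 powr ((real CARD('n) + 8) / 2)"
          by (simp add: powr_half_sqrt[symmetric] powr_powr)
        ultimately have eq: "sqrt (real n * h n ^ CARD('n)) * h n ^ 4 = c2 powr ((real CARD('n) + 8) / 2)"
          by simp
        then show "c2 powr ((real CARD('n) + 8) / 2) * ((sm.smoothed 1 (h n) - f t) / h n ^ 4) = b n"
          unfolding b_def eq[symmetric] using h0 clt(2)[where t=t, OF tendsto_const] n by (simp add: fbar_def)
      qed
    qed
    have "(\<lambda>n \<omega>. sqrt (real n * h n ^ CARD('n)) * (fbar n t \<omega> - expectation (fbar n t)) + b n)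
      = (\<lambda>n \<omega>. sqrt (real n * h n ^ CARD('n)) * (fbar n t \<omega> - f t))"
      by (simp add: b_def fun_eq_iff algebra_simps)
    with clt(1)[where t=t, OF blim] show ?thesis
      by (simp add: fbar_def \<mu>0_def \<beta>_def)
  qed
  ultimately show ?thesis by blast
qed

end
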